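(* Let $\alpha>0$ be fixed and let $c<1/\sqrt{2}$. Then for every sufficiently large $N\geq 1$ (depending on $\alpha$ and $c$), \[ \max_{\sqrt{N}\leq \ell\leq N\log N}\left|\zeta\left(\tfrac12+i\alpha\ell\right)\right|\;\geq\;\exp\left(c\sqrt{\frac{\log N\,\log\log\log N}{\log\log N}}\right), \] where the maximum is over integers $\ell$ in the indicated range.
   Context: $\zeta$ denotes the Riemann zeta function. *)

theory Defs
  imports "HOL-Analysis.Analysis"
begin

text \<open>Dirichlet eta function: the (conditionally convergent for Re s > 0) alternating series
  sum_{n>=1} (-1)^(n-1) n^(-s), taken as the limit of its partial sums.\<close>
definition dirichlet_eta :: "complex \<Rightarrow> complex" where
  "dirichlet_eta s = lim (\<lambda>N. \<Sum>n=1..N. (-1)^(n-1) / (of_nat n) powr s)"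

text \<open>Riemann zeta function in the half-plane Re s > 0 (s \<noteq> 1 and 2^(1-s) \<noteq> 1), via its
  standard analytic continuation zeta(s) = eta(s) / (1 - 2^(1-s)). On the critical line
  Re s = 1/2 the denominator never vanishes, so this is the genuine zeta there.\<close>
definition riemann_zeta :: "complex \<Rightarrow> complex" where
  "riemann_zeta s = dirichlet_eta s / (1 - 2 powr (1 - s))"

end

theory Submission
  imports Defs "HOL-Number_Theory.Prime_Powers" "HOL-Library.Log_Nat" "HOL-Real_Asymp.Real_Asymp"
begin

text \<open>
  The proof is a resonance argument in the style of Bondarenko and Seip, carried out on an
  arithmetic progression. On the critical line the zeta function is approximated, up to a bounded
  error and a polar term, by a smoothed partial sum \<open>P\<close> of its Dirichlet series of length slightly
  above \<open>N\<close>, whose coefficients are nonnegative. For a resonator \<open>R\<close> the sum of \<open>P |R|\<^sup>2\<close> over the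
  points \<open>\<alpha> l\<close> with \<open>|l| < N\<close>, weighted by a Fejer kernel, is a sum of nonnegative terms, and
  keeping only the exact coincidences \<open>k m = n\<close> bounds it from below by a GCD-type sum over the support
  of the resonator. From above it is bounded by the maximum of \<open>|P|\<close> over \<open>l \<ge> \<surd>N\<close> times the
  mean square of \<open>R\<close>, plus the contribution of \<open>l < \<surd>N\<close>, which is negligible by a mean square bound for
  \<open>P\<close> as soon as the resonator has at most \<open>N\<close> to the power \<open>1/2 - \<epsilon>\<close> elements; this is the origin of
  the constant \<open>1/\<surd>2\<close>. The resonator lives on products of primes taken from consecutive blocks
  of bounded logarithmic length just above \<open>log N log log N\<close>, with a bounded number of primes from
  each block. Because the blocks may be chosen long, Mertens' first theorem replaces the prime number theorem.
\<close>

section \<open>Truncations of the zeta function\<close>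

text \<open>Zeta enters only through the alternating eta series, whose terms decay too slowly for a
  direct cut near |t|. Differencing the terms K times makes the tail bounded once the cut is of
  order |t|^(1 + 1/(K-1)). Passing from eta back to zeta costs a polar term of size sqrt X / |t|,
  which at |t| = sqrt N is still a positive power of N; averaging over the length of the truncation
  gains a further factor 1/|t| and keeps the coefficients nonnegative. The mean square of a sum
  longer than N, taken over only sqrt N points, is too large: Cauchy-Schwarz would give about
  N^(3/4). For l < sqrt N the sum is therefore exchanged, through zeta itself, for one of length
  about N^(1/2 + \<epsilon>); the short range then contributes sqrt N, up to N^(2\<epsilon>), times
  the size of the resonator. A resonator with about N^\<kappa> elements gains nearly sqrt (\<kappa>
  log N log log log N / log log N) in the exponent, so the admissible range \<kappa> < 1/2 becomes c
  < 1 / sqrt 2.\<close>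

lemma norm_diff_unit_step_le:
  fixes f f' :: "complex \<Rightarrow> complex" and x B :: real
  assumes "\<And>y. x \<le> y \<Longrightarrow> y \<le> x + 1 \<Longrightarrow> (f has_field_derivative f' (of_real y)) (at (of_real y))"
    and "\<And>y. x \<le> y \<Longrightarrow> y \<le> x + 1 \<Longrightarrow> norm (f' (of_real y)) \<le> B"
  shows "norm (f (of_real (x + 1)) - f (of_real x)) \<le> B"
proof -
  let ?S = "closed_segment (of_real x :: complex) (of_real (x + 1))"
  have S: "?S = of_real ` {x..x+1}"
    by (simp only: closed_segment_of_real) (simp add: closed_segment_eq_real_ivl)
  have "norm (f (of_real (x + 1)) - f (of_real x)) \<le> B * norm (of_real (x + 1) - of_real x :: complex)"
  proof (rule field_differentiable_bound[where S = ?S and f' = f'])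
    show "convex ?S" by simp
    show "(f has_field_derivative f' z) (at z within ?S)" if "z \<in> ?S" for z
      using assms(1) that unfolding S by (auto intro: has_field_derivative_at_within)
    show "norm (f' z) \<le> B" if "z \<in> ?S" for z
      using assms(2) that unfolding S by auto
  qed (auto simp del: of_real_add)
  thus ?thesis by (simp add: norm_of_real[symmetric] del: norm_of_real)
qed

section \<open>Iterated differences of powers and the Euler transform of the eta series\<close>

fun powr_fdiff :: "nat \<Rightarrow> complex \<Rightarrow> complex \<Rightarrow> complex" where
  "powr_fdiff 0 s z = z powr (-s)"
| "powr_fdiff (Suc i) s z = powr_fdiff i s z - powr_fdiff i s (z + 1)"

lemma has_field_derivative_powr_fdiff:
  assumes "Re z > 0"
  shows "(powr_fdiff i s has_field_derivative -s * powr_fdiff i (s + 1) z) (at z)"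
  using assms
proof (induction i arbitrary: z)
  case 0
  have nz: "z \<notin> \<real>\<^sub>\<le>\<^sub>0" using 0 by (auto simp: complex_nonpos_Reals_iff)
  have eq: "-s - 1 = -(s + 1)" "powr_fdiff 0 s = (\<lambda>z. z powr (-s))" by (auto simp: fun_eq_iff)
  show ?case
    unfolding eq(2) using has_field_derivative_powr[OF nz, of "-s"] unfolding eq(1) by simp
next
  case (Suc i)
  have 1: "(powr_fdiff i s has_field_derivative -s * powr_fdiff i (s + 1) z) (at z)"
    using Suc by simp
  have "(powr_fdiff i s has_field_derivative -s * powr_fdiff i (s + 1) (z + 1)) (at (z + 1))"
    using Suc by simp
  hence 2: "((\<lambda>z. powr_fdiff i s (z + 1)) has_field_derivative -s * powr_fdiff i (s + 1) (z + 1)) (at z)"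
    by (subst (asm) DERIV_shift)
  have "((\<lambda>z. powr_fdiff i s z - powr_fdiff i s (z + 1)) has_field_derivative
      -s * powr_fdiff i (s + 1) z - -s * powr_fdiff i (s + 1) (z + 1)) (at z)"
    by (intro DERIV_diff 1 2)
  thus ?case by (simp add: algebra_simps)
qed

lemma pochhammer_mono_real:
  fixes a b :: real
  assumes "0 \<le> a" "a \<le> b"
  shows "pochhammer a n \<le> pochhammer b n"
  unfolding pochhammer_prod using assms by (intro prod_mono) auto

text \<open>A difference is bounded by the derivative on a unit step, and differentiation replaces
  \<open>s\<close> by \<open>s + 1\<close>. Each round therefore gains a factor 1/x and costs the
  next factor of the rising factorial of |s|.\<close>

lemma norm_powr_fdiff_le:
  assumes "x > 0" "Re s \<ge> 0"
  shows "norm (powr_fdiff i s (of_real x)) \<le> pochhammer (norm s) i * x powr (-Re s - i)"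
  using assms
proof (induction i arbitrary: s x)
  case 0
  thus ?case by (simp add: norm_powr_real_powr)
next
  case (Suc i)
  have "norm (powr_fdiff i s (of_real (x + 1)) - powr_fdiff i s (of_real x)) \<le>
      norm s * (pochhammer (norm s + 1) i * x powr (-Re s - 1 - i))"
  proof (rule norm_diff_unit_step_le)
    fix y assume y: "x \<le> y" "y \<le> x + 1"
    show "(powr_fdiff i s has_field_derivative -s * powr_fdiff i (s + 1) (of_real y)) (at (of_real y))"
      using Suc.prems y by (intro has_field_derivative_powr_fdiff) auto
    have "norm (powr_fdiff i (s + 1) (of_real y)) \<le> pochhammer (norm (s + 1)) i * y powr (-Re (s + 1) - i)"
      using Suc.prems y by (intro Suc.IH) auto
    also have "\<dots> \<le> pochhammer (norm s + 1) i * x powr (-Re s - 1 - i)"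
      using Suc.prems y norm_triangle_ineq[of s 1]
      by (intro mult_mono pochhammer_mono_real) (auto intro!: powr_mono2' pochhammer_nonneg add_nonneg_pos)
    finally show "norm (-s * powr_fdiff i (s + 1) (of_real y)) \<le>
        norm s * (pochhammer (norm s + 1) i * x powr (-Re s - 1 - i))"
      by (simp add: norm_mult mult_left_mono)
  qed
  thus ?case
    by (simp add: norm_minus_commute pochhammer_rec add.commute algebra_simps)
qed

text \<open>One round of the Euler transform. Summation by parts expresses twice the alternating sum
  as its first term plus the alternating sum of the differences, up to a boundary term that tends to
  0. Convergence is thus inherited from the differences, which decay faster.\<close>

lemma alternating_sums_halving:
  fixes a :: "nat \<Rightarrow> complex"
  assumes lim: "a \<longlonglongrightarrow> 0" and sums: "(\<lambda>n. (-1)^n * (a n - a (Suc n))) sums d"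
  shows "(\<lambda>n. (-1)^n * a n) sums ((a 0 + d) / 2)"
proof -
  have eq: "(\<Sum>k<n. (-1)^k * a k) = (a 0 - (-1)^n * a n + (\<Sum>k<n. (-1)^k * (a k - a (Suc k)))) / 2" for n
    by (induction n) (auto simp: field_simps)
  have "(\<lambda>n. (-1)^n * a n) \<longlonglongrightarrow> 0"
    using lim by (subst tendsto_norm_zero_iff[symmetric]) (simp add: norm_mult norm_power tendsto_norm_zero_iff)
  hence "(\<lambda>n. (a 0 - (-1)^n * a n + (\<Sum>k<n. (-1)^k * (a k - a (Suc k)))) / 2) \<longlonglongrightarrow> (a 0 - 0 + d) / 2"
    using sums unfolding sums_def by (intro tendsto_intros) auto
  thus ?thesis unfolding sums_def eq by simp
qed

lemma pochhammer_le_power: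
  fixes a :: real
  assumes "0 \<le> a" "i \<le> n"
  shows "pochhammer a i \<le> (a + n) ^ i"
proof -
  have "pochhammer a i \<le> (\<Prod>j\<in>{0..<i}. a + n)"
    unfolding pochhammer_prod using assms by (intro prod_mono) auto
  thus ?thesis by simp
qed

text \<open>The Euler transform is applied \<open>K\<close> times, after which the series converges
  absolutely. The hypothesis on \<open>M\<close> makes the \<open>K\<close>-th differences at most
  \<open>real (Suc n) powr (-3/2)\<close>, so the bound is independent of \<open>s\<close>,
  \<open>K\<close> and \<open>M\<close>. It asks \<open>M\<close> to be at least |s| + K to the
  power K/(K-1), an exponent that tends to 1 as \<open>K\<close> grows.\<close>

lemma alternating_powr_tail:
  fixes s :: complex and K M :: nat
  assumes "Re s = 1/2" "K \<ge> 2" "(norm s + K) ^ K \<le> real M ^ (K - 1)"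
  obtains t where "(\<lambda>n. (-1)^n * of_nat (M + n) powr (-s)) sums t"
    "norm t \<le> 1 + (\<Sum>n. real (Suc n) powr (-3/2))"
proof -
  define Z where "Z = (\<Sum>n. real (Suc n) powr (-3/2))"
  have sZ: "summable (\<lambda>n. real (Suc n) powr (-3/2))"
    by (subst summable_Suc_iff) (simp add: summable_real_powr_iff)
  have Z0: "Z \<ge> 0" unfolding Z_def by (intro suminf_nonneg sZ) auto
  have b1: "norm s + K \<ge> 1" using assms(2) norm_ge_zero[of s] by linarith
  have "(norm s + K) ^ (K - 1) \<le> (norm s + K) ^ K"
    using b1 by (intro power_increasing) auto
  also note assms(3)
  finally have MK: "norm s + K \<le> M"
    using b1 assms(2) by (subst (asm) power_mono_iff) auto
  hence M1: "real M \<ge> 1" using b1 by linarith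
  define a where "a = (\<lambda>i n. powr_fdiff i s (of_nat (M + n)))"
  have a_bound: "norm (a i n) \<le> pochhammer (norm s) i * real (M + n) powr (-1/2 - i)" for i n
    using norm_powr_fdiff_le[of "real (M + n)" s i] assms(1) M1 unfolding a_def by auto
  have a_rec: "a (Suc i) n = a i n - a i (Suc n)" for i n
    unfolding a_def by (simp add: add_ac)
  have a_lim: "a i \<longlonglongrightarrow> 0" for i
  proof (rule Lim_null_comparison[OF eventuallyI])
    show "norm (a i n) \<le> pochhammer (norm s) i * real (M + n) powr (-1/2 - i)" for n by (rule a_bound)
    show "(\<lambda>n. pochhammer (norm s) i * real (M + n) powr (-1/2 - i)) \<longlonglongrightarrow> 0"
      by real_asymp
  qed
  have top: "\<exists>t. (\<lambda>n. (-1)^n * a K n) sums t \<and> norm t \<le> Z"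
  proof -
    have le: "norm ((-1)^n * a K n) \<le> real (Suc n) powr (-3/2)" for n
    proof -
      have "norm ((-1)^n * a K n) \<le> pochhammer (norm s) K * real (M + n) powr (-1/2 - K)"
        using a_bound[of K n] by (simp add: norm_mult norm_power)
      \<comment> \<open>The exponent is split: -3/2 provides summability in \<open>n\<close>, and
        the remaining \<open>K - 1\<close> powers are estimated at \<open>M\<close>, where they
        cancel the Pochhammer factor.\<close>
      also have "real (M + n) powr (-1/2 - K) = real (M + n) powr (-3/2) * real (M + n) powr (- real (K - 1))"
        using assms(2) by (simp add: powr_add[symmetric] of_nat_diff)
      also have "\<dots> \<le> real (Suc n) powr (-3/2) * real M powr (- real (K - 1))"
        using M1 by (intro mult_mono powr_mono2') auto
      also have "real M powr (- real (K - 1)) = 1 / real M ^ (K - 1)"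
        using M1 by (simp add: powr_minus powr_realpow field_simps)
      also have "pochhammer (norm s) K * (real (Suc n) powr (-3/2) * (1 / real M ^ (K - 1))) =
          real (Suc n) powr (-3/2) * (pochhammer (norm s) K / real M ^ (K - 1))" by simp
      also have "\<dots> \<le> real (Suc n) powr (-3/2) * 1"
        using M1 assms(3) pochhammer_le_power[of "norm s" K K]
        by (intro mult_left_mono) auto
      finally show ?thesis
        by (cases "s = 0") (use assms(1) in \<open>auto simp: mult_left_mono pochhammer_nonneg\<close>)
    qed
    have sm: "summable (\<lambda>n. norm ((-1)^n * a K n))"
      using le by (intro summable_comparison_test'[OF sZ, of 0]) auto
    from sm have "norm (\<Sum>n. (-1)^n * a K n) \<le> Z" unfolding Z_def
      using le sZ by (intro order_trans[OF summable_norm] suminf_le) auto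
    moreover have "(\<lambda>n. (-1)^n * a K n) sums (\<Sum>n. (-1)^n * a K n)"
      by (rule summable_sums[OF summable_norm_cancel[OF sm]])
    ultimately show ?thesis by blast
  qed
  \<comment> \<open>Descending from \<open>K\<close> to 0 does not enlarge the bound: the transform
    averages a first term of norm at most 1 with a sum of norm at most 1 + Z.\<close>
  have step: "\<exists>t. (\<lambda>n. (-1)^n * a i n) sums t \<and> norm t \<le> 1 + Z" if "i \<le> K" for i
    using that
  proof (induction rule: inc_induct)
    case base
    thus ?case using top by force
  next
    case (step i)
    then obtain d where d: "(\<lambda>n. (-1)^n * a (Suc i) n) sums d" "norm d \<le> 1 + Z" by blast
    have sm: "(\<lambda>n. (-1)^n * a i n) sums ((a i 0 + d) / 2)"
      using d(1) unfolding a_rec by (intro alternating_sums_halving a_lim)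
    have "norm (a i 0) \<le> pochhammer (norm s) i * real M powr (-1/2 - i)"
      using a_bound[of i 0] by simp
    also have "\<dots> \<le> real M ^ i * real M powr (- real i)"
    proof (intro mult_mono)
      have "pochhammer (norm s) i \<le> (norm s + K) ^ i"
        using step by (intro pochhammer_le_power) auto
      also have "\<dots> \<le> real M ^ i" using MK by (intro power_mono) auto
      finally show "pochhammer (norm s) i \<le> real M ^ i" .
    qed (use M1 in \<open>auto intro!: powr_mono\<close>)
    also have "\<dots> = 1" using M1 by (simp add: powr_minus powr_realpow)
    finally have "norm (a i 0) \<le> 1" .
    hence "norm ((a i 0 + d) / 2) \<le> 1 + Z"
      using d(2) norm_triangle_ineq[of "a i 0" d] Z0 by (simp add: norm_divide)
    with sm show ?case by blast
  qed
  from step[of 0] show ?thesis using that unfolding a_def Z_def by auto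
qed

lemma dirichlet_eta_partial_sum:
  assumes "(\<lambda>n. (-1)^n * of_nat (Suc M + n) powr (-s)) sums t"
  shows "dirichlet_eta s = (\<Sum>n=1..M. (-1)^(n-1) * of_nat n powr (-s)) + (-1)^M * t"
proof -
  have "(\<Sum>n=1..M + N. (-1)^(n-1) / of_nat n powr s) =
      (\<Sum>n=1..M. (-1)^(n-1) * of_nat n powr (-s)) + (-1)^M * (\<Sum>n<N. (-1)^n * of_nat (Suc M + n) powr (-s))" for N
    by (induction N) (auto simp: powr_minus field_simps power_add intro!: sum.cong)
  moreover have "(\<lambda>N. (\<Sum>n=1..M. (-1)^(n-1) * of_nat n powr (-s)) +
      (-1)^M * (\<Sum>n<N. (-1)^n * of_nat (Suc M + n) powr (-s))) \<longlonglongrightarrow>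
      (\<Sum>n=1..M. (-1)^(n-1) * of_nat n powr (-s)) + (-1)^M * t"
    using assms unfolding sums_def by (intro tendsto_intros)
  ultimately have "(\<lambda>N. \<Sum>n=1..M + N. (-1)^(n-1) / of_nat n powr s) \<longlonglongrightarrow>
      (\<Sum>n=1..M. (-1)^(n-1) * of_nat n powr (-s)) + (-1)^M * t" by simp
  hence "(\<lambda>N. \<Sum>n=1..N. (-1)^(n-1) / of_nat n powr s) \<longlonglongrightarrow>
      (\<Sum>n=1..M. (-1)^(n-1) * of_nat n powr (-s)) + (-1)^M * t"
    by (subst (asm) add.commute) (rule LIMSEQ_offset)
  thus ?thesis unfolding dirichlet_eta_def by (rule limI)
qed

section \<open>Partial sums of the Dirichlet series and their polar term\<close>

definition zeta_sum :: "nat \<Rightarrow> complex \<Rightarrow> complex" where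
  "zeta_sum Y s = (\<Sum>n=1..Y. of_nat n powr (-s))"

text \<open>The subtraction removes every even term twice, because 2 (2m)^(-s) = 2^(1-s) m^(-s).
  This is the finite form of the relation between eta and zeta, and it links the truncations at
  \<open>Y\<close> and \<open>2 * Y\<close>.\<close>

lemma zeta_sum_double:
  "zeta_sum (2 * Y) s - 2 powr (1 - s) * zeta_sum Y s = (\<Sum>n=1..2*Y. (-1)^(n-1) * of_nat n powr (-s))"
proof (induction Y)
  case 0
  thus ?case by (simp add: zeta_sum_def)
next
  case (Suc Y)
  have "(of_nat (2 * Suc Y) :: complex) powr (-s) = 2 powr (-s) * of_nat (Suc Y) powr (-s)"
    using powr_times_real[of "2::complex" "of_nat (Suc Y)" "-s"] by simp
  moreover have "(2::complex) powr (1 - s) = 2 * 2 powr (-s)"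
    by (simp add: powr_add powr_diff powr_minus field_simps)
  ultimately have e: "2 powr (1 - s) * of_nat (Suc Y) powr (-s) = 2 * of_nat (2 * Suc Y) powr (-s)"
    by simp
  have two: "2 * Suc Y = Suc (Suc (2 * Y))" by simp
  have "zeta_sum (2 * Suc Y) s = zeta_sum (2 * Y) s + of_nat (Suc (2 * Y)) powr (-s) + of_nat (2 * Suc Y) powr (-s)"
    unfolding two zeta_sum_def by simp
  moreover have "zeta_sum (Suc Y) s = zeta_sum Y s + of_nat (Suc Y) powr (-s)"
    unfolding zeta_sum_def by simp
  moreover have "(\<Sum>n=1..2*Suc Y. (-1)^(n-1) * of_nat n powr (-s)) =
     (\<Sum>n=1..2*Y. (-1)^(n-1) * of_nat n powr (-s)) + of_nat (Suc (2 * Y)) powr (-s) - of_nat (2 * Suc Y) powr (-s)"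
    unfolding two by simp
  ultimately show ?case using Suc e by (simp only: ring_distribs) (simp add: algebra_simps)
qed

text \<open>The first quotient is the integral of \<open>z powr (-w)\<close> over a unit interval,
  which is compared with the value at the left end. The condition on \<open>Re w\<close> makes the
  derivative largest there; it admits both \<open>w = s\<close> and \<open>w = s - 1\<close>, the
  two values used on the critical line.\<close>

lemma norm_powr_antiderivative_step_le:
  fixes w :: complex and x :: real
  assumes "x > 0" "w \<noteq> 1" "Re w \<ge> -1"
  shows "norm ((of_real (x + 1) powr (1 - w) - of_real x powr (1 - w)) / (1 - w) - of_real x powr (-w))
    \<le> norm w * x powr (-Re w - 1)"
proof -
  have inner: "norm (of_real y powr (-w) - of_real x powr (-w)) \<le> norm w * x powr (-Re w - 1)"
    if y: "x \<le> y" "y \<le> x + 1" for y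
  proof -
    let ?S = "closed_segment (of_real x :: complex) (of_real y)"
    have S: "?S = of_real ` {x..y}"
      using y by (simp only: closed_segment_of_real) (simp add: closed_segment_eq_real_ivl)
    have "norm (of_real y powr (-w) - of_real x powr (-w)) \<le>
        (norm w * x powr (-Re w - 1)) * norm (of_real y - of_real x :: complex)"
    proof (rule field_differentiable_bound[where S = ?S and f = "\<lambda>z. z powr (-w)" and f' = "\<lambda>z. -w * z powr (-w - 1)"])
      show "convex ?S" by simp
      fix z assume "z \<in> ?S"
      then obtain r where r: "z = of_real r" "x \<le> r" "r \<le> y" unfolding S by auto
      show "((\<lambda>z. z powr (-w)) has_field_derivative -w * z powr (-w - 1)) (at z within ?S)"
        using r assms(1) by (intro has_field_derivative_at_within[OF has_field_derivative_powr])
          (auto simp: complex_nonpos_Reals_iff)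
      have "norm (z powr (-w - 1)) = r powr (-Re w - 1)"
        using r assms(1) by (simp add: norm_powr_real_powr)
      also have "\<dots> \<le> x powr (-Re w - 1)"
        using r assms by (intro powr_mono2') auto
      finally show "norm (-w * z powr (-w - 1)) \<le> norm w * x powr (-Re w - 1)"
        by (simp add: norm_mult mult_left_mono)
    qed auto
    also have "norm (of_real y - of_real x :: complex) \<le> 1"
      using y by (simp flip: of_real_diff)
    finally show ?thesis by (simp add: mult_left_mono)
  qed
  define f where "f = (\<lambda>z :: complex. z powr (1 - w) / (1 - w) - z * of_real x powr (-w))"
  have "norm (f (of_real (x + 1)) - f (of_real x)) \<le> norm w * x powr (-Re w - 1)"
  proof (rule norm_diff_unit_step_le[where f' = "\<lambda>z. z powr (-w) - of_real x powr (-w)"])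
    fix y assume y: "x \<le> y" "y \<le> x + 1"
    have nz: "complex_of_real y \<notin> \<real>\<^sub>\<le>\<^sub>0" using y assms(1) by (auto simp: complex_nonpos_Reals_iff)
    have "((\<lambda>z. z powr (1 - w) / (1 - w) - z * of_real x powr (-w)) has_field_derivative
        ((1 - w) * of_real y powr (1 - w - 1)) / (1 - w) - 1 * of_real x powr (-w)) (at (of_real y))"
      by (intro DERIV_diff DERIV_cdivide DERIV_cmult_right DERIV_ident has_field_derivative_powr[OF nz])
    thus "(f has_field_derivative of_real y powr (-w) - of_real x powr (-w)) (at (of_real y))"
      unfolding f_def using assms(2) by simp
  qed (use inner in auto)
  moreover have "f (of_real (x + 1)) - f (of_real x) =
      (of_real (x + 1) powr (1 - w) - of_real x powr (1 - w)) / (1 - w) - of_real x powr (-w)"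
    unfolding f_def by (simp add: field_simps diff_divide_distrib)
  ultimately show ?thesis by simp
qed

lemma sum_powr_minus_antiderivative:
  fixes w :: complex and m n :: nat
  assumes "m > 0" "w \<noteq> 1" "Re w \<ge> -1" "m \<le> n"
  shows "norm ((\<Sum>k=m..<n. of_nat k powr (-w)) - (of_nat n powr (1 - w) - of_nat m powr (1 - w)) / (1 - w))
     \<le> norm w * (\<Sum>k=m..<n. real k powr (-Re w - 1))"
proof -
  have "(of_nat n powr (1 - w) - of_nat m powr (1 - w)) / (1 - w) =
     (\<Sum>k=m..<n. (of_nat (Suc k) powr (1 - w) - of_nat k powr (1 - w)) / (1 - w))"
    using assms(4) sum_Suc_diff'[of m n "\<lambda>k. of_nat k powr (1 - w)"]
    by (simp only: sum_divide_distrib[symmetric])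
  hence "norm ((\<Sum>k=m..<n. of_nat k powr (-w)) - (of_nat n powr (1 - w) - of_nat m powr (1 - w)) / (1 - w)) =
     norm (\<Sum>k=m..<n. (of_nat (Suc k) powr (1 - w) - of_nat k powr (1 - w)) / (1 - w) - of_nat k powr (-w))"
    by (simp add: sum_subtractf norm_minus_commute)
  also have "\<dots> \<le> (\<Sum>k=m..<n. norm w * real k powr (-Re w - 1))"
  proof (rule sum_norm_le)
    fix k assume "k \<in> {m..<n}"
    thus "norm ((of_nat (Suc k) powr (1 - w) - of_nat k powr (1 - w)) / (1 - w) - of_nat k powr (-w))
        \<le> norm w * real k powr (-Re w - 1)"
      using norm_powr_antiderivative_step_le[of "real k" w] assms by (simp add: add.commute)
  qed
  finally show ?thesis by (simp add: sum_distrib_left)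
qed

text \<open>A partial sum equals \<open>n powr (1 - s) / (1 - s)\<close> up to a bounded error. The
  scaling factor has norm 2^(-j/2), so it kills everything bounded, in particular the arbitrary
  constant \<open>z\<close>, while it carries the polar term at \<open>2 ^ j * Y\<close> exactly to
  the one at \<open>Y\<close>.\<close>

lemma zeta_sum_limit:
  assumes s: "Re s = 1/2" and Y: "Y > 0"
  shows "(\<lambda>j. (2 powr (s - 1)) ^ j * (zeta_sum (2 ^ j * Y) s - z)) \<longlonglongrightarrow> of_nat Y powr (1 - s) / (1 - s)"
proof -
  have s1: "s \<noteq> 1" using s by auto
  define Z where "Z = (\<Sum>n. real (Suc n) powr (-3/2))"
  have sZ: "summable (\<lambda>n. real (Suc n) powr (-3/2))"
    by (subst summable_Suc_iff) (simp add: summable_real_powr_iff)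
  define C where "C = norm s * Z + 1 + norm (1 / (1 - s)) + norm z"
  have bound: "norm (zeta_sum n s - z - of_nat n powr (1 - s) / (1 - s)) \<le> C" if "n > 0" for n
  proof -
    have "(\<Sum>k=1..<n. real k powr (-3/2)) = (\<Sum>k<n-1. real (Suc k) powr (-3/2))"
      by (rule sum.reindex_bij_witness[of _ Suc "\<lambda>k. k - 1"]) auto
    also have "\<dots> \<le> Z" unfolding Z_def by (intro sum_le_suminf sZ) auto
    finally have 1: "norm ((\<Sum>k=1..<n. of_nat k powr (-s)) - (of_nat n powr (1 - s) - 1) / (1 - s)) \<le> norm s * Z"
      using sum_powr_minus_antiderivative[of 1 s n] s s1 that
      by (auto intro: order_trans[OF _ mult_left_mono])
    have "{1..n} = insert n {1..<n}" using that by auto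
    hence 2: "zeta_sum n s = of_nat n powr (-s) + (\<Sum>k=1..<n. of_nat k powr (-s))"
      unfolding zeta_sum_def by simp
    have "norm (of_nat n powr (-s)) = real n powr (-Re s)"
      using that norm_powr_real_powr[of "of_nat n" "-s"] by simp
    also have "\<dots> = real n powr (-1/2)"
      by (rule arg_cong[where f = "(powr) (real n)"]) (use s in simp)
    also have "\<dots> \<le> 1" using that powr_mono2'[of "-1/2" 1 "real n"] by simp
    finally have 3: "norm (of_nat n powr (-s)) \<le> 1" .
    have "zeta_sum n s - z - of_nat n powr (1 - s) / (1 - s) =
       ((\<Sum>k=1..<n. of_nat k powr (-s)) - (of_nat n powr (1 - s) - 1) / (1 - s)) + of_nat n powr (-s) - 1 / (1 - s) - z"
      unfolding 2 by (simp add: diff_divide_distrib)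
    also have "norm \<dots> \<le> norm s * Z + 1 + norm (1 / (1 - s)) + norm z"
      by (intro norm_triangle_le norm_triangle_le_diff add_mono 1 3 order_refl)
    finally show ?thesis unfolding C_def .
  qed
  have n2: "norm ((2::complex) powr (s - 1)) = 2 powr (-1/2)"
    using norm_powr_real_powr[of 2 "s - 1"] s by simp
  have "(\<lambda>j. (2 powr (s - 1)) ^ j * (zeta_sum (2 ^ j * Y) s - z - of_nat (2 ^ j * Y) powr (1 - s) / (1 - s))) \<longlonglongrightarrow> 0"
  proof (rule Lim_null_comparison[OF eventuallyI])
    fix j :: nat
    show "norm ((2 powr (s - 1)) ^ j * (zeta_sum (2 ^ j * Y) s - z - of_nat (2 ^ j * Y) powr (1 - s) / (1 - s)))
        \<le> (2 powr (-1/2)) ^ j * C"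
      unfolding norm_mult norm_power n2 by (intro mult_left_mono bound) (use Y in auto)
    show "(\<lambda>j. (2 powr (-1/2)) ^ j * C) \<longlonglongrightarrow> 0"
      by (intro tendsto_mult_left_zero LIMSEQ_power_zero) (auto simp: powr_minus_divide)
  qed
  moreover have "(2 powr (s - 1)) ^ j * of_nat (2 ^ j * Y) powr (1 - s) = of_nat Y powr (1 - s)" for j
  proof -
    have "(of_nat (2 ^ j * Y) :: complex) powr (1 - s) = (2 ^ j) powr (1 - s) * of_nat Y powr (1 - s)"
      using powr_times_real[of "2 ^ j" "of_nat Y" "1 - s"] by simp
    also have "(2 ^ j :: complex) powr (1 - s) = (2 powr (1 - s)) ^ j"
      by (induction j) (auto simp: powr_times_real)
    also have "(2 powr (s - 1)) ^ j * ((2 powr (1 - s)) ^ j * of_nat Y powr (1 - s)) =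
        (2 powr (s - 1) * 2 powr (1 - s)) ^ j * of_nat Y powr (1 - s)"
      by (simp add: power_mult_distrib)
    also have "(2::complex) powr (s - 1) * 2 powr (1 - s) = 1"
      by (simp flip: powr_add)
    finally show ?thesis by simp
  qed
  hence "(2 powr (s - 1)) ^ j * (zeta_sum (2 ^ j * Y) s - z - of_nat (2 ^ j * Y) powr (1 - s) / (1 - s)) =
     (2 powr (s - 1)) ^ j * (zeta_sum (2 ^ j * Y) s - z) - of_nat Y powr (1 - s) / (1 - s)" for j
    by (simp add: right_diff_distrib times_divide_eq_right)
  ultimately show ?thesis by (simp only: LIM_zero_iff)
qed

text \<open>The bracket is the bound of \<open>alternating_powr_tail\<close>; the 3 dominates the
  geometric series of the powers of 1 / sqrt 2 starting with the first.\<close>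

definition zeta_error :: real where
  "zeta_error = 3 * (1 + (\<Sum>n. real (Suc n) powr (-3/2)))"

lemma zeta_error_ge: "zeta_error \<ge> 3"
proof -
  have "summable (\<lambda>n. real (Suc n) powr (-3/2))"
    by (subst summable_Suc_iff) (simp add: summable_real_powr_iff)
  hence "(\<Sum>n. real (Suc n) powr (-3/2)) \<ge> 0" by (intro suminf_nonneg) auto
  thus ?thesis unfolding zeta_error_def by simp
qed

text \<open>The error of the truncation at $Y$ is, up to $O(1)$, the error at $2^j Y$ scaled by
  $2^{j(s-1)}$; letting $j \to \infty$ isolates the polar term.\<close>

lemma zeta_sum_approx:
  assumes s: "Re s = 1/2" and K: "K \<ge> 2" and Y: "(norm s + K) ^ K \<le> real Y ^ (K - 1)"
  shows "norm (zeta_sum Y s - riemann_zeta s - of_nat Y powr (1 - s) / (1 - s)) \<le> zeta_error"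
proof -
  define C where "C = 1 + (\<Sum>n. real (Suc n) powr (-3/2))"
  have C0: "C \<ge> 0" using zeta_error_ge unfolding zeta_error_def C_def by simp
  have "Y \<noteq> 0"
  proof
    assume "Y = 0"
    moreover have "norm s + K > 0" using K norm_ge_zero[of s] by linarith
    hence "(norm s + K) ^ K > 0" by simp
    ultimately show False using Y K by (simp add: zero_power)
  qed
  define q where "q = (2::complex) powr (1 - s)"
  have nq: "norm q = sqrt 2"
    unfolding q_def using norm_powr_real_powr[of 2 "1 - s"] s by (simp add: powr_half_sqrt)
  have q1: "q \<noteq> 1" using nq by auto
  define E where "E = (\<lambda>j. zeta_sum (2 ^ j * Y) s - riemann_zeta s)"
  \<comment> \<open>Eta is written once as a doubled truncation plus an alternating tail and once as
    \<open>(1 - q)\<close> times zeta; in the difference only the tail survives.\<close>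
  have step: "norm (E (Suc j) - q * E j) \<le> C" for j
  proof -
    have "Y \<le> 2 ^ j * Y" by simp
    hence "Y \<le> Suc (2 * (2 ^ j * Y))" by linarith
    hence "(norm s + K) ^ K \<le> real (Suc (2 * (2 ^ j * Y))) ^ (K - 1)"
      by (intro order_trans[OF Y power_mono]) (auto simp only: of_nat_le_iff of_nat_0_le_iff)
    then obtain t where t: "(\<lambda>n. (-1)^n * of_nat (Suc (2 * (2 ^ j * Y)) + n) powr (-s)) sums t" "norm t \<le> C"
      using alternating_powr_tail[OF s K] unfolding C_def by metis
    have "dirichlet_eta s = zeta_sum (2 * (2 ^ j * Y)) s - q * zeta_sum (2 ^ j * Y) s + t"
      unfolding q_def zeta_sum_double dirichlet_eta_partial_sum[OF t(1)] by simp
    moreover have "dirichlet_eta s = (1 - q) * riemann_zeta s"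
      unfolding riemann_zeta_def using q1 by (simp add: q_def)
    ultimately have "E (Suc j) - q * E j = -t"
      unfolding E_def by (simp add: algebra_simps)
    thus ?thesis using t(2) by simp
  qed
  define r where "r = (2::complex) powr (s - 1)"
  have rq: "r * q = 1" unfolding r_def q_def by (simp flip: powr_add)
  have nr: "norm r = 1 / sqrt 2"
    using rq nq by (metis nonzero_eq_divide_eq norm_mult norm_one real_sqrt_eq_zero_cancel_iff zero_neq_numeral)
  have tele: "norm (r ^ j * E j - E 0) \<le> C * (\<Sum>i<j. (1 / sqrt 2) ^ Suc i)" for j
  proof (induction j)
    case (Suc j)
    have "r ^ Suc j * E (Suc j) - E 0 = r ^ Suc j * (E (Suc j) - q * E j) + (r ^ j * E j - E 0)"
      using rq by (simp add: algebra_simps)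
    also have "norm \<dots> \<le> (1 / sqrt 2) ^ Suc j * C + C * (\<Sum>i<j. (1 / sqrt 2) ^ Suc i)"
      unfolding norm_mult norm_power nr[symmetric]
      by (intro norm_triangle_le add_mono Suc[unfolded nr[symmetric]])
        (auto simp: norm_mult norm_power intro!: mult_left_mono step)
    finally show ?case by (simp add: algebra_simps)
  qed simp
  \<comment> \<open>Replacing 1 / sqrt 2 by the slightly larger ratio 3/4 makes the infinite sum
    exactly 3.\<close>
  have geo: "(\<Sum>i<j. (1 / sqrt 2) ^ Suc i) \<le> (3::real)" for j
  proof -
    have sq: "sqrt 2 \<ge> 4/3" by (rule real_le_rsqrt) (simp add: power2_eq_square)
    have "(\<Sum>i<j. (1 / sqrt 2) ^ Suc i) \<le> (\<Sum>i<j. (3/4::real) ^ Suc i)"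
      using sq by (intro sum_mono power_mono) (auto simp: field_simps)
    also have "\<dots> = 3 - 3 * (3/4) ^ j" by (induction j) (auto simp: field_simps)
    also have "\<dots> \<le> 3" by simp
    finally show ?thesis .
  qed
  have "(\<lambda>j. r ^ j * E j - E 0) \<longlonglongrightarrow> of_nat Y powr (1 - s) / (1 - s) - E 0"
    unfolding r_def E_def using zeta_sum_limit[OF s, of Y] \<open>Y \<noteq> 0\<close> by (intro tendsto_diff) auto
  moreover have "norm (r ^ j * E j - E 0) \<le> C * 3" for j
    using tele[of j] geo[of j] C0 by (meson mult_left_mono order_trans)
  ultimately have "norm (of_nat Y powr (1 - s) / (1 - s) - E 0) \<le> C * 3"
    by (intro Lim_bounded[OF tendsto_norm]) auto
  thus ?thesis unfolding zeta_error_def C_def E_def by (simp add: norm_minus_commute mult.commute)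
qed

section \<open>Averaged truncations\<close>

definition zeta_smooth_sum :: "nat \<Rightarrow> complex \<Rightarrow> complex" where
  "zeta_smooth_sum X s = (\<Sum>Y=X..<2*X. zeta_sum Y s) / of_nat X"

text \<open>The polar term oscillates in \<open>Y\<close>, so summing it over a dyadic range gains
  another factor 1/|Im s| over the \<open>sqrt X / |Im s|\<close> of a sharp truncation. At heights
  near sqrt N with \<open>X\<close> slightly above N this is the difference between an error tending
  to 0 and one growing like a power of N.\<close>

lemma zeta_smooth_sum_approx:
  assumes s: "Re s = 1/2" "Im s \<noteq> 0" and K: "K \<ge> 2" and X: "(norm s + K) ^ K \<le> real X ^ (K - 1)"
  shows "norm (zeta_smooth_sum X s - riemann_zeta s) \<le> zeta_error + 1 + 8 * sqrt X / (Im s)\<^sup>2"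
proof -
  have "X \<noteq> 0"
  proof
    assume "X = 0"
    moreover have "norm s + K > 0" using K norm_ge_zero[of s] by linarith
    hence "(norm s + K) ^ K > 0" by simp
    ultimately show False using X K by (simp add: zero_power)
  qed
  hence X0: "real X \<ge> 1" by simp
  define p where "p = (\<Sum>Y=X..<2*X. of_nat Y powr (1 - s))"
  have a: "norm (\<Sum>Y=X..<2*X. zeta_sum Y s - riemann_zeta s - of_nat Y powr (1 - s) / (1 - s)) \<le> (\<Sum>Y=X..<2*X. zeta_error)"
  proof (rule sum_norm_le)
    fix Y assume "Y \<in> {X..<2*X}"
    hence "(norm s + K) ^ K \<le> real Y ^ (K - 1)" by (intro order_trans[OF X] power_mono) auto
    thus "norm (zeta_sum Y s - riemann_zeta s - of_nat Y powr (1 - s) / (1 - s)) \<le> zeta_error"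
      by (rule zeta_sum_approx[OF s(1) K])
  qed
  have "(\<Sum>Y=X..<2*X. zeta_sum Y s - riemann_zeta s - of_nat Y powr (1 - s) / (1 - s)) =
     of_nat X * (zeta_smooth_sum X s - riemann_zeta s) - p / (1 - s)"
    using \<open>X \<noteq> 0\<close> unfolding zeta_smooth_sum_def p_def sum_subtractf sum_divide_distrib
    by (simp add: right_diff_distrib sum_divide_distrib[symmetric])
  hence "norm (of_nat X * (zeta_smooth_sum X s - riemann_zeta s)) \<le> X * zeta_error + norm (p / (1 - s))"
    using a norm_triangle_sub[of "of_nat X * (zeta_smooth_sum X s - riemann_zeta s)" "p / (1 - s)"] by simp
  hence 1: "X * norm (zeta_smooth_sum X s - riemann_zeta s) \<le> X * zeta_error + norm p / norm (1 - s)"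
    by (simp add: norm_mult norm_divide)
  have s2: "s - 1 \<noteq> 1" "Re (s - 1) \<ge> -1" using s by auto
  \<comment> \<open>The summation formula is now applied with \<open>s - 1\<close> in place of
    \<open>s\<close>. Its error \<open>norm (s - 1) * X\<close>, divided by
    \<open>norm (1 - s)\<close> and by \<open>X\<close>, is the summand 1 of the final
    bound.\<close>
  have "norm (p - (of_nat (2 * X) powr (2 - s) - of_nat X powr (2 - s)) / (2 - s))
      \<le> norm (s - 1) * (\<Sum>k=X..<2*X. real k powr (-1/2))"
    using sum_powr_minus_antiderivative[OF _ s2, of X "2 * X"] \<open>X \<noteq> 0\<close> s
    unfolding p_def by (simp add: field_simps)
  also have "(\<Sum>k=X..<2*X. real k powr (-1/2)) \<le> (\<Sum>k=X..<2*X. 1)"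
  proof (rule sum_mono)
    fix k assume "k \<in> {X..<2*X}"
    hence "real k \<ge> 1" using X0 by auto
    thus "real k powr (-1/2) \<le> 1" using powr_mono2'[of "-1/2" 1 "real k"] by simp
  qed
  also have "\<dots> = X" by simp
  finally have "norm (p - (of_nat (2 * X) powr (2 - s) - of_nat X powr (2 - s)) / (2 - s)) \<le> norm (s - 1) * X"
    by (simp add: mult_left_mono)
  hence "norm p \<le> norm (s - 1) * X + norm ((of_nat (2 * X) powr (2 - s) - of_nat X powr (2 - s)) / (2 - s))"
    using norm_triangle_sub[of p "(of_nat (2 * X) powr (2 - s) - of_nat X powr (2 - s)) / (2 - s)"] by linarith
  also have "norm ((of_nat (2 * X) powr (2 - s) - of_nat X powr (2 - s)) / (2 - s)) \<le> (8 * X * sqrt X) / norm (2 - s)"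
  proof -
    have nn: "norm (of_nat n powr (2 - s)) = real n * sqrt (real n)" for n
      using norm_powr_real_powr[of "of_nat n" "2 - s"] s
      by (cases "n = 0") (auto simp: powr_half_sqrt[symmetric] powr_add[of "real n" 1 "1/2", simplified])
    have "norm (of_nat (2 * X) powr (2 - s) - of_nat X powr (2 - s)) \<le> 2 * X * sqrt (2 * X) + X * sqrt X"
      by (rule norm_triangle_le_diff) (simp only: nn order_refl)
    also have "\<dots> \<le> 2 * X * (2 * sqrt X) + X * sqrt X"
      by (intro add_mono mult_left_mono) (auto simp: real_sqrt_mult sqrt2_less_2[THEN less_imp_le] intro!: mult_right_mono)
    also have "\<dots> \<le> 8 * X * sqrt X" by simp
    finally show ?thesis by (simp add: norm_divide divide_right_mono)
  qed
  finally have 2: "norm p \<le> norm (s - 1) * X + (8 * X * sqrt X) / norm (2 - s)" by simp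
  have i1: "norm (1 - s) \<ge> \<bar>Im s\<bar>" "norm (2 - s) \<ge> \<bar>Im s\<bar>"
    using abs_Im_le_cmod[of "1 - s"] abs_Im_le_cmod[of "2 - s"] by auto
  have pos: "norm (1 - s) > 0" "norm (2 - s) > 0" using i1 s by auto
  have "norm p / norm (1 - s) \<le> (norm (s - 1) * X + (8 * X * sqrt X) / norm (2 - s)) / norm (1 - s)"
    using 2 by (intro divide_right_mono) auto
  also have "\<dots> = X + 8 * X * sqrt X / (norm (2 - s) * norm (1 - s))"
    using pos by (simp add: add_divide_distrib norm_minus_commute)
  also have "\<dots> \<le> X + 8 * X * sqrt X / (Im s)\<^sup>2"
  proof -
    have "(Im s)\<^sup>2 = \<bar>Im s\<bar> * \<bar>Im s\<bar>" by (simp add: power2_eq_square)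
    also have "\<dots> \<le> norm (2 - s) * norm (1 - s)" by (intro mult_mono i1) auto
    finally show ?thesis using s by (intro add_left_mono divide_left_mono) (auto intro!: mult_pos_pos pos)
  qed
  also have "\<dots> = X * (1 + 8 * sqrt X / (Im s)\<^sup>2)" by (simp add: algebra_simps)
  finally have "X * norm (zeta_smooth_sum X s - riemann_zeta s) \<le> X * (zeta_error + 1 + 8 * sqrt X / (Im s)\<^sup>2)"
    using 1 by (simp add: algebra_simps)
  thus ?thesis using X0 by (subst (asm) mult_le_cancel_left_pos) auto
qed

section \<open>Dirichlet kernels and mean squares\<close>

definition dirichlet_kernel :: "nat \<Rightarrow> real \<Rightarrow> complex" where
  "dirichlet_kernel L x = (\<Sum>l<L. cis (real l * x))"

lemma dirichlet_kernel_mult: "(cis x - 1) * dirichlet_kernel L x = cis (real L * x) - 1"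
  unfolding dirichlet_kernel_def
  by (induction L) (auto simp: algebra_simps cis_mult)

lemma norm_dirichlet_kernel_le: "norm (dirichlet_kernel L x) \<le> L"
  unfolding dirichlet_kernel_def by (rule order_trans[OF norm_sum]) simp

lemma norm_dirichlet_kernel_minus: "norm (dirichlet_kernel L (-x)) = norm (dirichlet_kernel L x)"
proof -
  have "dirichlet_kernel L (-x) = cnj (dirichlet_kernel L x)"
    unfolding dirichlet_kernel_def by (simp add: cis_cnj)
  thus ?thesis by simp
qed

lemma half_le_sin:
  assumes "0 \<le> x" "x \<le> 1"
  shows "x / 2 \<le> sin (x::real)"
proof (cases "x = 0")
  case False
  with assms have "0 < x" by simp
  then obtain z where z: "0 < z" "z < x" "sin x - sin 0 = (x - 0) * cos z"
    using MVT2[of 0 x sin cos] by (auto intro!: derivative_eq_intros)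
  have "1 / 2 = cos (pi / 3)" by (simp add: cos_60)
  also have "\<dots> \<le> cos z" using z assms pi_gt3 by (intro cos_monotone_0_pi_le) auto
  finally show ?thesis using z assms by (simp add: mult_left_mono)
qed simp

lemma norm_dirichlet_kernel_le_inverse:
  assumes "x \<noteq> 0" "\<bar>x\<bar> \<le> 1"
  shows "norm (dirichlet_kernel L x) \<le> 4 / \<bar>x\<bar>"
proof -
  have "\<bar>x\<bar> / 2 \<le> \<bar>sin x\<bar>"
    using half_le_sin[of "\<bar>x\<bar>"] assms by (cases "x \<ge> 0") (auto simp: abs_if split: if_splits)
  also have "\<dots> \<le> norm (cis x - 1)" using abs_Im_le_cmod[of "cis x - 1"] by simp
  finally have 1: "\<bar>x\<bar> / 2 \<le> norm (cis x - 1)" .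
  have "\<bar>x\<bar> / 2 * norm (dirichlet_kernel L x) \<le> norm (cis x - 1) * norm (dirichlet_kernel L x)"
    by (intro mult_right_mono 1) auto
  also have "\<dots> = norm (cis (real L * x) - 1)"
    by (simp only: norm_mult[symmetric] dirichlet_kernel_mult)
  also have "\<dots> \<le> 2"
    using norm_triangle_ineq4[of "cis (real L * x)" 1] by simp
  finally show ?thesis using assms by (simp add: field_simps)
qed

text \<open>The kernel is here a full geometric sum over the powers of a \<open>Q\<close>-th root of
  unity other than 1. This orthogonality is the reason for placing the resonator frequencies on a
  grid.\<close>

lemma dirichlet_kernel_eq_0:
  assumes "i < Q" "j < Q" "i \<noteq> j"
  shows "dirichlet_kernel Q (2 * pi * (real i - real j) / real Q) = 0"
proof -
  let ?z = "2 * pi * (real i - real j) / real Q"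
  have "cis ?z \<noteq> 1"
  proof
    assume "cis ?z = 1"
    hence "cos ?z = 1" by (simp add: complex_eq_iff)
    then obtain n :: int where "?z = real_of_int n * 2 * pi" using cos_one_2pi_int by blast
    hence "2 * pi * (real i - real j) = 2 * pi * (real_of_int n * real Q)"
      using assms by (simp add: field_simps)
    hence "real i - real j = real_of_int n * real Q" by (subst (asm) mult_cancel_left) simp
    hence "real_of_int (int i - int j) = real_of_int (n * int Q)" by simp
    hence eq: "int i - int j = n * int Q" by (simp only: of_int_eq_iff)
    hence "n \<noteq> 0" using assms by auto
    hence "\<bar>n\<bar> * int Q \<ge> 1 * int Q" by (intro mult_right_mono) auto
    hence "\<bar>int i - int j\<bar> \<ge> int Q" unfolding eq by (simp add: abs_mult)
    thus False using assms by linarith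
  qed
  moreover have "cis (real Q * ?z) = 1"
    using assms cis_multiple_2pi[of "real i - real j"] by simp
  ultimately show ?thesis using dirichlet_kernel_mult[of ?z Q] by simp
qed

text \<open>After removing the multiple of \<open>2 * pi\<close>, every term has its argument within
  \<open>pi / 3\<close> of 0, hence real part at least 1/2, so no cancellation occurs. This makes
  approximate coincidences of frequencies as useful as exact ones.\<close>

lemma dirichlet_kernel_near_multiple_2pi:
  assumes "\<bar>z + 2 * pi * of_int n\<bar> * real L \<le> pi / 3"
  shows "norm (dirichlet_kernel L z) \<ge> L / 2"
proof -
  let ?y = "z + 2 * pi * of_int n"
  have cis_eq: "cis (real l * z) = cis (real l * ?y)" for l
  proof -
    have "cis (real l * ?y) = cis (real l * z) * cis (2 * pi * (real l * of_int n))"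
      by (simp add: cis_mult algebra_simps)
    also have "cis (2 * pi * (real l * of_int n)) = 1" by (rule cis_multiple_2pi) auto
    finally show ?thesis by simp
  qed
  have "real L / 2 = (\<Sum>l<L. 1 / 2)" by simp
  also have "\<dots> \<le> (\<Sum>l<L. cos (real l * ?y))"
  proof (rule sum_mono)
    fix l assume "l \<in> {..<L}"
    hence "\<bar>real l * ?y\<bar> \<le> real L * \<bar>?y\<bar>" unfolding abs_mult by (intro mult_right_mono) auto
    hence le: "\<bar>real l * ?y\<bar> \<le> pi / 3" using assms by (simp add: mult.commute)
    have "1 / 2 = cos (pi / 3)" by (simp add: cos_60)
    also have "\<dots> \<le> cos \<bar>real l * ?y\<bar>"
      using le by (intro cos_monotone_0_pi_le) auto
    finally show "1 / 2 \<le> cos (real l * ?y)" by simp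
  qed
  also have "\<dots> = Re (dirichlet_kernel L z)"
    unfolding dirichlet_kernel_def cis_eq by simp
  also have "\<dots> \<le> norm (dirichlet_kernel L z)" by (rule complex_Re_le_cmod)
  finally show ?thesis .
qed

text \<open>A Schur test: the square is expanded, each product |c n| |c m| is bounded by the mean of
  the squares, and the symmetry of the kernel leaves a single row sum. It serves both the
  logarithmic frequencies of zeta and the exact grid of the resonator.\<close>

lemma large_sieve_row_sum:
  fixes c :: "'a \<Rightarrow> complex" and x :: "'a \<Rightarrow> real"
  assumes row: "\<And>n. n \<in> S \<Longrightarrow> (\<Sum>m\<in>S. norm (dirichlet_kernel L (x n - x m))) \<le> W"
  shows "(\<Sum>l<L. (norm (\<Sum>n\<in>S. c n * cis (real l * x n)))\<^sup>2) \<le> W * (\<Sum>n\<in>S. (norm (c n))\<^sup>2)"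
proof -
  let ?D = "\<lambda>n m. norm (dirichlet_kernel L (x n - x m))"
  have sym: "?D n m = ?D m n" for n m
    using norm_dirichlet_kernel_minus[of L "x n - x m"] by simp
  have "of_real (\<Sum>l<L. (norm (\<Sum>n\<in>S. c n * cis (real l * x n)))\<^sup>2) =
    (\<Sum>l<L. (\<Sum>n\<in>S. c n * cis (real l * x n)) * (\<Sum>m\<in>S. cnj (c m) * cis (-(real l * x m))))"
    by (simp only: of_real_sum complex_norm_square cnj_sum complex_cnj_mult cis_cnj)
  also have "\<dots> = (\<Sum>l<L. \<Sum>n\<in>S. \<Sum>m\<in>S. (c n * cnj (c m)) * cis (real l * (x n - x m)))"
    by (simp add: sum_product cis_mult[symmetric] algebra_simps diff_conv_add_uminus del: add_uminus_conv_diff)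
  also have "\<dots> = (\<Sum>n\<in>S. \<Sum>m\<in>S. (c n * cnj (c m)) * dirichlet_kernel L (x n - x m))"
    unfolding dirichlet_kernel_def sum_distrib_left
    by (subst sum.swap, intro sum.cong refl, subst sum.swap) simp
  also have "norm \<dots> \<le> (\<Sum>n\<in>S. \<Sum>m\<in>S. norm (c n) * norm (c m) * ?D n m)"
    by (intro sum_norm_le) (simp add: norm_mult)
  also have "\<dots> \<le> (\<Sum>n\<in>S. \<Sum>m\<in>S. ((norm (c n))\<^sup>2 * ?D n m + (norm (c m))\<^sup>2 * ?D n m) / 2)"
  proof (intro sum_mono)
    fix n m
    have "norm (c n) * norm (c m) * ?D n m \<le> ((norm (c n))\<^sup>2 + (norm (c m))\<^sup>2) / 2 * ?D n m"
      using sum_squares_bound[of "norm (c n)" "norm (c m)"] by (intro mult_right_mono) auto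
    thus "norm (c n) * norm (c m) * ?D n m \<le> ((norm (c n))\<^sup>2 * ?D n m + (norm (c m))\<^sup>2 * ?D n m) / 2"
      by (simp add: algebra_simps)
  qed
  also have "\<dots> = ((\<Sum>n\<in>S. \<Sum>m\<in>S. (norm (c n))\<^sup>2 * ?D n m) + (\<Sum>n\<in>S. \<Sum>m\<in>S. (norm (c m))\<^sup>2 * ?D n m)) / 2"
    by (simp add: sum.distrib sum_divide_distrib add_divide_distrib)
  also have "(\<Sum>n\<in>S. \<Sum>m\<in>S. (norm (c m))\<^sup>2 * ?D n m) = (\<Sum>n\<in>S. \<Sum>m\<in>S. (norm (c n))\<^sup>2 * ?D n m)"
    by (subst sum.swap) (intro sum.cong refl arg_cong2[where f = "(*)"] sym)
  also have "(\<Sum>n\<in>S. \<Sum>m\<in>S. (norm (c n))\<^sup>2 * ?D n m) \<le> (\<Sum>n\<in>S. (norm (c n))\<^sup>2 * W)"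
    by (simp only: sum_distrib_left[symmetric]) (intro sum_mono mult_left_mono row, auto)
  finally have "norm (complex_of_real (\<Sum>l<L. (norm (\<Sum>n\<in>S. c n * cis (real l * x n)))\<^sup>2)) \<le> (\<Sum>n\<in>S. (norm (c n))\<^sup>2 * W)"
    by simp
  hence "(\<Sum>l<L. (norm (\<Sum>n\<in>S. c n * cis (real l * x n)))\<^sup>2) \<le> (\<Sum>n\<in>S. (norm (c n))\<^sup>2 * W)"
    by (simp only: norm_of_real)
  thus ?thesis by (simp add: sum_distrib_left mult.commute)
qed

section \<open>Mean square of a zeta sum along an arithmetic progression\<close>

lemma harm_le_Suc_ln:
  assumes "n > 0"
  shows "harm n \<le> 1 + ln (real n)"
  using decseqD[OF decseq_harm_diff_ln, of 0 "n - 1"] assms by (simp add: harm_expand)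

lemma sum_inverse_dist_le:
  assumes "n \<in> {1..Y}"
  shows "(\<Sum>m\<in>{1..Y}-{n}. 1 / \<bar>real n - real m\<bar>) \<le> 2 * harm Y"
proof -
  have "(\<Sum>m\<in>{1..Y}-{n}. 1 / \<bar>real n - real m\<bar>) =
      (\<Sum>m\<in>{1..<n}. 1 / \<bar>real n - real m\<bar>) + (\<Sum>m\<in>{n<..Y}. 1 / \<bar>real n - real m\<bar>)"
    using assms by (subst sum.union_disjoint[symmetric]) (auto intro!: sum.cong)
  also have "(\<Sum>m\<in>{1..<n}. 1 / \<bar>real n - real m\<bar>) = (\<Sum>j\<in>{1..<n}. inverse (real j))"
    by (rule sum.reindex_bij_witness[of _ "\<lambda>j. n - j" "\<lambda>m. n - m"]) (auto simp: of_nat_diff field_simps)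
  also have "(\<Sum>m\<in>{n<..Y}. 1 / \<bar>real n - real m\<bar>) = (\<Sum>j\<in>{1..Y-n}. inverse (real j))"
    by (rule sum.reindex_bij_witness[of _ "\<lambda>j. n + j" "\<lambda>m. m - n"]) (auto simp: of_nat_diff field_simps)
  also have "(\<Sum>j\<in>{1..<n}. inverse (real j)) \<le> harm Y"
    unfolding harm_def using assms by (intro sum_mono2) auto
  also have "(\<Sum>j\<in>{1..Y-n}. inverse (real j)) \<le> harm Y"
    unfolding harm_def by (intro sum_mono2) auto
  finally show ?thesis by simp
qed

lemma abs_ln_diff_ge:
  assumes "n \<in> {1..Y}" "m \<in> {1..Y}"
  shows "\<bar>ln (real n) - ln (real m)\<bar> \<ge> \<bar>real n - real m\<bar> / Y"
proof -
  have *: "ln (real b) - ln (real a) \<ge> (real b - real a) / Y" if "1 \<le> a" "a \<le> b" "b \<le> Y" for a b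
  proof -
    have "ln (real a / real b) \<le> real a / real b - 1" using that by (intro ln_le_minus_one) auto
    hence "ln (real b) - ln (real a) \<ge> (real b - real a) / real b"
      using that by (simp add: ln_div field_simps)
    moreover have "(real b - real a) / real b \<ge> (real b - real a) / real Y"
      using that by (intro divide_left_mono) auto
    ultimately show ?thesis by linarith
  qed
  show ?thesis using *[of n m] *[of m n] assms by (cases "n \<le> m") (auto simp: abs_if field_simps)
qed

lemma of_nat_powr_critical_line:
  assumes "n > 0"
  shows "of_nat n powr (- Complex (1/2) t) = of_real (1 / sqrt n) * cis (- (t * ln n))"
proof -
  have "complex_of_nat n powr (- Complex (1/2) t) = exp (- Complex (1/2) t * of_real (ln n))"
    using assms by (simp add: powr_def Ln_of_nat)
  also have "- Complex (1/2) t * of_real (ln n) = of_real (- ln n / 2) + \<i> * of_real (- (t * ln n))"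
    by (simp add: complex_eq_iff)
  also have "exp \<dots> = of_real (exp (- ln n / 2)) * cis (- (t * ln n))"
    by (simp only: exp_add cis_conv_exp exp_of_real)
  also have "exp (- ln n / 2) = 1 / sqrt n"
    using assms by (simp add: exp_minus field_simps ln_sqrt[symmetric])
  finally show ?thesis .
qed

text \<open>On integers \<open>l\<close> the frequencies \<alpha> ln n matter only modulo
  \<open>2 * pi\<close>, so distant \<open>n\<close> may resonate. Splitting the range by the
  integer part of \<alpha> ln n leaves phases within distance 1 in each class, where the inverse
  bound for the kernel applies; Cauchy-Schwarz over the classes costs only the factor \<alpha> ln Y
  + 1.\<close>

lemma zeta_sum_mean_square:
  fixes \<alpha> :: real
  assumes \<alpha>: "\<alpha> > 0" and Y: "Y > 0"
  shows "(\<Sum>l<L. (norm (zeta_sum Y (Complex (1/2) (\<alpha> * real l))))\<^sup>2) \<le>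
    (\<alpha> * ln Y + 1) * ((L + 8 * Y / \<alpha> * (1 + ln Y)) * (1 + ln Y))"
proof -
  define g where "g = (\<lambda>n::nat. nat \<lfloor>\<alpha> * ln (real n)\<rfloor>)"
  define J where "J = nat \<lfloor>\<alpha> * ln Y\<rfloor>"
  define S where "S = (\<lambda>j. {n\<in>{1..Y}. g n = j})"
  define W where "W = L + 8 * Y / \<alpha> * (1 + ln Y)"
  have lnY: "ln Y \<ge> 0" using Y by simp
  have W0: "W \<ge> 0" unfolding W_def using \<alpha> lnY by auto
  have g: "g ` {1..Y} \<subseteq> {..J}"
    unfolding g_def J_def using \<alpha> by (auto intro!: nat_mono floor_mono mult_left_mono)
  let ?c = "\<lambda>n. complex_of_real (1 / sqrt (real n))"
  let ?x = "\<lambda>n. - (\<alpha> * ln (real n))"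
  have eq: "zeta_sum Y (Complex (1/2) (\<alpha> * real l)) = (\<Sum>j\<le>J. \<Sum>n\<in>S j. ?c n * cis (real l * ?x n))" for l
  proof -
    have "zeta_sum Y (Complex (1/2) (\<alpha> * real l)) = (\<Sum>n\<in>{1..Y}. ?c n * cis (real l * ?x n))"
      unfolding zeta_sum_def
      by (intro sum.cong refl, subst of_nat_powr_critical_line) (auto simp: algebra_simps)
    also have "\<dots> = (\<Sum>j\<le>J. \<Sum>n\<in>S j. ?c n * cis (real l * ?x n))"
      unfolding S_def by (rule sum.group[symmetric]) (use g in auto)
    finally show ?thesis .
  qed
  have row: "(\<Sum>m\<in>S j. norm (dirichlet_kernel L (?x n - ?x m))) \<le> W" if n: "n \<in> S j" for n j
  proof -
    have fin: "finite (S j)" unfolding S_def by auto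
    \<comment> \<open>Within a class the phases differ by at most 1, and the spacing of logarithms
      below \<open>Y\<close> keeps them \<alpha> |n - m| / Y apart; the row sum becomes
      harmonic.\<close>
    have b: "norm (dirichlet_kernel L (?x n - ?x m)) \<le> 4 * Y / \<alpha> * (1 / \<bar>real n - real m\<bar>)"
      if m: "m \<in> S j - {n}" for m
    proof -
      have "g n = g m" using n m unfolding S_def by auto
      moreover have "\<alpha> * ln (real n) \<ge> 0" "\<alpha> * ln (real m) \<ge> 0"
        using n m \<alpha> unfolding S_def by auto
      ultimately have "\<lfloor>\<alpha> * ln (real n)\<rfloor> = \<lfloor>\<alpha> * ln (real m)\<rfloor>"
        unfolding g_def by (simp add: eq_nat_nat_iff)
      hence le1: "\<bar>?x n - ?x m\<bar> \<le> 1" by linarith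
      have d: "\<bar>real n - real m\<bar> > 0" using m by auto
      have "?x n - ?x m = -(\<alpha> * (ln (real n) - ln (real m)))" by (simp add: algebra_simps)
      hence "\<bar>?x n - ?x m\<bar> = \<alpha> * \<bar>ln (real n) - ln (real m)\<bar>"
        using \<alpha> by (simp only: abs_minus_cancel abs_mult abs_of_pos)
      also have "\<dots> \<ge> \<alpha> * (\<bar>real n - real m\<bar> / Y)"
        using n m \<alpha> unfolding S_def by (intro mult_left_mono abs_ln_diff_ge) auto
      finally have ge: "\<bar>?x n - ?x m\<bar> \<ge> \<alpha> * (\<bar>real n - real m\<bar> / Y)" .
      have pos: "\<alpha> * (\<bar>real n - real m\<bar> / Y) > 0" using \<alpha> Y d by auto
      have "norm (dirichlet_kernel L (?x n - ?x m)) \<le> 4 / \<bar>?x n - ?x m\<bar>"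
        using le1 ge pos by (intro norm_dirichlet_kernel_le_inverse) auto
      also have "\<dots> \<le> 4 / (\<alpha> * (\<bar>real n - real m\<bar> / Y))"
        using ge pos by (intro divide_left_mono mult_pos_pos[OF _ pos]) linarith+
      also have "\<dots> = 4 * Y / \<alpha> * (1 / \<bar>real n - real m\<bar>)" by simp
      finally show ?thesis .
    qed
    have nY: "n \<in> {1..Y}" using n unfolding S_def by auto
    have "(\<Sum>m\<in>S j. norm (dirichlet_kernel L (?x n - ?x m))) =
        norm (dirichlet_kernel L (?x n - ?x n)) + (\<Sum>m\<in>S j - {n}. norm (dirichlet_kernel L (?x n - ?x m)))"
      by (rule sum.remove[OF fin n])
    also have "\<dots> \<le> L + (\<Sum>m\<in>S j - {n}. 4 * Y / \<alpha> * (1 / \<bar>real n - real m\<bar>))"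
      by (intro add_mono norm_dirichlet_kernel_le sum_mono b)
    also have "(\<Sum>m\<in>S j - {n}. 4 * Y / \<alpha> * (1 / \<bar>real n - real m\<bar>)) \<le> (\<Sum>m\<in>{1..Y} - {n}. 4 * Y / \<alpha> * (1 / \<bar>real n - real m\<bar>))"
      using \<alpha> unfolding S_def by (intro sum_mono2) auto
    also have "\<dots> \<le> 4 * Y / \<alpha> * (2 * harm Y)"
      unfolding sum_distrib_left[symmetric] using \<alpha> by (intro mult_left_mono sum_inverse_dist_le nY) auto
    also have "\<dots> \<le> 4 * Y / \<alpha> * (2 * (1 + ln Y))"
      using \<alpha> Y by (intro mult_left_mono harm_le_Suc_ln) auto
    also have "4 * Y / \<alpha> * (2 * (1 + ln Y)) = 8 * Y / \<alpha> * (1 + ln Y)" by simp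
    finally show ?thesis unfolding W_def by simp
  qed
  have "(\<Sum>l<L. (norm (zeta_sum Y (Complex (1/2) (\<alpha> * real l))))\<^sup>2) \<le>
      (\<Sum>l<L. real (Suc J) * (\<Sum>j\<le>J. (norm (\<Sum>n\<in>S j. ?c n * cis (real l * ?x n)))\<^sup>2))"
  proof (rule sum_mono)
    fix l
    have "(norm (zeta_sum Y (Complex (1/2) (\<alpha> * real l))))\<^sup>2 \<le> (\<Sum>j\<le>J. norm (\<Sum>n\<in>S j. ?c n * cis (real l * ?x n)))\<^sup>2"
      unfolding eq by (intro power_mono norm_sum norm_ge_zero)
    also have "\<dots> \<le> (\<Sum>j\<le>J. (norm (\<Sum>n\<in>S j. ?c n * cis (real l * ?x n)))\<^sup>2) * card {..J}"
      by (rule sum_squared_le_sum_of_squares)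
    finally show "(norm (zeta_sum Y (Complex (1/2) (\<alpha> * real l))))\<^sup>2 \<le>
      real (Suc J) * (\<Sum>j\<le>J. (norm (\<Sum>n\<in>S j. ?c n * cis (real l * ?x n)))\<^sup>2)" by (simp add: mult.commute)
  qed
  also have "\<dots> = real (Suc J) * (\<Sum>j\<le>J. \<Sum>l<L. (norm (\<Sum>n\<in>S j. ?c n * cis (real l * ?x n)))\<^sup>2)"
    by (subst sum.swap) (simp add: sum_distrib_left)
  also have "\<dots> \<le> real (Suc J) * (\<Sum>j\<le>J. W * (\<Sum>n\<in>S j. (norm (?c n))\<^sup>2))"
    by (intro mult_left_mono sum_mono large_sieve_row_sum row) auto
  also have "(\<Sum>j\<le>J. W * (\<Sum>n\<in>S j. (norm (?c n))\<^sup>2)) = W * (\<Sum>n\<in>{1..Y}. (norm (?c n))\<^sup>2)"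
    unfolding S_def sum_distrib_left[symmetric] by (subst sum.group) (use g in auto)
  also have "(\<Sum>n\<in>{1..Y}. (norm (?c n))\<^sup>2) = harm Y"
    unfolding harm_def by (intro sum.cong refl) (auto simp: norm_divide power_divide field_simps)
  also have "real (Suc J) * (W * harm Y) \<le> (\<alpha> * ln Y + 1) * (W * (1 + ln Y))"
  proof (intro mult_mono)
    have "\<alpha> * ln Y \<ge> 0" using \<alpha> lnY by simp
    thus "real (Suc J) \<le> \<alpha> * ln Y + 1" unfolding J_def by linarith
    show "harm Y \<le> 1 + ln Y" using harm_le_Suc_ln[of Y] Y by simp
  qed (use W0 lnY \<alpha> in \<open>auto intro!: mult_nonneg_nonneg harm_nonneg\<close>)
  finally show ?thesis unfolding W_def by simp
qed

section \<open>The resonance inequality\<close>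

text \<open>For fixed \<open>c\<close> each distance below \<open>h\<close> is met at most twice,
  once on either side of \<open>c\<close>.\<close>

lemma sum_abs_diff_le:
  fixes g :: "nat \<Rightarrow> real"
  assumes "\<And>l. g l \<ge> 0"
  shows "(\<Sum>a<L. if nat \<bar>int a - int c\<bar> < h then g (nat \<bar>int a - int c\<bar>) else 0) \<le> 2 * (\<Sum>l<h. g l)"
proof -
  define A1 where "A1 = {a\<in>{..<L}. c \<le> a \<and> a - c < h}"
  define A2 where "A2 = {a\<in>{..<L}. a < c \<and> c - a < h}"
  have "(\<Sum>a<L. if nat \<bar>int a - int c\<bar> < h then g (nat \<bar>int a - int c\<bar>) else 0) =
      (\<Sum>a\<in>A1 \<union> A2. g (nat \<bar>int a - int c\<bar>))"
    unfolding A1_def A2_def by (intro sum.mono_neutral_cong_right) auto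
  also have "\<dots> = (\<Sum>a\<in>A1. g (nat \<bar>int a - int c\<bar>)) + (\<Sum>a\<in>A2. g (nat \<bar>int a - int c\<bar>))"
    unfolding A1_def A2_def by (intro sum.union_disjoint) auto
  also have "(\<Sum>a\<in>A1. g (nat \<bar>int a - int c\<bar>)) = (\<Sum>l\<in>(\<lambda>a. a - c) ` A1. g l)"
    by (subst sum.reindex) (auto simp: A1_def inj_on_def nat_diff_distrib intro!: sum.cong arg_cong[where f = g])
  also have "\<dots> \<le> (\<Sum>l<h. g l)"
    using assms by (intro sum_mono2) (auto simp: A1_def)
  also have "(\<Sum>a\<in>A2. g (nat \<bar>int a - int c\<bar>)) = (\<Sum>l\<in>(\<lambda>a. c - a) ` A2. g l)"
    by (subst sum.reindex) (auto simp: A2_def inj_on_def nat_diff_distrib intro!: sum.cong arg_cong[where f = g])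
  also have "\<dots> \<le> (\<Sum>l<h. g l)"
    using assms by (intro sum_mono2) (auto simp: A2_def)
  finally show ?thesis by simp
qed

text \<open>A difference d occurs L - |d| times among the pairs, so this is the unnormalised Fejer
  kernel.\<close>

lemma sum_cis_diff_eq_kernel:
  "(\<Sum>a<L. \<Sum>c<L. cis (real_of_int (int a - int c) * z)) = of_real ((norm (dirichlet_kernel L z))\<^sup>2)"
  unfolding complex_norm_square dirichlet_kernel_def cnj_sum cis_cnj sum_product cis_mult
  by (intro sum.cong refl arg_cong[where f = cis]) (simp add: algebra_simps)

lemma resonance_fejer_expansion:
  fixes w r x y :: "nat \<Rightarrow> real" and A :: "nat set" and Q L :: nat
  defines "P \<equiv> \<lambda>l::int. \<Sum>k\<in>A. of_real (w k) * cis (- (of_int l * x k))"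
    and "R \<equiv> \<lambda>l::int. \<Sum>j<Q. of_real (r j) * cis (of_int l * y j)"
  shows "(\<Sum>a<L. \<Sum>c<L. P (int a - int c) * (R (int a - int c) * cnj (R (int a - int c)))) =
    of_real (\<Sum>k\<in>A. \<Sum>i<Q. \<Sum>j<Q. w k * r i * r j * (norm (dirichlet_kernel L (y i - y j - x k)))\<^sup>2)"
proof -
  have "P l * (R l * cnj (R l)) = (\<Sum>k\<in>A. \<Sum>i<Q. \<Sum>j<Q. of_real (w k * r i * r j) * cis (of_int l * (y i - y j - x k)))" for l
  proof -
    have eq: "R l * cnj (R l) = (\<Sum>i<Q. \<Sum>j<Q. (of_real (r i) * cis (of_int l * y i)) * (of_real (r j) * cis (- (of_int l * y j))))"
      unfolding R_def by (simp add: sum_product cis_cnj)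
    have "P l * (R l * cnj (R l)) = (\<Sum>k\<in>A. of_real (w k) * cis (- (of_int l * x k)) * (R l * cnj (R l)))"
      unfolding P_def by (rule sum_distrib_right)
    also have "\<dots> = (\<Sum>k\<in>A. \<Sum>i<Q. \<Sum>j<Q. of_real (w k) * cis (- (of_int l * x k)) *
        ((of_real (r i) * cis (of_int l * y i)) * (of_real (r j) * cis (- (of_int l * y j)))))"
      by (simp only: eq sum_distrib_left)
    also have "\<dots> = (\<Sum>k\<in>A. \<Sum>i<Q. \<Sum>j<Q. of_real (w k * r i * r j) * cis (of_int l * (y i - y j - x k)))"
    proof (intro sum.cong refl)
      fix k i j
      have "cis (of_int l * (y i - y j - x k)) = cis (- (of_int l * x k)) * (cis (of_int l * y i) * cis (- (of_int l * y j)))"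
        unfolding cis_mult by (rule arg_cong[where f = cis]) (simp add: algebra_simps)
      thus "of_real (w k) * cis (- (of_int l * x k)) *
        ((of_real (r i) * cis (of_int l * y i)) * (of_real (r j) * cis (- (of_int l * y j)))) =
        of_real (w k * r i * r j) * cis (of_int l * (y i - y j - x k))" by simp
    qed
    finally show ?thesis .
  qed
  hence "(\<Sum>a<L. \<Sum>c<L. P (int a - int c) * (R (int a - int c) * cnj (R (int a - int c)))) =
    (\<Sum>a<L. \<Sum>c<L. \<Sum>k\<in>A. \<Sum>i<Q. \<Sum>j<Q. of_real (w k * r i * r j) * cis (real_of_int (int a - int c) * (y i - y j - x k)))"
    by simp
  also have "\<dots> = (\<Sum>k\<in>A. \<Sum>i<Q. \<Sum>j<Q. \<Sum>a<L. \<Sum>c<L. of_real (w k * r i * r j) * cis (real_of_int (int a - int c) * (y i - y j - x k)))"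
    by (simp only: sum.swap[of _ "{..<Q}" "{..<L}"] sum.swap[of _ A "{..<L}"])
  also have "\<dots> = (\<Sum>k\<in>A. \<Sum>i<Q. \<Sum>j<Q. of_real (w k * r i * r j) *
      of_real ((norm (dirichlet_kernel L (y i - y j - x k)))\<^sup>2))"
    by (simp only: sum_distrib_left[symmetric] sum_cis_diff_eq_kernel)
  finally show ?thesis by (simp only: of_real_sum of_real_mult)
qed

text \<open>The frequencies of the resonator are rounded to the grid \<open>2\<pi>j/Q\<close> with \<open>Q = 8L\<close>, so that its
  mean square is given exactly by Parseval's identity; the coefficient at a grid point is the
  $\ell^2$-norm of the weights rounded to it, which by Cauchy--Schwarz loses nothing in the lower bound.
  The double sum over \<open>a - c\<close> is a Fejer kernel in disguise: all terms are nonnegative, so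
  unwanted coincidences between frequencies may be dropped.\<close>

lemma resonance_inequality:
  fixes w f x :: "nat \<Rightarrow> real" and A I :: "nat set" and E :: "(nat \<times> nat) set" and L h :: nat and M B :: real
  defines "P \<equiv> \<lambda>l::int. \<Sum>k\<in>A. of_real (w k) * cis (- (of_int l * x k))"
  assumes L: "L > 0" and fin: "finite A" "finite I"
    and w: "\<And>k. w k \<ge> 0" and f: "\<And>m. f m \<ge> 0"
    and E: "E \<subseteq> A \<times> I"
    and E': "\<And>k m. (k, m) \<in> E \<Longrightarrow> k > 0 \<and> k * m \<in> I \<and> x (k * m) = x k + x m"
    and M: "M \<ge> 0" "\<And>l. h \<le> l \<Longrightarrow> l < L \<Longrightarrow> norm (P (int l)) \<le> M"
    and B: "(\<Sum>l<h. norm (P (int l))) \<le> B"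
  shows "real L * (\<Sum>(k,m)\<in>E. w k * (f m * f (k * m))) \<le> 4 * (8 * L * M + 2 * B * card I) * (\<Sum>m\<in>I. (f m)\<^sup>2)"
proof -
  define D where "D = (\<Sum>m\<in>I. (f m)\<^sup>2)"
  define Q where "Q = 8 * L"
  have Q0: "Q > 0" using L unfolding Q_def by simp
  \<comment> \<open>The index of the grid point at or just below the frequency of \<open>m\<close>,
    reduced modulo \<open>2 * pi\<close>.\<close>
  define b where "b = (\<lambda>m. nat \<lfloor>Q * frac (x m / (2 * pi))\<rfloor>)"
  define r where "r = (\<lambda>j. sqrt (\<Sum>m\<in>{m\<in>I. b m = j}. (f m)\<^sup>2))"
  define y where "y = (\<lambda>j. 2 * pi * real j / real Q)"
  define R where "R = (\<lambda>l::int. \<Sum>j<Q. complex_of_real (r j) * cis (of_int l * y j))"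
  have D0: "D \<ge> 0" unfolding D_def by (intro sum_nonneg) auto
  have r0: "r j \<ge> 0" for j unfolding r_def by (intro real_sqrt_ge_zero sum_nonneg) auto
  have r2: "(r j)\<^sup>2 = (\<Sum>m\<in>{m\<in>I. b m = j}. (f m)\<^sup>2)" for j
    unfolding r_def by (intro real_sqrt_pow2 sum_nonneg) auto
  have bQ: "b m < Q" for m
  proof -
    have "Q * frac (x m / (2 * pi)) < Q" using Q0 frac_lt_1[of "x m / (2*pi)"] by simp
    moreover have "Q * frac (x m / (2 * pi)) \<ge> 0" by (simp add: frac_ge_0)
    ultimately show ?thesis unfolding b_def by linarith
  qed
  have y_near: "\<exists>n::int. \<exists>\<delta>. 0 \<le> \<delta> \<and> \<delta> < 2 * pi / Q \<and> y (b m) = x m - 2 * pi * n - \<delta>" for m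
  proof -
    define d where "d = Q * frac (x m / (2 * pi)) - b m"
    have "Q * frac (x m / (2 * pi)) \<ge> 0" by (simp add: frac_ge_0)
    hence d: "0 \<le> d" "d < 1" unfolding d_def b_def by linarith+
    have "real (b m) = Q * (x m / (2 * pi) - \<lfloor>x m / (2 * pi)\<rfloor>) - d"
      unfolding d_def frac_def by simp
    hence "y (b m) = x m - 2 * pi * \<lfloor>x m / (2 * pi)\<rfloor> - 2 * pi * d / Q"
      unfolding y_def using Q0 by (simp add: field_simps)
    moreover have "0 \<le> 2 * pi * d / Q" "2 * pi * d / Q < 2 * pi / Q"
      using d Q0 by (auto simp: divide_strict_right_mono)
    ultimately show ?thesis by blast
  qed
  have sum_r2: "(\<Sum>j<Q. (r j)\<^sup>2) = D"
    unfolding r2 D_def by (rule sum.group) (use fin bQ in auto)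
  have parseval: "(\<Sum>a<L. (norm (R (int a - int c)))\<^sup>2) \<le> Q * D" for c
  proof -
    have eq: "R (int a - int c) = (\<Sum>j<Q. (of_real (r j) * cis (- (real c * y j))) * cis (real a * y j))" for a
      unfolding R_def by (intro sum.cong refl) (simp add: mult.assoc cis_mult algebra_simps)
    \<comment> \<open>The window of length \<open>L\<close> is enlarged to a full period
      \<open>Q\<close>, on which the grid frequencies are exactly orthogonal.\<close>
    have "(\<Sum>a<L. (norm (R (int a - int c)))\<^sup>2) \<le> (\<Sum>a<Q. (norm (R (int a - int c)))\<^sup>2)"
      unfolding Q_def by (intro sum_mono2) auto
    also have "\<dots> \<le> Q * (\<Sum>j<Q. (norm (of_real (r j) * cis (- (real c * y j))))\<^sup>2)"
      unfolding eq
    proof (rule large_sieve_row_sum)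
      fix n assume n: "n \<in> {..<Q}"
      have "(\<Sum>m<Q. norm (dirichlet_kernel Q (y n - y m))) = (\<Sum>m<Q. if m = n then norm (dirichlet_kernel Q (y n - y m)) else 0)"
      proof (intro sum.cong refl)
        fix m assume "m \<in> {..<Q}"
        moreover have "y n - y m = 2 * pi * (real n - real m) / real Q"
          unfolding y_def by (simp add: diff_divide_distrib right_diff_distrib)
        ultimately show "norm (dirichlet_kernel Q (y n - y m)) = (if m = n then norm (dirichlet_kernel Q (y n - y m)) else 0)"
          using dirichlet_kernel_eq_0[of n Q m] n by auto
      qed
      also have "\<dots> = norm (dirichlet_kernel Q (y n - y n))" using n by simp
      also have "\<dots> \<le> Q" by (rule norm_dirichlet_kernel_le)
      finally show "(\<Sum>m<Q. norm (dirichlet_kernel Q (y n - y m))) \<le> real Q" .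
    qed
    also have "(\<Sum>j<Q. (norm (of_real (r j) * cis (- (real c * y j))))\<^sup>2) = D"
      unfolding sum_r2[symmetric] by (intro sum.cong refl) (simp add: norm_mult)
    finally show ?thesis .
  qed
  \<comment> \<open>The pointwise bound for the short range: at most \<open>card I\<close>
    coefficients \<open>r j\<close> are nonzero. It is the only place where the size of the
    resonator enters.\<close>
  have R_le: "(norm (R l))\<^sup>2 \<le> card I * D" for l
  proof -
    have "norm (R l) \<le> (\<Sum>j<Q. r j)"
      unfolding R_def by (rule sum_norm_le) (simp add: norm_mult r0)
    also have "\<dots> = (\<Sum>j\<in>b ` I. r j)"
      using bQ fin unfolding r_def by (intro sum.mono_neutral_right) (auto intro!: sum.neutral)
    finally have "(norm (R l))\<^sup>2 \<le> (\<Sum>j\<in>b ` I. r j)\<^sup>2" by (intro power_mono) auto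
    also have "\<dots> \<le> (\<Sum>j\<in>b ` I. (r j)\<^sup>2) * card (b ` I)"
      by (rule sum_squared_le_sum_of_squares)
    also have "\<dots> \<le> D * card I"
      unfolding sum_r2[symmetric] using fin bQ
      by (intro mult_mono sum_mono2) (auto intro!: card_image_le sum_nonneg)
    finally show ?thesis by (simp add: mult.commute)
  qed
  have P_sym: "norm (P l) = norm (P (int (nat \<bar>l\<bar>)))" for l
  proof (cases "l \<ge> 0")
    case False
    have "P (-l) = cnj (P l)" unfolding P_def by (simp add: cis_cnj)
    thus ?thesis using False by simp
  qed simp
  \<comment> \<open>For fixed \<open>c\<close>, indices at distance at least \<open>h\<close> are
    handled by \<open>M\<close> and Parseval, nearer ones by the pointwise bound for
    \<open>R\<close> and the short sum \<open>B\<close>, counted on both sides.\<close>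
  have upper: "norm (\<Sum>a<L. \<Sum>c<L. P (int a - int c) * (R (int a - int c) * cnj (R (int a - int c)))) \<le>
      real L * (M * (Q * D) + card I * D * (2 * B))"
  proof -
    have "norm (\<Sum>c<L. \<Sum>a<L. P (int a - int c) * (R (int a - int c) * cnj (R (int a - int c)))) \<le>
      (\<Sum>c<L. M * (Q * D) + card I * D * (2 * B))"
    proof (rule sum_norm_le)
      fix c assume c: "c \<in> {..<L}"
      have "norm (\<Sum>a<L. P (int a - int c) * (R (int a - int c) * cnj (R (int a - int c)))) \<le>
         (\<Sum>a<L. M * (norm (R (int a - int c)))\<^sup>2 + card I * D *
           (if nat \<bar>int a - int c\<bar> < h then norm (P (int (nat \<bar>int a - int c\<bar>))) else 0))"
      proof (rule sum_norm_le)
        fix a assume a: "a \<in> {..<L}"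
        let ?l = "int a - int c"
        have "norm (P ?l * (R ?l * cnj (R ?l))) = norm (P (int (nat \<bar>?l\<bar>))) * (norm (R ?l))\<^sup>2"
          by (simp add: norm_mult power2_eq_square P_sym[of ?l])
        also have "\<dots> \<le> M * (norm (R ?l))\<^sup>2 + card I * D *
           (if nat \<bar>?l\<bar> < h then norm (P (int (nat \<bar>?l\<bar>))) else 0)"
        proof (cases "nat \<bar>?l\<bar> < h")
          case True
          have "norm (P (int (nat \<bar>?l\<bar>))) * (norm (R ?l))\<^sup>2 \<le> norm (P (int (nat \<bar>?l\<bar>))) * (card I * D)"
            by (intro mult_left_mono R_le) auto
          moreover have "M * (norm (R ?l))\<^sup>2 \<ge> 0" using M by auto
          ultimately show ?thesis using True by (simp add: mult.commute)
        next
          case False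
          have "norm (P (int (nat \<bar>?l\<bar>))) \<le> M" using False a c by (intro M) auto
          thus ?thesis using False by (simp add: mult_right_mono)
        qed
        finally show "norm (P ?l * (R ?l * cnj (R ?l))) \<le> M * (norm (R ?l))\<^sup>2 + card I * D *
           (if nat \<bar>?l\<bar> < h then norm (P (int (nat \<bar>?l\<bar>))) else 0)" .
      qed
      also have "\<dots> = M * (\<Sum>a<L. (norm (R (int a - int c)))\<^sup>2) + card I * D *
          (\<Sum>a<L. if nat \<bar>int a - int c\<bar> < h then norm (P (int (nat \<bar>int a - int c\<bar>))) else 0)"
        by (simp only: sum.distrib sum_distrib_left)
      also have "\<dots> \<le> M * (Q * D) + card I * D * (2 * B)"
      proof (intro add_mono mult_left_mono parseval)
        have "(\<Sum>a<L. if nat \<bar>int a - int c\<bar> < h then norm (P (int (nat \<bar>int a - int c\<bar>))) else 0) \<le>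
            2 * (\<Sum>l<h. norm (P (int l)))"
          using sum_abs_diff_le[of "\<lambda>l. norm (P (int l))" c h L] by simp
        thus "(\<Sum>a<L. if nat \<bar>int a - int c\<bar> < h then norm (P (int (nat \<bar>int a - int c\<bar>))) else 0) \<le> 2 * B"
          using B by linarith
      qed (use M D0 in auto)
      finally show "norm (\<Sum>a<L. P (int a - int c) * (R (int a - int c) * cnj (R (int a - int c)))) \<le>
         M * (Q * D) + card I * D * (2 * B)" .
    qed
    thus ?thesis by (subst sum.swap) simp
  qed
  define T where "T = (\<Sum>k\<in>A. \<Sum>i<Q. \<Sum>j<Q. w k * r i * r j * (norm (dirichlet_kernel L (y i - y j - x k)))\<^sup>2)"
  have T_upper: "T \<le> real L * (M * (Q * D) + card I * D * (2 * B))"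
    using upper resonance_fejer_expansion[of w x A r y Q L]
    unfolding P_def R_def T_def by (simp only: norm_of_real)
  \<comment> \<open>An edge is sent to the index triple of the term of \<open>T\<close> in which it
    is seen. Several edges may share a triple after rounding, so they are grouped by their image and
    each term of \<open>T\<close> is used once.\<close>
  define \<phi> where "\<phi> = (\<lambda>(k, m). (k, b (k * m), b m))"
  have finE: "finite E" using E fin by (meson finite_SigmaI finite_subset)
  have kernel_lower: "(norm (dirichlet_kernel L (y (b (k * m)) - y (b m) - x k)))\<^sup>2 \<ge> (real L)\<^sup>2 / 4"
    if km: "(k, m) \<in> E" for k m
  proof -
    obtain n1 :: int and d1 where 1: "0 \<le> d1" "d1 < 2 * pi / Q" "y (b m) = x m - 2 * pi * n1 - d1"
      using y_near[of m] by blast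
    obtain n2 :: int and d2 where 2: "0 \<le> d2" "d2 < 2 * pi / Q" "y (b (k * m)) = x (k * m) - 2 * pi * n2 - d2"
      using y_near[of "k * m"] by blast
    have "y (b (k * m)) - y (b m) - x k + 2 * pi * of_int (n2 - n1) = d1 - d2"
      using 1 2 E'[OF km] by (simp add: algebra_simps)
    moreover have "\<bar>d1 - d2\<bar> \<le> 2 * pi / Q" using 1 2 by (simp add: abs_le_iff)
    ultimately have "\<bar>y (b (k * m)) - y (b m) - x k + 2 * pi * of_int (n2 - n1)\<bar> * real L \<le> 2 * pi / Q * real L"
      by (intro mult_right_mono) auto
    \<comment> \<open>With \<open>Q = 8 * L\<close> the left side is \<open>pi / 4\<close>, so
      rounding both frequencies stays within the tolerance of the kernel bound.\<close>
    also have "\<dots> \<le> pi / 3" using L unfolding Q_def by (simp add: field_simps)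
    finally have "norm (dirichlet_kernel L (y (b (k * m)) - y (b m) - x k)) \<ge> L / 2"
      by (rule dirichlet_kernel_near_multiple_2pi)
    hence "(norm (dirichlet_kernel L (y (b (k * m)) - y (b m) - x k)))\<^sup>2 \<ge> (real L / 2)\<^sup>2"
      by (intro power_mono) auto
    thus ?thesis by (simp add: power_divide)
  qed
  \<comment> \<open>On one fibre \<open>k\<close> is fixed, so both \<open>m\<close> and
    \<open>k * m\<close> determine the edge. Cauchy-Schwarz therefore bounds the fibre by the full
    norms \<open>r j\<close> and \<open>r i\<close> of the two grid points.\<close>
  have cs: "(\<Sum>e\<in>{e\<in>E. \<phi> e = (k, i, j)}. f (snd e) * f (k * snd e)) \<le> r i * r j" for k i j
  proof (cases "{e\<in>E. \<phi> e = (k, i, j)} = {}")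
    case True
    show ?thesis unfolding True using r0[of i] r0[of j] by simp
  next
    case False
    let ?S = "{e\<in>E. \<phi> e = (k, i, j)}"
    have k0: "k > 0" using False E' unfolding \<phi>_def by auto
    have S: "fst e = k \<and> b (snd e) = j \<and> b (k * snd e) = i \<and> snd e \<in> I \<and> k * snd e \<in> I" if "e \<in> ?S" for e
      using that E E' unfolding \<phi>_def by (cases e) auto
    have inj1: "inj_on snd ?S"
    proof (rule inj_onI)
      fix e e' assume "e \<in> ?S" "e' \<in> ?S" "snd e = snd e'"
      thus "e = e'" using S[of e] S[of e'] by (simp add: prod_eq_iff)
    qed
    have inj2: "inj_on (\<lambda>e. k * snd e) ?S"
    proof (rule inj_onI)
      fix e e' assume "e \<in> ?S" "e' \<in> ?S" "k * snd e = k * snd e'"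
      thus "e = e'" using S[of e] S[of e'] k0 by (simp add: prod_eq_iff)
    qed
    have "(\<Sum>e\<in>?S. f (snd e) * f (k * snd e)) \<le> L2_set (\<lambda>e. f (snd e)) ?S * L2_set (\<lambda>e. f (k * snd e)) ?S"
      using L2_set_mult_ineq[of "\<lambda>e. f (snd e)" "\<lambda>e. f (k * snd e)" ?S] f by simp
    also have "\<dots> \<le> r j * r i"
    proof (intro mult_mono)
      have "(\<Sum>e\<in>?S. (f (snd e))\<^sup>2) = (\<Sum>m\<in>snd ` ?S. (f m)\<^sup>2)"
        by (subst sum.reindex[OF inj1]) simp
      also have "\<dots> \<le> (\<Sum>m\<in>{m\<in>I. b m = j}. (f m)\<^sup>2)"
        using S fin by (intro sum_mono2) fastforce+
      finally show "L2_set (\<lambda>e. f (snd e)) ?S \<le> r j" unfolding L2_set_def r_def by simp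
      have "(\<Sum>e\<in>?S. (f (k * snd e))\<^sup>2) = (\<Sum>m\<in>(\<lambda>e. k * snd e) ` ?S. (f m)\<^sup>2)"
        by (subst sum.reindex[OF inj2]) simp
      also have "\<dots> \<le> (\<Sum>m\<in>{m\<in>I. b m = i}. (f m)\<^sup>2)"
        using S fin by (intro sum_mono2) fastforce+
      finally show "L2_set (\<lambda>e. f (k * snd e)) ?S \<le> r i" unfolding L2_set_def r_def by simp
    qed (auto simp: r0 L2_set_nonneg)
    finally show ?thesis by (simp add: mult.commute)
  qed
  have "(real L)\<^sup>2 / 4 * (\<Sum>(k,m)\<in>E. w k * (f m * f (k * m))) =
     (real L)\<^sup>2 / 4 * (\<Sum>t\<in>\<phi> ` E. \<Sum>e\<in>{e\<in>E. \<phi> e = t}. w (fst e) * (f (snd e) * f (fst e * snd e)))"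
    by (subst sum.image_gen[OF finE, of _ \<phi>]) (simp add: case_prod_unfold)
  also have "\<dots> = (\<Sum>t\<in>\<phi> ` E. \<Sum>e\<in>{e\<in>E. \<phi> e = t}. (real L)\<^sup>2 / 4 * (w (fst e) * (f (snd e) * f (fst e * snd e))))"
    by (simp only: sum_distrib_left)
  also have "\<dots> \<le> (\<Sum>(k,i,j)\<in>\<phi> ` E. w k * r i * r j * (norm (dirichlet_kernel L (y i - y j - x k)))\<^sup>2)"
  proof (rule sum_mono)
    fix t assume t: "t \<in> \<phi> ` E"
    then obtain k m where km: "(k, m) \<in> E" "t = (k, b (k * m), b m)" unfolding \<phi>_def by auto
    let ?i = "b (k * m)" and ?j = "b m"
    have "(\<Sum>e\<in>{e\<in>E. \<phi> e = t}. (real L)\<^sup>2 / 4 * (w (fst e) * (f (snd e) * f (fst e * snd e)))) =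
       (\<Sum>e\<in>{e\<in>E. \<phi> e = t}. ((real L)\<^sup>2 / 4 * w k) * (f (snd e) * f (k * snd e)))"
      by (intro sum.cong refl) (auto simp: \<phi>_def km split: prod.splits)
    also have "\<dots> = ((real L)\<^sup>2 / 4 * w k) * (\<Sum>e\<in>{e\<in>E. \<phi> e = (k, ?i, ?j)}. f (snd e) * f (k * snd e))"
      by (simp only: sum_distrib_left km)
    also have "\<dots> \<le> ((real L)\<^sup>2 / 4 * w k) * (r ?i * r ?j)"
      by (intro mult_left_mono cs) (auto intro!: mult_nonneg_nonneg w)
    also have "\<dots> = (w k * (r ?i * r ?j)) * ((real L)\<^sup>2 / 4)" by simp
    also have "\<dots> \<le> (w k * (r ?i * r ?j)) * (norm (dirichlet_kernel L (y ?i - y ?j - x k)))\<^sup>2"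
      by (intro mult_left_mono kernel_lower km(1) mult_nonneg_nonneg w r0)
    finally show "(\<Sum>e\<in>{e\<in>E. \<phi> e = t}. (real L)\<^sup>2 / 4 * (w (fst e) * (f (snd e) * f (fst e * snd e)))) \<le>
       (case t of (k, i, j) \<Rightarrow> w k * r i * r j * (norm (dirichlet_kernel L (y i - y j - x k)))\<^sup>2)"
      unfolding km(2) by (simp add: mult.assoc)
  qed
  also have "\<dots> \<le> (\<Sum>(k,i,j)\<in>A \<times> {..<Q} \<times> {..<Q}. w k * r i * r j * (norm (dirichlet_kernel L (y i - y j - x k)))\<^sup>2)"
    using E fin bQ w r0 by (intro sum_mono2) (auto simp: \<phi>_def intro!: mult_nonneg_nonneg)
  also have "\<dots> = T" unfolding T_def by (simp add: sum.cartesian_product[symmetric] case_prod_unfold sum.cartesian_product)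
  also note T_upper
  finally have "real L * (real L * (\<Sum>(k,m)\<in>E. w k * (f m * f (k * m)))) \<le>
      real L * (4 * (M * (Q * D) + card I * D * (2 * B)))"
    by (simp add: power2_eq_square algebra_simps)
  hence "real L * (\<Sum>(k,m)\<in>E. w k * (f m * f (k * m))) \<le> 4 * (M * (Q * D) + card I * D * (2 * B))"
    using L by (subst (asm) mult_le_cancel_left_pos) auto
  thus ?thesis unfolding Q_def D_def by (simp add: algebra_simps)
qed

section \<open>Mertens' first theorem\<close>

lemma card_multiples: "d > 0 \<Longrightarrow> card {m\<in>{1..n}. d dvd m} = n div (d::nat)"
proof -
  assume d: "d > 0"
  have "{m\<in>{1..n}. d dvd m} = (\<lambda>q. d * q) ` {1..n div d}"
  proof (intro equalityI subsetI)
    fix m assume "m \<in> {m\<in>{1..n}. d dvd m}"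
    then obtain q where q: "m = d * q" "1 \<le> m" "m \<le> n" by auto
    have "q \<le> n div d" using q d by (simp add: less_eq_div_iff_mult_less_eq mult.commute)
    moreover have "1 \<le> q" using q by (cases q) auto
    ultimately show "m \<in> (\<lambda>q. d * q) ` {1..n div d}" using q(1) by (intro image_eqI[of _ _ q]) auto
  next
    fix m assume "m \<in> (\<lambda>q. d * q) ` {1..n div d}"
    then obtain q where "m = d * q" "q \<in> {1..n div d}" by blast
    hence q: "m = d * q" "1 \<le> q" "q \<le> n div d" by auto
    have "d * q \<le> n" using q d by (simp add: less_eq_div_iff_mult_less_eq mult.commute)
    thus "m \<in> {m\<in>{1..n}. d dvd m}" using q d by (simp add: Suc_le_eq)
  qed
  hence "card {m\<in>{1..n}. d dvd m} = card ((\<lambda>q. d * q) ` {1..n div d})" by simp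
  also have "\<dots> = n div d" using d by (subst card_image) (auto simp: inj_on_def)
  finally show ?thesis .
qed

text \<open>Legendre's formula: each ln m is split over the divisors of m and the order of summation
  is exchanged.\<close>

lemma ln_fact_mangoldt:
  "ln (fact n :: real) = (\<Sum>d=1..n. mangoldt d * real (n div d))"
proof -
  have "ln (fact n :: real) = (\<Sum>m=1..n. ln (real m))"
    by (induction n) (auto simp: ln_mult)
  also have "\<dots> = (\<Sum>m=1..n. \<Sum>d | d dvd m. mangoldt d)"
    by (intro sum.cong refl, subst mangoldt_sum) auto
  also have "\<dots> = (\<Sum>m=1..n. \<Sum>d=1..n. if d dvd m then mangoldt d else 0)"
  proof (rule sum.cong[OF refl])
    fix m assume m: "m \<in> {1..n}"
    hence "{d. d dvd m} = {d\<in>{1..n}. d dvd m}"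
      by (auto dest: dvd_imp_le intro: Nat.gr0I simp: Suc_le_eq)
    thus "(\<Sum>d | d dvd m. mangoldt d) = (\<Sum>d=1..n. if d dvd m then mangoldt d else (0::real))"
      by (simp only: sum.inter_filter[symmetric] finite_atLeastAtMost)
  qed
  also have "\<dots> = (\<Sum>d=1..n. \<Sum>m=1..n. if d dvd m then mangoldt d else 0)"
    by (rule sum.swap)
  also have "\<dots> = (\<Sum>d=1..n. mangoldt d * real (n div d))"
  proof (intro sum.cong refl)
    fix d assume "d \<in> {1..n}"
    hence "card {m\<in>{1..n}. d dvd m} = n div d" by (intro card_multiples) auto
    moreover have "(\<Sum>m=1..n. if d dvd m then mangoldt d else (0::real)) = (\<Sum>m\<in>{m\<in>{1..n}. d dvd m}. mangoldt d)"
      by (simp only: sum.inter_filter finite_atLeastAtMost)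
    ultimately show "(\<Sum>m=1..n. if d dvd m then mangoldt d else 0) = mangoldt d * real (n div d)"
      by simp
  qed
  finally show ?thesis .
qed

section \<open>Chebyshev's upper bound and the estimates of Mertens\<close>

definition chebyshev_psi :: "nat \<Rightarrow> real" where
  "chebyshev_psi n = (\<Sum>d=1..n. mangoldt d)"

text \<open>In Legendre's formula for the logarithm of the central binomial coefficient, each
  \<open>mangoldt d\<close> with n < d \<le> 2n has coefficient 1 and every other one a nonnegative
  coefficient; the binomial itself is at most 4^n.\<close>

lemma chebyshev_psi_double: "chebyshev_psi (2 * n) \<le> chebyshev_psi n + 2 * n * ln 2"
proof -
  have "real (2 * n choose n) = fact (2 * n) / (fact n * fact n)"
    using binomial_fact[of n "2 * n", where 'a = real] by simp
  hence "ln (fact (2 * n) :: real) = 2 * ln (fact n) + ln (real (2 * n choose n))"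
    by (simp add: ln_mult ln_div)
  moreover have "ln (real (2 * n choose n)) \<le> ln (2 ^ (2 * n))"
  proof (subst ln_le_cancel_iff)
    have "(2 * n choose n) \<le> (\<Sum>k\<le>2*n. 2 * n choose k)" by (rule member_le_sum) auto
    also have "\<dots> = 2 ^ (2 * n)" by (rule choose_row_sum)
    finally show "real (2 * n choose n) \<le> 2 ^ (2 * n)"
      by (metis of_nat_le_iff of_nat_numeral of_nat_power)
  qed auto
  ultimately have 1: "ln (fact (2 * n) :: real) - 2 * ln (fact n) \<le> 2 * n * ln 2"
    by (simp add: ln_realpow)
  have "ln (fact n :: real) = (\<Sum>d=1..2*n. mangoldt d * real (n div d))"
    unfolding ln_fact_mangoldt by (intro sum.mono_neutral_left) auto
  hence "ln (fact (2 * n) :: real) - 2 * ln (fact n) =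
      (\<Sum>d=1..2*n. mangoldt d * (real (2 * n div d) - 2 * real (n div d)))"
    unfolding ln_fact_mangoldt[of "2 * n"] by (simp add: sum_subtractf sum_distrib_left algebra_simps)
  also have "\<dots> \<ge> (\<Sum>d=1..2*n. mangoldt d * (if n < d then 1 else 0))"
  proof (intro sum_mono mult_left_mono mangoldt_nonneg)
    fix d assume d: "d \<in> {1..2*n}"
    have "2 * (n div d) \<le> 2 * n div d"
      using d by (auto simp: less_eq_div_iff_mult_less_eq intro!: div_times_less_eq_dividend)
    moreover have "2 * n div d = 1" "n div d = 0" if "n < d"
      using that d by (auto simp: div_nat_eqI)
    ultimately show "(if n < d then 1 else 0) \<le> real (2 * n div d) - 2 * real (n div d)"
      by (simp flip: of_nat_mult of_nat_le_iff)
  qed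
  also have "(\<Sum>d=1..2*n. mangoldt d * (if n < d then 1 else 0)) = chebyshev_psi (2 * n) - chebyshev_psi n"
  proof -
    have "chebyshev_psi (2 * n) = (\<Sum>d=1..2*n. mangoldt d * (if n < d then 1 else 0) + mangoldt d * (if n < d then 0 else 1))"
      unfolding chebyshev_psi_def by (intro sum.cong) auto
    also have "\<dots> = (\<Sum>d=1..2*n. mangoldt d * (if n < d then 1 else 0)) + (\<Sum>d=1..2*n. mangoldt d * (if n < d then 0 else 1))"
      by (rule sum.distrib)
    also have "(\<Sum>d=1..2*n. mangoldt d * (if n < d then 0 else 1)) = chebyshev_psi n"
      unfolding chebyshev_psi_def by (intro sum.mono_neutral_cong_right) auto
    finally show ?thesis by simp
  qed
  finally show ?thesis using 1 by linarith
qed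

text \<open>Induction by halving. For n = 2m + 1 the additional term is at most 2m ln 2, which
  together with the 6m ln 2 for 2m is still below 4n ln 2.\<close>

lemma chebyshev_psi_le: "chebyshev_psi n \<le> 4 * n * ln 2"
proof (induction n rule: less_induct)
  case (less n)
  show ?case
  proof (cases "n \<le> 1")
    case True
    thus ?thesis by (cases n) (auto simp: chebyshev_psi_def)
  next
    case False
    define m where "m = n div 2"
    have m: "m < n" "m \<ge> 1" using False unfolding m_def by auto
    have IH: "chebyshev_psi (2 * m) \<le> 6 * m * ln 2"
      using chebyshev_psi_double[of m] less.IH[OF m(1)] by simp
    show ?thesis
    proof (cases "even n")
      case True
      hence n: "n = 2 * m" unfolding m_def by simp
      show ?thesis using IH unfolding n by (rule order_trans) simp
    next
      case False
      hence n: "n = Suc (2 * m)" unfolding m_def by presburger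
      have "chebyshev_psi n = chebyshev_psi (2 * m) + mangoldt (Suc (2 * m))"
        unfolding n chebyshev_psi_def by simp
      also have "mangoldt (Suc (2 * m)) \<le> ln (real (Suc (2 * m)))" by (rule mangoldt_le) simp
      also have "\<dots> \<le> ln (2 ^ (2 * m))"
      proof (subst ln_le_cancel_iff)
        have "Suc (2 * m) \<le> 2 ^ (2 * m)" using less_exp[of "2 * m"] by (rule Suc_leI)
        thus "real (Suc (2 * m)) \<le> 2 ^ (2 * m)" by (metis of_nat_le_iff of_nat_numeral of_nat_power)
      qed auto
      also have "\<dots> = 2 * m * ln 2" by (simp add: ln_realpow)
      also note IH
      finally have "chebyshev_psi n \<le> 8 * m * ln 2" by simp
      thus ?thesis unfolding n by (rule order_trans) simp
    qed
  qed
qed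

lemma ln_fact_ge: "n * ln n - n \<le> ln (fact n :: real)"
proof (induction n)
  case (Suc n)
  show ?case
  proof (cases "n = 0")
    case False
    have "ln (1 + 1 / real n) \<le> 1 / real n" by (rule ln_add_one_self_le_self) simp
    hence "n * ln (1 + 1 / real n) \<le> 1" using False by (simp add: field_simps)
    moreover have "1 + 1 / real n = real (Suc n) / real n" using False by (simp add: field_simps)
    hence "ln (1 + 1 / real n) = ln (real (Suc n)) - ln n"
      using False by (simp only: ln_div) simp
    ultimately have "n * ln (real (Suc n)) - n * ln n \<le> 1" by (simp add: algebra_simps)
    moreover have "ln (fact (Suc n) :: real) = ln (real (Suc n)) + ln (fact n)"
      by (subst fact_Suc, subst ln_mult) auto
    ultimately show ?thesis using Suc by (simp add: algebra_simps del: fact_Suc)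
  qed auto
qed auto

text \<open>Replacing \<open>n div d\<close> by n/d in Legendre's formula changes it by at most
  \<open>chebyshev_psi n\<close>, which is O(n); comparing with ln n! and dividing by n leaves
  bounded errors.\<close>

lemma mangoldt_mertens:
  assumes "n > 0"
  shows "(\<Sum>d=1..n. mangoldt d / d) \<le> ln n + 4 * ln 2" "(\<Sum>d=1..n. mangoldt d / d) \<ge> ln n - 1"
proof -
  have up: "real (n div d) \<ge> real n / real d - 1" for d
    using divide_nat_diff_div_nat_less_one[of n d] by linarith
  have "n * (\<Sum>d=1..n. mangoldt d / d) - chebyshev_psi n = (\<Sum>d=1..n. mangoldt d * (real n / real d - 1))"
    unfolding chebyshev_psi_def sum_distrib_left sum_subtractf[symmetric]
    by (intro sum.cong) (auto simp: algebra_simps)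
  also have "\<dots> \<le> ln (fact n)"
    unfolding ln_fact_mangoldt by (intro sum_mono mult_left_mono up mangoldt_nonneg)
  also have "\<dots> \<le> ln (real n ^ n)"
    using assms fact_le_power[of n, where ?'a = real] by (subst ln_le_cancel_iff) auto
  finally have "n * (\<Sum>d=1..n. mangoldt d / d) \<le> n * (ln n + 4 * ln 2)"
    using chebyshev_psi_le[of n] assms by (simp add: ln_realpow algebra_simps)
  thus "(\<Sum>d=1..n. mangoldt d / d) \<le> ln n + 4 * ln 2"
    using assms by (subst (asm) mult_le_cancel_left_pos) auto
  have "n * ln n - n \<le> ln (fact n :: real)" by (rule ln_fact_ge)
  also have "\<dots> \<le> (\<Sum>d=1..n. mangoldt d * (real n / real d))"
    unfolding ln_fact_mangoldt by (intro sum_mono mult_left_mono of_nat_div_le_of_nat mangoldt_nonneg)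
  also have "\<dots> = n * (\<Sum>d=1..n. mangoldt d / d)" by (simp add: sum_distrib_left mult.commute)
  finally have "n * (ln n - 1) \<le> n * (\<Sum>d=1..n. mangoldt d / d)" by (simp add: algebra_simps)
  thus "(\<Sum>d=1..n. mangoldt d / d) \<ge> ln n - 1"
    using assms by (subst (asm) mult_le_cancel_left_pos) auto
qed

lemma sum_inverse_powers_le:
  fixes p :: real
  assumes "p \<ge> 2"
  shows "(\<Sum>k=2..n. 1 / p ^ k) \<le> 2 / p\<^sup>2"
proof (cases "n \<ge> 2")
  case True
  have "(\<Sum>k=2..n. 1 / p ^ k) \<le> 2 / p\<^sup>2 - 2 * (1 / p ^ Suc n)"
    using True
  proof (induction n rule: nat_induct_at_least)
    case base
    have "1 / p\<^sup>2 + 2 / p ^ 3 \<le> 2 / p\<^sup>2"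
      using assms by (simp add: field_simps power2_eq_square power3_eq_cube)
    thus ?case by (simp add: numeral_3_eq_3 numeral_2_eq_2)
  next
    case (Suc n)
    have "2 * (1 / p ^ Suc (Suc n)) \<le> 1 / p ^ Suc n"
      using assms by (simp add: field_simps)
    moreover have "(\<Sum>k=2..Suc n. 1 / p ^ k) = (\<Sum>k=2..n. 1 / p ^ k) + 1 / p ^ Suc n"
      using Suc.hyps by simp
    ultimately show ?case using Suc.IH by linarith
  qed
  also have "\<dots> \<le> 2 / p\<^sup>2" using assms by simp
  finally show ?thesis .
qed (use assms in auto)

text \<open>The powers of p from the square on contribute at most 2 ln p / p^2, and ln p \<le> 2
  sqrt p reduces this to the convergent series with exponent -3/2.\<close>

lemma proper_prime_power_sum_bounded:
  "(\<Sum>d | d \<in> {1..n} \<and> \<not> prime d. mangoldt d / d) \<le> 4 * (\<Sum>n. real (Suc n) powr (-3/2))"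
proof -
  have sZ: "summable (\<lambda>n. real (Suc n) powr (-3/2))"
    by (subst summable_Suc_iff) (simp add: summable_real_powr_iff)
  define S where "S = {d\<in>{1..n}. \<not> prime d \<and> primepow d}"
  define h where "h = (\<lambda>(p::nat, k::nat). p ^ k)"
  define T where "T = {(p, k). prime p \<and> p \<in> {2..n} \<and> k \<in> {2..n}}"
  have "T \<subseteq> {2..n} \<times> {2..n}" unfolding T_def by auto
  hence finT: "finite T" by (rule finite_subset) auto
  have "(\<Sum>d | d \<in> {1..n} \<and> \<not> prime d. mangoldt d / d) = (\<Sum>d\<in>S. mangoldt d / (real d))"
    unfolding S_def by (intro sum.mono_neutral_right) (auto simp: mangoldt_def)
  also have "\<dots> \<le> (\<Sum>d\<in>h ` T. mangoldt d / real d)"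
  proof (intro sum_mono2)
    show "S \<subseteq> h ` T"
    proof
      fix d assume d: "d \<in> S"
      then obtain p k where pk: "prime p" "k > 0" "d = p ^ k" unfolding S_def primepow_def by auto
      have "k \<noteq> 1" using pk d unfolding S_def by auto
      hence k: "k \<ge> 2" using pk by simp
      have "p ^ 1 \<le> p ^ k" using pk prime_gt_0_nat[of p] by (intro power_increasing) auto
      moreover have "k < p ^ k" using pk prime_gt_1_nat[of p] by (intro power_gt_expt) auto
      ultimately have "(p, k) \<in> T" using d pk k prime_ge_2_nat[of p] unfolding T_def S_def by auto
      thus "d \<in> h ` T" using pk unfolding h_def by force
    qed
  qed (use finT in \<open>auto intro!: divide_nonneg_nonneg mangoldt_nonneg\<close>)
  also have "\<dots> \<le> (\<Sum>t\<in>T. mangoldt (h t) / real (h t))"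
    using finT by (intro sum_image_le[of T _ h, unfolded o_def]) (auto intro!: divide_nonneg_nonneg mangoldt_nonneg)
  also have "\<dots> = (\<Sum>t\<in>T. ln (real (fst t)) * (1 / real (fst t) ^ snd t))"
    by (intro sum.cong refl) (auto simp: T_def h_def)
  also have "\<dots> \<le> (\<Sum>t\<in>{2..n} \<times> {2..n}. ln (real (fst t)) * (1 / real (fst t) ^ snd t))"
    by (intro sum_mono2) (auto simp: T_def)
  also have "\<dots> = (\<Sum>p=2..n. ln (real p) * (\<Sum>k=2..n. 1 / real p ^ k))"
    by (simp add: sum.cartesian_product' sum_distrib_left)
  also have "\<dots> \<le> (\<Sum>p=2..n. 4 * real p powr (-3/2))"
  proof (intro sum_mono)
    fix p assume "p \<in> {2..n}"
    hence p: "real p \<ge> 2" by auto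
    have "ln (real p) = 2 * ln (sqrt p)" using p by (simp add: ln_sqrt)
    also have "\<dots> \<le> 2 * sqrt p" using p ln_le_minus_one[of "sqrt p"] by simp
    finally have l: "ln (real p) \<le> 2 * sqrt p" .
    have "ln (real p) * (\<Sum>k=2..n. 1 / real p ^ k) \<le> (2 * sqrt p) * (2 / (real p)\<^sup>2)"
      using p l by (intro mult_mono sum_inverse_powers_le sum_nonneg) auto
    also have "\<dots> = 4 * real p powr (-3/2)"
    proof -
      have "real p powr (-3/2) = real p powr (1/2) * real p powr (-2)"
        by (simp flip: powr_add)
      also have "real p powr (-2) = 1 / (real p)\<^sup>2" using p by (simp add: powr_minus_divide)
      finally show ?thesis using p by (simp add: powr_half_sqrt)
    qed
    finally show "ln (real p) * (\<Sum>k=2..n. 1 / real p ^ k) \<le> 4 * real p powr (-3/2)" .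
  qed
  also have "\<dots> \<le> 4 * (\<Sum>p=1..n. real p powr (-3/2))"
    unfolding sum_distrib_left by (intro sum_mono2) auto
  also have "(\<Sum>p=1..n. real p powr (-3/2)) = (\<Sum>k<n. real (Suc k) powr (-3/2))"
    by (rule sum.reindex_bij_witness[of _ Suc "\<lambda>k. k - 1"]) auto
  also have "\<dots> \<le> (\<Sum>n. real (Suc n) powr (-3/2))" by (intro sum_le_suminf sZ) auto
  finally show ?thesis by simp
qed

text \<open>The interval form has an error \<open>C\<close> independent of both ends. An interval
  whose logarithmic length is a large multiple of \<open>C\<close> thus carries its expected weight
  up to a small relative error, which is all that the resonator needs from the distribution of
  primes.\<close>

lemma mertens_first:
  obtains C :: real where "C \<ge> 1"
    "\<And>x y. 1 \<le> x \<Longrightarrow> x \<le> y \<Longrightarrow>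
      \<bar>(\<Sum>p | prime p \<and> x < real p \<and> real p \<le> y. ln (real p) / real p) - ln (y / x)\<bar> \<le> C"
proof -
  define Z where "Z = 4 * (\<Sum>n. real (Suc n) powr (-3/2))"
  \<comment> \<open>\<open>Z\<close> accounts for the proper prime powers and the last
    \<open>ln 2\<close> for rounding \<open>x\<close> down to an integer.\<close>
  define C0 where "C0 = 4 * ln 2 + 1 + \<bar>Z\<bar> + ln 2"
  define A where "A = (\<lambda>x::real. \<Sum>p | prime p \<and> real p \<le> x. ln (real p) / real p)"
  have fin: "finite {p. prime p \<and> real p \<le> x}" for x
    by (rule finite_subset[of _ "{..nat \<lfloor>x\<rfloor>}"]) (auto simp: le_nat_floor)
  have A: "\<bar>A x - ln x\<bar> \<le> C0" if x: "x \<ge> 1" for x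
  proof -
    define n where "n = nat \<lfloor>x\<rfloor>"
    have n1: "real n \<le> x" "x < real n + 1" using x unfolding n_def by linarith+
    have n: "n > 0" "real n \<le> x" using x n1 by linarith+
    hence "real n \<ge> 1" by simp
    hence n2: "x \<le> 2 * real n" using n1 by linarith
    have "{p. prime p \<and> real p \<le> x} = {d\<in>{1..n}. prime d}"
      using n x unfolding n_def by (auto simp: le_nat_floor Suc_le_eq prime_gt_0_nat le_nat_iff le_floor_iff)
    hence "A x = (\<Sum>d | d \<in> {1..n} \<and> prime d. mangoldt d / d)"
      unfolding A_def by (intro sum.cong) auto
    moreover have "(\<Sum>d=1..n. mangoldt d / d) =
        (\<Sum>d | d \<in> {1..n} \<and> prime d. mangoldt d / real d) + (\<Sum>d | d \<in> {1..n} \<and> \<not> prime d. mangoldt d / d)"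
      by (subst sum.union_disjoint[symmetric]) (auto intro!: sum.cong)
    moreover have "(\<Sum>d | d \<in> {1..n} \<and> \<not> prime d. mangoldt d / d) \<le> Z"
      unfolding Z_def by (rule proper_prime_power_sum_bounded)
    moreover have "(\<Sum>d | d \<in> {1..n} \<and> \<not> prime d. mangoldt d / real d) \<ge> 0"
      by (intro sum_nonneg divide_nonneg_nonneg mangoldt_nonneg) auto
    moreover note mangoldt_mertens[OF n(1)]
    moreover have "ln (real n) \<le> ln x" using n by simp
    moreover have "ln x \<le> ln (2 * real n)" using n n2 x by (subst ln_le_cancel_iff) auto
    hence "ln x \<le> ln 2 + ln (real n)" using n by (simp add: ln_mult)
    moreover have "ln (2::real) \<ge> 0" by simp
    ultimately show ?thesis unfolding C0_def by linarith
  qed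
  have "\<bar>(\<Sum>p | prime p \<and> x < real p \<and> real p \<le> y. ln (real p) / real p) - ln (y / x)\<bar> \<le> 2 * C0"
    if xy: "1 \<le> x" "x \<le> y" for x y
  proof -
    have "A y = (\<Sum>p | prime p \<and> x < real p \<and> real p \<le> y. ln (real p) / real p) + A x"
      unfolding A_def using xy
      by (subst sum.union_disjoint[symmetric]) (auto intro!: sum.cong finite_subset[OF _ fin[of y]] fin)
    thus ?thesis using A[of x] A[of y] xy by (simp add: ln_div abs_le_iff)
  qed
  moreover have "2 * C0 \<ge> 1" unfolding C0_def by simp
  ultimately show ?thesis using that by blast
qed

section \<open>Blocks of subsets\<close>

lemma sum_Pow_prod: "finite Q \<Longrightarrow> (\<Sum>S\<in>Pow Q. \<Prod>p\<in>S. u p) = (\<Prod>p\<in>Q. 1 + (u p :: real))"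
  using prod_add[of Q u "\<lambda>_. 1"] by (simp add: add.commute)

text \<open>Rankin's method: a subset is charged by a factor \<open>a\<close> for each of its elements.\<close>

lemma sum_small_subsets_ge:
  fixes u :: "'a \<Rightarrow> real"
  assumes fin: "finite Q" and u: "\<And>p. p \<in> Q \<Longrightarrow> u p \<ge> 0" and a: "a \<ge> 1"
  shows "(\<Sum>S | S \<subseteq> Q \<and> card S \<le> s. \<Prod>p\<in>S. u p) \<ge> (\<Prod>p\<in>Q. 1 + u p) - (\<Prod>p\<in>Q. 1 + a * u p) / a ^ s"
proof -
  have nn: "(\<Prod>p\<in>S. u p) \<ge> 0" if "S \<subseteq> Q" for S using that u by (intro prod_nonneg) auto
  have "(\<Prod>p\<in>Q. 1 + u p) = (\<Sum>S\<in>Pow Q. \<Prod>p\<in>S. u p)" by (rule sum_Pow_prod[OF fin, symmetric])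
  also have "\<dots> = (\<Sum>S | S \<subseteq> Q \<and> card S \<le> s. \<Prod>p\<in>S. u p) + (\<Sum>S | S \<subseteq> Q \<and> card S > s. \<Prod>p\<in>S. u p)"
    using fin by (subst sum.union_disjoint[symmetric])
      (auto intro!: sum.cong finite_subset[of _ "Pow Q"])
  also have "(\<Sum>S | S \<subseteq> Q \<and> card S > s. \<Prod>p\<in>S. u p) \<le> (\<Sum>S | S \<subseteq> Q \<and> card S > s. (\<Prod>p\<in>S. a * u p) / a ^ s)"
  proof (rule sum_mono)
    fix S assume "S \<in> {S. S \<subseteq> Q \<and> card S > s}"
    hence S: "S \<subseteq> Q" "s \<le> card S" by auto
    have "(\<Prod>p\<in>S. u p) * a ^ s \<le> (\<Prod>p\<in>S. u p) * a ^ card S"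
      using S a by (intro mult_left_mono power_increasing nn) auto
    also have "\<dots> = (\<Prod>p\<in>S. a * u p)" by (simp add: prod.distrib mult.commute)
    finally show "(\<Prod>p\<in>S. u p) \<le> (\<Prod>p\<in>S. a * u p) / a ^ s" using a by (simp add: field_simps)
  qed
  also have "\<dots> \<le> (\<Sum>S\<in>Pow Q. (\<Prod>p\<in>S. a * u p) / a ^ s)"
    using fin u a by (intro sum_mono2) (auto intro!: divide_nonneg_nonneg prod_nonneg)
  also have "\<dots> = (\<Prod>p\<in>Q. 1 + a * u p) / a ^ s"
    unfolding sum_divide_distrib[symmetric] using sum_Pow_prod[OF fin] by simp
  finally show ?thesis by simp
qed

lemma prod_one_plus_le_exp:
  fixes u :: "'a \<Rightarrow> real"
  assumes "\<And>p. p \<in> Q \<Longrightarrow> u p \<ge> 0"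
  shows "(\<Prod>p\<in>Q. 1 + u p) \<le> exp (\<Sum>p\<in>Q. u p)"
proof (cases "finite Q")
  case True
  have "(\<Prod>p\<in>Q. 1 + u p) \<le> (\<Prod>p\<in>Q. exp (u p))"
    using assms by (intro prod_mono) (auto intro: add_nonneg_nonneg)
  thus ?thesis using True by (simp add: exp_sum)
qed simp

text \<open>A Chernoff bound. Since 1 + a u \<le> (1 + u) (1 + (a - 1) u), the tail is measured
  against the full product itself instead of \<open>exp U\<close>; the relative tail is at most the
  exponential of (a - 1) U - s ln a, hence of -(a ln a - a + 1) U \<le> -1, and is below
  1/2.\<close>

lemma sum_small_subsets_ge_half:
  fixes u :: "'a \<Rightarrow> real"
  assumes fin: "finite Q" and u: "\<And>p. p \<in> Q \<Longrightarrow> u p \<ge> 0" and a: "a > 1"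
    and U: "(\<Sum>p\<in>Q. u p) \<le> U" and s: "a * U \<le> real s" and big: "(a * ln a - a + 1) * U \<ge> 1"
  shows "(\<Sum>S | S \<subseteq> Q \<and> card S \<le> s. \<Prod>p\<in>S. u p) \<ge> (\<Prod>p\<in>Q. 1 + u p) / 2"
proof -
  have Z: "(\<Prod>p\<in>Q. 1 + u p) > 0" using u by (intro prod_pos) (auto intro: add_pos_nonneg)
  have "(\<Prod>p\<in>Q. 1 + a * u p) \<le> (\<Prod>p\<in>Q. (1 + u p) * (1 + (a - 1) * u p))"
  proof (intro prod_mono conjI)
    fix p assume "p \<in> Q"
    hence "u p \<ge> 0" by (rule u)
    thus "0 \<le> 1 + a * u p" using a by (intro add_nonneg_nonneg mult_nonneg_nonneg) auto
    have "(a - 1) * (u p * u p) \<ge> 0" using a by simp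
    thus "1 + a * u p \<le> (1 + u p) * (1 + (a - 1) * u p)" by (simp add: algebra_simps)
  qed
  also have "\<dots> = (\<Prod>p\<in>Q. 1 + u p) * (\<Prod>p\<in>Q. 1 + (a - 1) * u p)" by (rule prod.distrib)
  also have "\<dots> \<le> (\<Prod>p\<in>Q. 1 + u p) * exp (\<Sum>p\<in>Q. (a - 1) * u p)"
    using u a Z by (intro mult_left_mono prod_one_plus_le_exp) auto
  also have "(\<Sum>p\<in>Q. (a - 1) * u p) \<le> (a - 1) * U"
    unfolding sum_distrib_left[symmetric] using a U by (intro mult_left_mono) auto
  finally have 1: "(\<Prod>p\<in>Q. 1 + a * u p) \<le> (\<Prod>p\<in>Q. 1 + u p) * exp ((a - 1) * U)"
    using Z by (simp add: mult_left_mono)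
  have 2: "exp ((a - 1) * U) \<le> a ^ s / 2"
  proof -
    have "exp ((a - 1) * U) * 2 \<le> exp ((a - 1) * U) * exp 1"
      using exp_ge_add_one_self[of 1] by (intro mult_left_mono) auto
    also have "\<dots> \<le> exp ((a - 1) * U) * exp ((a * ln a - a + 1) * U)"
      using big by (intro mult_left_mono) auto
    also have "\<dots> = exp (ln a * (a * U))" by (simp add: exp_add[symmetric] algebra_simps)
    also have "\<dots> \<le> exp (ln a * real s)" using a s by (intro exp_le_cancel_iff[THEN iffD2] mult_left_mono) auto
    also have "\<dots> = a ^ s" using a by (simp add: exp_of_nat2_mult)
    finally show ?thesis by simp
  qed
  have "(\<Prod>p\<in>Q. 1 + a * u p) / a ^ s \<le> (\<Prod>p\<in>Q. 1 + u p) * (a ^ s / 2) / a ^ s"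
    using a Z 1 2 by (intro divide_right_mono order_trans[OF 1] mult_left_mono) auto
  also have "\<dots> = (\<Prod>p\<in>Q. 1 + u p) / 2" using a by simp
  finally show ?thesis using sum_small_subsets_ge[where u = u and Q = Q and a = a and s = s] fin u a by auto
qed

lemma exp_le_prod_one_plus:
  fixes v :: "'a \<Rightarrow> real"
  assumes fin: "finite Q" and v: "\<And>p. p \<in> Q \<Longrightarrow> 0 \<le> v p \<and> v p \<le> \<delta>" and \<delta>: "\<delta> \<le> 1"
  shows "exp ((1 - \<delta>) * (\<Sum>p\<in>Q. v p)) \<le> (\<Prod>p\<in>Q. 1 + v p)"
proof -
  have "exp ((1 - \<delta>) * (\<Sum>p\<in>Q. v p)) = (\<Prod>p\<in>Q. exp ((1 - \<delta>) * v p))"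
    using fin by (simp add: sum_distrib_left exp_sum)
  also have "\<dots> \<le> (\<Prod>p\<in>Q. 1 + v p)"
  proof (intro prod_mono conjI)
    fix p assume "p \<in> Q"
    hence p: "0 \<le> v p" "v p \<le> \<delta>" using v by auto
    have "(1 - \<delta>) * v p \<le> v p - (v p)\<^sup>2"
      using p mult_right_mono[OF p(2,1)] by (simp add: power2_eq_square algebra_simps)
    also have "\<dots> \<le> ln (1 + v p)" using p \<delta> by (intro ln_one_plus_pos_lower_bound) auto
    finally have "exp ((1 - \<delta>) * v p) \<le> exp (ln (1 + v p))" by simp
    thus "exp ((1 - \<delta>) * v p) \<le> 1 + v p" using p by simp
  qed auto
  finally show ?thesis .
qed

text \<open>In the application the elements of \<open>T\<close> are the primes of the multiplier k
  and those of \<open>S\<close> the primes of m; disjointness makes k m squarefree with prime set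
  \<open>T \<union> S\<close>.\<close>

definition block_pairs :: "'a set \<Rightarrow> nat \<Rightarrow> nat \<Rightarrow> ('a set \<times> 'a set) set" where
  "block_pairs Q t s = {(T, S). T \<subseteq> Q \<and> S \<subseteq> Q \<and> T \<inter> S = {} \<and> card T \<le> t \<and> card S \<le> s}"

lemma finite_block_pairs: "finite Q \<Longrightarrow> finite (block_pairs Q t s)"
  by (rule finite_subset[of _ "Pow Q \<times> Pow Q"]) (auto simp: block_pairs_def)

text \<open>Without restrictions the sum would be the product of 1 + u times roughly the exponential
  of the sum of \<open>v\<close>. Small \<open>v\<close> loses the factor 1 - \<delta> in the
  exponent, keeping \<open>S\<close> away from \<open>T\<close> costs at most e^\<delta> per element
  of \<open>T\<close>, and the two caps on the cardinalities cost a factor 1/2 each, absorbed by the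
  -2.\<close>

lemma block_sum_ge:
  fixes u v :: "'a \<Rightarrow> real"
  assumes fin: "finite Q" and u: "\<And>p. p \<in> Q \<Longrightarrow> 0 \<le> u p \<and> u p \<le> \<delta>"
    and v: "\<And>p. p \<in> Q \<Longrightarrow> 0 \<le> v p \<and> v p \<le> \<delta>" and \<delta>: "0 < \<delta>" "\<delta> \<le> 1/4"
    and U: "(\<Sum>p\<in>Q. u p) \<le> U" and V: "(\<Sum>p\<in>Q. v p) \<le> V" and V1: "(\<Sum>p\<in>Q. v p) \<ge> 1"
    and s: "(1 + \<delta>) * U \<le> real s" and big: "((1 + \<delta>) * ln (1 + \<delta>) - (1 + \<delta>) + 1) * U \<ge> 1"
    and t: "4 * V \<le> real t" "real t \<le> 4 * V + 1"
  shows "(\<Sum>(T,S)\<in>block_pairs Q t s. (\<Prod>p\<in>T. v p) * (\<Prod>p\<in>S. u p)) \<ge>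
    exp ((1 - \<delta>) * (\<Sum>p\<in>Q. v p) - \<delta> * (4 * V + 1) - 2) * (\<Prod>p\<in>Q. 1 + u p)"
proof -
  define X where "X = (\<Sum>p\<in>Q. v p)"
  define Z where "Z = (\<Prod>p\<in>Q. 1 + u p)"
  have Z0: "Z > 0" unfolding Z_def using u by (intro prod_pos) (auto intro: add_pos_nonneg)
  have finP: "finite {T. T \<subseteq> Q' \<and> card T \<le> m}" if "Q' \<subseteq> Q" for Q' m
    by (rule finite_subset[of _ "Pow Q"]) (use fin that in auto)
  have inner: "(\<Sum>S | S \<subseteq> Q - T \<and> card S \<le> s. \<Prod>p\<in>S. u p) \<ge> Z * exp (- \<delta> * (4 * V + 1)) / 2"
    if T: "T \<subseteq> Q" "card T \<le> t" for T
  proof -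
    have finT: "finite T" using T fin finite_subset by auto
    have "(\<Prod>p\<in>T. 1 + u p) \<le> (\<Prod>p\<in>T. exp \<delta>)"
    proof (intro prod_mono conjI)
      fix p assume "p \<in> T"
      hence "0 \<le> u p" "u p \<le> \<delta>" using T u by auto
      thus "0 \<le> 1 + u p" "1 + u p \<le> exp \<delta>" using exp_ge_add_one_self[of \<delta>] by linarith+
    qed
    also have "\<dots> = exp (\<delta> * card T)" by (simp add: exp_of_nat2_mult)
    also have "\<dots> \<le> exp (\<delta> * (4 * V + 1))"
      using T t \<delta> by (intro exp_le_cancel_iff[THEN iffD2] mult_left_mono) linarith+
    finally have le: "(\<Prod>p\<in>T. 1 + u p) \<le> exp (\<delta> * (4 * V + 1))" .
    have "Z = (\<Prod>p\<in>Q - T. 1 + u p) * (\<Prod>p\<in>T. 1 + u p)"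
      unfolding Z_def by (rule prod.subset_diff[OF T(1) fin])
    also have "\<dots> \<le> (\<Prod>p\<in>Q - T. 1 + u p) * exp (\<delta> * (4 * V + 1))"
      using le u by (intro mult_left_mono prod_nonneg) (auto intro: add_nonneg_nonneg)
    finally have "Z / exp (\<delta> * (4 * V + 1)) \<le> (\<Prod>p\<in>Q - T. 1 + u p)"
      by (subst pos_divide_le_eq) auto
    hence "Z * exp (- \<delta> * (4 * V + 1)) \<le> (\<Prod>p\<in>Q - T. 1 + u p)"
      by (simp only: mult_minus_left exp_minus divide_inverse)
    moreover have "(\<Sum>S | S \<subseteq> Q - T \<and> card S \<le> s. \<Prod>p\<in>S. u p) \<ge> (\<Prod>p\<in>Q - T. 1 + u p) / 2"
    proof (rule sum_small_subsets_ge_half[where a = "1 + \<delta>" and U = U])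
      have "(\<Sum>p\<in>Q - T. u p) \<le> (\<Sum>p\<in>Q. u p)" using fin u by (intro sum_mono2) auto
      thus "(\<Sum>p\<in>Q - T. u p) \<le> U" using U by linarith
    qed (use fin u \<delta> s big in auto)
    ultimately show ?thesis by linarith
  qed
  have outer: "(\<Sum>T | T \<subseteq> Q \<and> card T \<le> t. \<Prod>p\<in>T. v p) \<ge> exp ((1 - \<delta>) * X) / 2"
  proof -
    \<comment> \<open>Rankin's bound with base \<open>exp 1\<close>: the cap \<open>t\<close> is at
      least 4V and exp 1 \<le> 3, so the exponent of the tail is at most -X, which suffices because
      X \<ge> 1.\<close>
    have "(\<Prod>p\<in>Q. 1 + exp 1 * v p) \<le> exp (\<Sum>p\<in>Q. exp 1 * v p)"
      using v by (intro prod_one_plus_le_exp) auto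
    also have "\<dots> = exp (exp 1 * X)" by (simp add: X_def sum_distrib_left)
    finally have "(\<Prod>p\<in>Q. 1 + exp 1 * v p) / exp 1 ^ t \<le> exp (exp 1 * X) / exp 1 ^ t"
      by (intro divide_right_mono) auto
    also have "\<dots> = exp (exp 1 * X - t)" by (simp add: exp_diff exp_of_nat_mult[symmetric])
    also have "\<dots> \<le> exp ((1 - \<delta>) * X - 1)"
    proof -
      have "exp 1 * X \<le> 3 * X" using exp_le V1 unfolding X_def by (intro mult_right_mono) auto
      moreover have "\<delta> * X \<le> 1/4 * X" using \<delta> V1 unfolding X_def by (intro mult_right_mono) auto
      moreover have "(1 - \<delta>) * X = X - \<delta> * X" by (simp add: algebra_simps)
      moreover have "X \<le> V" "X \<ge> 1" using V V1 unfolding X_def by auto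
      ultimately have "exp 1 * X - t \<le> (1 - \<delta>) * X - 1" using t by linarith
      thus ?thesis by simp
    qed
    also have "\<dots> \<le> exp ((1 - \<delta>) * X) / 2"
    proof -
      have "2 * exp (-1 :: real) \<le> 1" using exp_ge_add_one_self[of "1::real"] by (simp add: exp_minus field_simps)
      hence "exp ((1 - \<delta>) * X) * (2 * exp (-1)) \<le> exp ((1 - \<delta>) * X) * 1" by (intro mult_left_mono) auto
      moreover have "exp ((1 - \<delta>) * X - 1) = exp ((1 - \<delta>) * X) * exp (-1)"
        by (simp only: diff_conv_add_uminus exp_add)
      ultimately show ?thesis by linarith
    qed
    finally have "(\<Prod>p\<in>Q. 1 + exp 1 * v p) / exp 1 ^ t \<le> exp ((1 - \<delta>) * X) / 2" .
    moreover have "exp ((1 - \<delta>) * X) \<le> (\<Prod>p\<in>Q. 1 + v p)"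
      unfolding X_def using v \<delta> by (intro exp_le_prod_one_plus fin) auto
    moreover have "(\<Sum>T | T \<subseteq> Q \<and> card T \<le> t. \<Prod>p\<in>T. v p) \<ge> (\<Prod>p\<in>Q. 1 + v p) - (\<Prod>p\<in>Q. 1 + exp 1 * v p) / exp 1 ^ t"
      using v by (intro sum_small_subsets_ge fin) auto
    ultimately show ?thesis by linarith
  qed
  have eq: "block_pairs Q t s = Sigma {T. T \<subseteq> Q \<and> card T \<le> t} (\<lambda>T. {S. S \<subseteq> Q - T \<and> card S \<le> s})"
    unfolding block_pairs_def by auto
  have four: "exp (-2 :: real) \<le> 1 / 4"
  proof -
    have "(2::real)\<^sup>2 \<le> exp 1 ^ 2" using exp_ge_add_one_self[of "1::real"] by (intro power_mono) auto
    hence "4 \<le> exp (2::real)" by (simp add: exp_of_nat_mult[of 2 1, simplified, symmetric])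
    thus ?thesis by (simp add: exp_minus field_simps)
  qed
  have e: "(1 - \<delta>) * X - \<delta> * (4 * V + 1) - 2 = (1 - \<delta>) * X + -\<delta> * (4 * V + 1) + -2" by simp
  have "exp ((1 - \<delta>) * X - \<delta> * (4 * V + 1) - 2) * Z = exp ((1 - \<delta>) * X) * exp (-\<delta> * (4 * V + 1)) * Z * exp (-2)"
    unfolding e exp_add by (simp only: mult_ac)
  also have "\<dots> \<le> exp ((1 - \<delta>) * X) * exp (-\<delta> * (4 * V + 1)) * Z * (1 / 4)"
    using four Z0 by (intro mult_left_mono) auto
  also have "\<dots> = exp ((1 - \<delta>) * X) / 2 * (Z * exp (- \<delta> * (4 * V + 1)) / 2)" by simp
  also have "\<dots> \<le> (\<Sum>T | T \<subseteq> Q \<and> card T \<le> t. \<Prod>p\<in>T. v p) * (Z * exp (- \<delta> * (4 * V + 1)) / 2)"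
    using Z0 by (intro mult_right_mono outer) auto
  also have "\<dots> = (\<Sum>T | T \<subseteq> Q \<and> card T \<le> t. (\<Prod>p\<in>T. v p) * (Z * exp (- \<delta> * (4 * V + 1)) / 2))"
    by (rule sum_distrib_right)
  also have "\<dots> \<le> (\<Sum>T | T \<subseteq> Q \<and> card T \<le> t. (\<Prod>p\<in>T. v p) * (\<Sum>S | S \<subseteq> Q - T \<and> card S \<le> s. \<Prod>p\<in>S. u p))"
    using v by (intro sum_mono mult_left_mono inner prod_nonneg) auto
  also have "\<dots> = (\<Sum>(T,S)\<in>block_pairs Q t s. (\<Prod>p\<in>T. v p) * (\<Prod>p\<in>S. u p))"
    unfolding eq sum_distrib_left by (rule sum.Sigma) (auto intro!: finP)
  finally show ?thesis unfolding X_def Z_def .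
qed

definition family_pairs :: "(nat \<Rightarrow> 'a set) \<Rightarrow> nat \<Rightarrow> (nat \<Rightarrow> nat) \<Rightarrow> (nat \<Rightarrow> nat) \<Rightarrow> ('a set \<times> 'a set) set" where
  "family_pairs Q K t s = {(T, S). T \<subseteq> (\<Union>k\<in>{1..K}. Q k) \<and> S \<subseteq> (\<Union>k\<in>{1..K}. Q k) \<and> T \<inter> S = {} \<and>
     (\<forall>k\<in>{1..K}. card (T \<inter> Q k) \<le> t k \<and> card (S \<inter> Q k) \<le> s k)}"

text \<open>Expanding the product chooses one pair in each block, and the chosen pairs are glued by
  unions. As the blocks are disjoint, intersecting with a block recovers the choice, so glueing is
  injective; the terms are nonnegative.\<close>

lemma family_sum_ge:
  fixes u v :: "'a \<Rightarrow> real"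
  assumes fin: "\<And>k. k \<in> {1..K} \<Longrightarrow> finite (Q k)"
    and disj: "\<And>j k. j \<in> {1..K} \<Longrightarrow> k \<in> {1..K} \<Longrightarrow> j \<noteq> k \<Longrightarrow> Q j \<inter> Q k = {}"
    and nn: "\<And>k p. k \<in> {1..K} \<Longrightarrow> p \<in> Q k \<Longrightarrow> 0 \<le> u p \<and> 0 \<le> v p"
  shows "(\<Prod>k=1..K. \<Sum>(T,S)\<in>block_pairs (Q k) (t k) (s k). (\<Prod>p\<in>T. v p) * (\<Prod>p\<in>S. u p)) \<le>
    (\<Sum>(T,S)\<in>family_pairs Q K t s. (\<Prod>p\<in>T. v p) * (\<Prod>p\<in>S. u p))"
  using assms
proof (induction K)
  case 0
  have "family_pairs Q 0 t s = {({}, {})}" unfolding family_pairs_def by auto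
  thus ?case by simp
next
  case (Suc K)
  define g where "g = (\<lambda>(T, S). (\<Prod>p\<in>T. v p) * (\<Prod>p\<in>S. u p))"
  let ?F = "family_pairs Q K t s" and ?B = "block_pairs (Q (Suc K)) (t (Suc K)) (s (Suc K))"
  let ?U = "\<Union>k\<in>{1..K}. Q k"
  have finU: "finite ?U" "finite (\<Union>k\<in>{1..Suc K}. Q k)" using Suc.prems(1) by auto
  have dU: "?U \<inter> Q (Suc K) = {}" using Suc.prems(2) by fastforce
  have finF: "finite ?F" by (rule finite_subset[of _ "Pow ?U \<times> Pow ?U"]) (use finU in \<open>auto simp: family_pairs_def\<close>)
  have finF': "finite (family_pairs Q (Suc K) t s)"
    by (rule finite_subset[of _ "Pow (\<Union>k\<in>{1..Suc K}. Q k) \<times> Pow (\<Union>k\<in>{1..Suc K}. Q k)"])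
      (use finU in \<open>auto simp: family_pairs_def\<close>)
  have finB: "finite ?B" using Suc.prems(1) by (intro finite_block_pairs) auto
  define j where "j = (\<lambda>((T, S), (T', S')). (T \<union> T' :: 'a set, S \<union> S' :: 'a set))"
  have FU: "T \<subseteq> ?U" "S \<subseteq> ?U" if "(T, S) \<in> ?F" for T S using that unfolding family_pairs_def by auto
  have BU: "T \<subseteq> Q (Suc K)" "S \<subseteq> Q (Suc K)" if "(T, S) \<in> ?B" for T S using that unfolding block_pairs_def by auto
  have inj: "inj_on j (?F \<times> ?B)"
  proof (rule inj_onI)
    fix x y assume x: "x \<in> ?F \<times> ?B" and y: "y \<in> ?F \<times> ?B" and eq: "j x = j y"
    obtain T S T' S' where x': "x = ((T, S), (T', S'))" by (metis prod.exhaust)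
    obtain A B A' B' where y': "y = ((A, B), (A', B'))" by (metis prod.exhaust)
    have e: "T \<union> T' = A \<union> A'" "S \<union> S' = B \<union> B'" using eq x' y' unfolding j_def by auto
    have sub: "T \<subseteq> ?U" "S \<subseteq> ?U" "A \<subseteq> ?U" "B \<subseteq> ?U"
      "T' \<subseteq> Q (Suc K)" "S' \<subseteq> Q (Suc K)" "A' \<subseteq> Q (Suc K)" "B' \<subseteq> Q (Suc K)"
      using FU[of T S] FU[of A B] BU[of T' S'] BU[of A' B'] x y unfolding x' y' by simp_all
    have "T = (T \<union> T') \<inter> ?U" "A = (A \<union> A') \<inter> ?U" "S = (S \<union> S') \<inter> ?U" "B = (B \<union> B') \<inter> ?U"
      "T' = (T \<union> T') \<inter> Q (Suc K)" "A' = (A \<union> A') \<inter> Q (Suc K)" "S' = (S \<union> S') \<inter> Q (Suc K)" "B' = (B \<union> B') \<inter> Q (Suc K)"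
      using sub dU by blast+
    thus "x = y" using e x' y' by metis
  qed
  have img: "j ` (?F \<times> ?B) \<subseteq> family_pairs Q (Suc K) t s"
  proof
    fix z assume "z \<in> j ` (?F \<times> ?B)"
    then obtain T S T' S' where z: "z = (T \<union> T', S \<union> S')" and F: "(T, S) \<in> ?F" and B: "(T', S') \<in> ?B"
      unfolding j_def by auto
    have sub: "T \<subseteq> ?U" "S \<subseteq> ?U" "T' \<subseteq> Q (Suc K)" "S' \<subseteq> Q (Suc K)" using FU[OF F] BU[OF B] by auto
    have 1: "(T \<union> T') \<inter> Q (Suc K) = T'" "(S \<union> S') \<inter> Q (Suc K) = S'" using sub dU by blast+
    have 2: "(T \<union> T') \<inter> Q k = T \<inter> Q k" "(S \<union> S') \<inter> Q k = S \<inter> Q k" if "k \<in> {1..K}" for k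
      using sub dU that by blast+
    have 3: "(T \<union> T') \<inter> (S \<union> S') = {}"
      using sub dU F B unfolding family_pairs_def block_pairs_def by blast
    have 4: "T \<union> T' \<subseteq> (\<Union>k\<in>{1..Suc K}. Q k)" "S \<union> S' \<subseteq> (\<Union>k\<in>{1..Suc K}. Q k)"
      using sub by (auto simp: atLeastAtMostSuc_conv)
    have 5: "card (T \<inter> Q k) \<le> t k \<and> card (S \<inter> Q k) \<le> s k" if "k \<in> {1..K}" for k
      using F that unfolding family_pairs_def by auto
    have 6: "card T' \<le> t (Suc K)" "card S' \<le> s (Suc K)" using B unfolding block_pairs_def by auto
    have "card ((T \<union> T') \<inter> Q k) \<le> t k \<and> card ((S \<union> S') \<inter> Q k) \<le> s k" if "k \<in> {1..Suc K}" for k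
    proof (cases "k = Suc K")
      case True
      thus ?thesis using 1 6 by simp
    next
      case False
      hence "k \<in> {1..K}" using that by auto
      thus ?thesis using 2 5 by simp
    qed
    thus "z \<in> family_pairs Q (Suc K) t s" unfolding family_pairs_def z using 3 4 by blast
  qed
  have nn': "g z \<ge> 0" if "z \<in> family_pairs Q (Suc K) t s" for z
  proof -
    obtain T S where z: "z = (T, S)" by (cases z)
    have "\<And>p. p \<in> T \<union> S \<Longrightarrow> 0 \<le> u p \<and> 0 \<le> v p"
      using that Suc.prems(3) unfolding z family_pairs_def by fast
    thus ?thesis unfolding g_def z by (auto intro!: mult_nonneg_nonneg prod_nonneg)
  qed
  have "(\<Prod>k=1..Suc K. \<Sum>z\<in>block_pairs (Q k) (t k) (s k). g z) =
      (\<Prod>k=1..K. \<Sum>z\<in>block_pairs (Q k) (t k) (s k). g z) * (\<Sum>z\<in>?B. g z)" by simp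
  also have "\<dots> \<le> (\<Sum>z\<in>?F. g z) * (\<Sum>z\<in>?B. g z)"
  proof (intro mult_right_mono sum_nonneg)
    show "(\<Prod>k=1..K. \<Sum>z\<in>block_pairs (Q k) (t k) (s k). g z) \<le> (\<Sum>z\<in>?F. g z)"
      unfolding g_def
    proof (rule Suc.IH)
      show "finite (Q k)" if "k \<in> {1..K}" for k using that by (intro Suc.prems(1)) auto
      show "Q j \<inter> Q k = {}" if "j \<in> {1..K}" "k \<in> {1..K}" "j \<noteq> k" for j k
        using that by (intro Suc.prems(2)) auto
      show "0 \<le> u p \<and> 0 \<le> v p" if "k \<in> {1..K}" "p \<in> Q k" for k p
        using that by (intro Suc.prems(3)[of k]) auto
    qed
  next
    fix z assume z: "z \<in> ?B"
    obtain T S where zz: "z = (T, S)" by (cases z)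
    have "\<And>p. p \<in> T \<union> S \<Longrightarrow> 0 \<le> u p \<and> 0 \<le> v p"
      using z Suc.prems(3)[of "Suc K"] unfolding zz block_pairs_def by auto
    thus "0 \<le> g z" unfolding g_def zz by (auto intro!: mult_nonneg_nonneg prod_nonneg)
  qed
  also have "\<dots> = (\<Sum>(x, y)\<in>?F \<times> ?B. g x * g y)"
    by (simp add: sum_product sum.cartesian_product)
  also have "\<dots> = (\<Sum>z\<in>?F \<times> ?B. g (j z))"
  proof (intro sum.cong refl)
    fix z assume z: "z \<in> ?F \<times> ?B"
    obtain T S T' S' where z': "z = ((T, S), (T', S'))" by (metis prod.exhaust)
    have sub: "T \<subseteq> ?U" "S \<subseteq> ?U" "T' \<subseteq> Q (Suc K)" "S' \<subseteq> Q (Suc K)"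
      using FU[of T S] BU[of T' S'] z unfolding z' by simp_all
    have finQ: "finite (Q (Suc K))" using Suc.prems(1) by auto
    have f: "finite T" "finite S" "finite T'" "finite S'"
      using sub finU(1) finQ by (auto intro: finite_subset)
    have d: "T \<inter> T' = {}" "S \<inter> S' = {}" using sub dU by blast+
    show "(case z of (x, y) \<Rightarrow> g x * g y) = g (j z)"
      unfolding z' g_def j_def using f d by (simp add: prod.union_disjoint mult_ac)
  qed
  also have "\<dots> = (\<Sum>z\<in>j ` (?F \<times> ?B). g z)" by (simp add: sum.reindex[OF inj])
  also have "\<dots> \<le> (\<Sum>z\<in>family_pairs Q (Suc K) t s. g z)"
    by (intro sum_mono2 finF' img nn') auto
  finally show ?case unfolding g_def .
qed

section \<open>The resonator\<close>

text \<open>Unique factorisation for squarefree numbers, which makes the passage from a set of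
  primes to its product injective and lets \<open>f\<close> be read off from the set.\<close>

lemma prime_factors_prod_primes:
  fixes S :: "nat set"
  assumes "finite S" "\<And>p. p \<in> S \<Longrightarrow> prime p"
  shows "prime_factors (\<Prod>S) = S"
  using assms
proof (induction S rule: finite_induct)
  case (insert p S)
  have "q > 0" if "q \<in> S" for q using insert.prems that prime_gt_0_nat by blast
  hence "\<Prod>S > 0" by (intro prod_pos) auto
  hence "\<Prod>S \<noteq> 0" by simp
  moreover have p: "prime p" using insert.prems by blast
  ultimately have "prime_factors (p * \<Prod>S) = prime_factors p \<union> prime_factors (\<Prod>S)"
    by (intro prime_factors_product) auto
  also have "prime_factors (\<Prod>S) = S" using insert.prems by (intro insert.IH) blast
  also have "prime_factors p = {p}" using p by (rule prime_prime_factors)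
  finally show ?case using insert.hyps by simp
qed auto

lemma sqrt_prod: "sqrt (\<Prod>p\<in>S. f p) = (\<Prod>p\<in>S. sqrt (f p))"
  by (induction S rule: infinite_finite_induct) (auto simp: real_sqrt_mult)

text \<open>\<open>I\<close> allows \<open>t k + s k\<close> primes from block \<open>k\<close>, so
  that it contains m and k m for every admissible pair. The sum of squares is at most the full
  product of 1 + u, while an edge contributes exactly the product of \<open>v\<close> over the
  primes of k times that of \<open>u\<close> over the primes of m; the block hypotheses compare the
  two. The numbers \<open>y k\<close> are free weights for counting \<open>I\<close>.\<close>

lemma prime_resonator:
  fixes Q :: "nat \<Rightarrow> nat set" and w y b g :: "nat \<Rightarrow> real" and K :: nat and s t :: "nat \<Rightarrow> nat"
  defines "u \<equiv> \<lambda>p. (w p)\<^sup>2" and "v \<equiv> \<lambda>p. w p / sqrt (real p)"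
    and "f \<equiv> \<lambda>m. \<Prod>p\<in>prime_factors m. w p"
  assumes fin: "\<And>k. k \<in> {1..K} \<Longrightarrow> finite (Q k)"
    and disj: "\<And>j k. j \<in> {1..K} \<Longrightarrow> k \<in> {1..K} \<Longrightarrow> j \<noteq> k \<Longrightarrow> Q j \<inter> Q k = {}"
    and prime: "\<And>k p. k \<in> {1..K} \<Longrightarrow> p \<in> Q k \<Longrightarrow> prime p"
    and w: "\<And>p. w p \<ge> 0"
    and y: "\<And>k. k \<in> {1..K} \<Longrightarrow> 0 < y k \<and> y k \<le> 1"
    and b: "\<And>k p. k \<in> {1..K} \<Longrightarrow> p \<in> Q k \<Longrightarrow> real p \<le> b k" "\<And>k. k \<in> {1..K} \<Longrightarrow> b k \<ge> 1"
    and block: "\<And>k. k \<in> {1..K} \<Longrightarrow>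
      exp (g k) * (\<Prod>p\<in>Q k. 1 + u p) \<le> (\<Sum>(T,S)\<in>block_pairs (Q k) (t k) (s k). (\<Prod>p\<in>T. v p) * (\<Prod>p\<in>S. u p))"
  obtains I :: "nat set" and E :: "(nat \<times> nat) set" where
    "finite I" "0 \<notin> I" "1 \<in> I" "real (card I) \<le> (\<Prod>k=1..K. (1 + y k) ^ card (Q k) / y k ^ (t k + s k))"
    "\<And>k m. (k, m) \<in> E \<Longrightarrow> k > 0 \<and> m \<in> I \<and> k * m \<in> I \<and> real k \<le> (\<Prod>j=1..K. b j ^ t j)"
    "exp (\<Sum>k=1..K. g k) * (\<Sum>m\<in>I. (f m)\<^sup>2) \<le> (\<Sum>(k,m)\<in>E. 1 / sqrt (real k) * (f m * f (k * m)))"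
proof -
  define U where "U = (\<Union>k\<in>{1..K}. Q k)"
  define F where "F = {S. S \<subseteq> U \<and> (\<forall>k\<in>{1..K}. card (S \<inter> Q k) \<le> t k + s k)}"
  define I where "I = (\<lambda>S. \<Prod>S) ` F"
  let ?P = "family_pairs Q K t s"
  define E where "E = (\<lambda>(T, S). (\<Prod>T, \<Prod>S)) ` ?P"
  have finU: "finite U" unfolding U_def using fin by auto
  have primeU: "prime p" if "p \<in> U" for p using that prime unfolding U_def by auto
  have finS: "finite S" if "S \<subseteq> U" for S using that finU finite_subset by auto
  have finF: "finite F" by (rule finite_subset[of _ "Pow U"]) (use finU in \<open>auto simp: F_def\<close>)
  have pf: "prime_factors (\<Prod>S) = S" if "S \<subseteq> U" for S
    using that finS primeU by (intro prime_factors_prod_primes) auto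
  have pos: "\<Prod>S > 0" if "S \<subseteq> U" for S
  proof (rule prod_pos)
    fix p assume "p \<in> S"
    thus "p > 0" using that by (intro prime_gt_0_nat primeU) auto
  qed
  have injF: "inj_on (\<lambda>S. \<Prod>S) F"
  proof (rule inj_onI)
    fix S S' assume SS: "S \<in> F" "S' \<in> F" and eq: "\<Prod>S = \<Prod>S'"
    have "S \<subseteq> U" "S' \<subseteq> U" using SS unfolding F_def by auto
    thus "S = S'" using pf[of S] pf[of S'] unfolding eq by simp
  qed
  have f_prod: "f (\<Prod>S) = (\<Prod>p\<in>S. w p)" if "S \<subseteq> U" for S unfolding f_def pf[OF that] ..
  have decomp: "(\<Prod>p\<in>S. h p) = (\<Prod>k=1..K. \<Prod>p\<in>S \<inter> Q k. h p)" if "S \<subseteq> U" for S and h :: "nat \<Rightarrow> real"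
  proof -
    have "S = (\<Union>k\<in>{1..K}. S \<inter> Q k)" using that unfolding U_def by auto
    hence "(\<Prod>p\<in>S. h p) = (\<Prod>p\<in>(\<Union>k\<in>{1..K}. S \<inter> Q k). h p)" by simp
    also have "\<dots> = (\<Prod>k=1..K. \<Prod>p\<in>S \<inter> Q k. h p)"
    proof (rule prod.UNION_disjoint)
      show "\<forall>k\<in>{1..K}. finite (S \<inter> Q k)" using fin by blast
      show "\<forall>j\<in>{1..K}. \<forall>k\<in>{1..K}. j \<noteq> k \<longrightarrow> (S \<inter> Q j) \<inter> (S \<inter> Q k) = {}" using disj by blast
    qed simp
    finally show ?thesis .
  qed
  have decompU: "(\<Prod>p\<in>U. h p) = (\<Prod>k=1..K. \<Prod>p\<in>Q k. h p)" for h :: "nat \<Rightarrow> real"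
  proof -
    have "U \<inter> Q k = Q k" if "k \<in> {1..K}" for k using that unfolding U_def by auto
    thus ?thesis using decomp[of U h] by simp
  qed
  have P: "T \<subseteq> U \<and> S \<subseteq> U \<and> T \<inter> S = {} \<and> T \<union> S \<in> F \<and> S \<in> F \<and> (\<forall>k\<in>{1..K}. card (T \<inter> Q k) \<le> t k)"
    if "(T, S) \<in> ?P" for T S
  proof -
    have 1: "T \<subseteq> U" "S \<subseteq> U" "T \<inter> S = {}" "\<And>k. k \<in> {1..K} \<Longrightarrow> card (T \<inter> Q k) \<le> t k \<and> card (S \<inter> Q k) \<le> s k"
      using that unfolding family_pairs_def U_def by auto
    have "card ((T \<union> S) \<inter> Q k) \<le> t k + s k" if "k \<in> {1..K}" for k
    proof -
      have "card ((T \<union> S) \<inter> Q k) \<le> card (T \<inter> Q k) + card (S \<inter> Q k)"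
        by (metis Int_Un_distrib2 card_Un_le)
      thus ?thesis using 1(4)[OF that] by linarith
    qed
    moreover have "card (S \<inter> Q k) \<le> t k + s k" if "k \<in> {1..K}" for k using 1(4)[OF that] by linarith
    ultimately have "T \<union> S \<in> F" "S \<in> F" unfolding F_def using 1(1,2) by blast+
    thus ?thesis using 1 by blast
  qed
  show ?thesis
  proof (rule that[of I E])
    show "finite I" unfolding I_def using finF by simp
    show "0 \<notin> I"
    proof
      assume "0 \<in> I"
      then obtain S where "S \<in> F" "0 = \<Prod>S" unfolding I_def by blast
      thus False using pos[of S] unfolding F_def by simp
    qed
    have "{} \<in> F" unfolding F_def by auto
    thus "1 \<in> I" unfolding I_def by (intro image_eqI[of _ _ "{}"]) auto
  next
    \<comment> \<open>Counting by a generating function: a prime of block \<open>k\<close> receives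
      the weight \<open>y k\<close>. As \<open>y k \<le> 1\<close>, the cap on cardinalities bounds
      the weight of each admissible set from below, while the total weight of all sets is a
      product.\<close>
    define Y where "Y = (\<lambda>p. \<Sum>k\<in>{1..K}. if p \<in> Q k then y k else 0)"
    have Y: "Y p = y k" if "k \<in> {1..K}" "p \<in> Q k" for k p
    proof -
      have "Y p = (\<Sum>j\<in>{1..K}. if j = k then y k else 0)"
        unfolding Y_def using that disj by (intro sum.cong) auto
      thus ?thesis using that by simp
    qed
    have ypos: "(\<Prod>k=1..K. y k ^ (t k + s k)) > 0"
      using y by (intro prod_pos zero_less_power) blast
    have "real (card I) = (\<Sum>S\<in>F. 1)" unfolding I_def using card_image[OF injF] by simp
    also have "\<dots> \<le> (\<Sum>S\<in>F. (\<Prod>p\<in>S. Y p) / (\<Prod>k=1..K. y k ^ (t k + s k)))"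
    proof (rule sum_mono)
      fix S assume S: "S \<in> F"
      hence SU: "S \<subseteq> U" unfolding F_def by auto
      have "(\<Prod>k=1..K. y k ^ (t k + s k)) \<le> (\<Prod>k=1..K. y k ^ card (S \<inter> Q k))"
      proof (intro prod_mono conjI)
        fix k assume k: "k \<in> {1..K}"
        show "0 \<le> y k ^ (t k + s k)" using y[OF k] by simp
        show "y k ^ (t k + s k) \<le> y k ^ card (S \<inter> Q k)"
          using y[OF k] S k unfolding F_def by (intro power_decreasing) auto
      qed
      also have "\<dots> = (\<Prod>k=1..K. \<Prod>p\<in>S \<inter> Q k. Y p)"
      proof (rule prod.cong[OF refl])
        fix k assume k: "k \<in> {1..K}"
        have "(\<Prod>p\<in>S \<inter> Q k. Y p) = (\<Prod>p\<in>S \<inter> Q k. y k)" by (rule prod.cong) (auto intro: Y[OF k])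
        thus "y k ^ card (S \<inter> Q k) = (\<Prod>p\<in>S \<inter> Q k. Y p)" by simp
      qed
      also have "\<dots> = (\<Prod>p\<in>S. Y p)" by (rule decomp[OF SU, symmetric])
      finally show "1 \<le> (\<Prod>p\<in>S. Y p) / (\<Prod>k=1..K. y k ^ (t k + s k))" using ypos by simp
    qed
    also have "\<dots> \<le> (\<Sum>S\<in>Pow U. (\<Prod>p\<in>S. Y p) / (\<Prod>k=1..K. y k ^ (t k + s k)))"
    proof (intro sum_mono2)
      fix S assume "S \<in> Pow U - F"
      have "Y p \<ge> 0" for p unfolding Y_def
      proof (rule sum_nonneg)
        fix k assume "k \<in> {1..K}"
        thus "0 \<le> (if p \<in> Q k then y k else 0)" using y[of k] by simp
      qed
      thus "0 \<le> (\<Prod>p\<in>S. Y p) / (\<Prod>k=1..K. y k ^ (t k + s k))"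
        using ypos by (intro divide_nonneg_pos prod_nonneg) auto
    next
      show "finite (Pow U)" using finU by simp
      show "F \<subseteq> Pow U" unfolding F_def by blast
    qed
    also have "\<dots> = (\<Prod>p\<in>U. 1 + Y p) / (\<Prod>k=1..K. y k ^ (t k + s k))"
      by (simp only: sum_divide_distrib[symmetric] sum_Pow_prod[OF finU])
    also have "(\<Prod>p\<in>U. 1 + Y p) = (\<Prod>k=1..K. (1 + y k) ^ card (Q k))"
      unfolding decompU
    proof (rule prod.cong[OF refl])
      fix k assume k: "k \<in> {1..K}"
      have "(\<Prod>p\<in>Q k. 1 + Y p) = (\<Prod>p\<in>Q k. 1 + y k)" by (rule prod.cong) (auto simp: Y[OF k])
      thus "(\<Prod>p\<in>Q k. 1 + Y p) = (1 + y k) ^ card (Q k)" by simp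
    qed
    finally show "real (card I) \<le> (\<Prod>k=1..K. (1 + y k) ^ card (Q k) / y k ^ (t k + s k))"
      by (simp add: prod_dividef)
  next
    fix k m assume "(k, m) \<in> E"
    then obtain T S where TS: "(T, S) \<in> ?P" "k = \<Prod>T" "m = \<Prod>S" unfolding E_def by auto
    note PT = P[OF TS(1)]
    have "k * m = \<Prod>(T \<union> S)" unfolding TS using PT finS by (subst prod.union_disjoint) auto
    moreover have "real k = (\<Prod>p\<in>T. real p)" unfolding TS by (simp add: of_nat_prod)
    hence "real k = (\<Prod>j=1..K. \<Prod>p\<in>T \<inter> Q j. real p)" using PT by (simp only: decomp[of T])
    moreover have "\<dots> \<le> (\<Prod>j=1..K. b j ^ t j)"
    proof (intro prod_mono conjI)
      fix j assume j: "j \<in> {1..K}"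
      show "0 \<le> (\<Prod>p\<in>T \<inter> Q j. real p)" by (intro prod_nonneg) auto
      have "(\<Prod>p\<in>T \<inter> Q j. real p) \<le> (\<Prod>p\<in>T \<inter> Q j. b j)"
        using b(1)[OF j] by (intro prod_mono) auto
      also have "\<dots> = b j ^ card (T \<inter> Q j)" by simp
      also have "\<dots> \<le> b j ^ t j" using PT b(2)[OF j] j by (intro power_increasing) blast+
      finally show "(\<Prod>p\<in>T \<inter> Q j. real p) \<le> b j ^ t j" .
    qed
    moreover have "k > 0" unfolding TS using PT by (intro pos) blast
    moreover have "m \<in> I" unfolding TS I_def using PT by blast
    moreover have "\<Prod>(T \<union> S) \<in> I" unfolding I_def using PT by blast
    ultimately show "k > 0 \<and> m \<in> I \<and> k * m \<in> I \<and> real k \<le> (\<Prod>j=1..K. b j ^ t j)" by simp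
  next
    have u0: "u p \<ge> 0" "v p \<ge> 0" for p unfolding u_def v_def using w by auto
    have "(\<Sum>m\<in>I. (f m)\<^sup>2) = (\<Sum>S\<in>F. \<Prod>p\<in>S. u p)"
      unfolding I_def sum.reindex[OF injF] o_def u_def
    proof (rule sum.cong[OF refl])
      fix S assume "S \<in> F"
      hence "S \<subseteq> U" unfolding F_def by blast
      thus "(f (\<Prod>S))\<^sup>2 = (\<Prod>p\<in>S. (w p)\<^sup>2)" by (simp add: f_prod prod_power_distrib)
    qed
    also have "\<dots> \<le> (\<Sum>S\<in>Pow U. \<Prod>p\<in>S. u p)"
    proof (rule sum_mono2)
      show "finite (Pow U)" using finU by simp
      show "F \<subseteq> Pow U" unfolding F_def by blast
    qed (intro prod_nonneg u0)
    also have "\<dots> = (\<Prod>k=1..K. \<Prod>p\<in>Q k. 1 + u p)" unfolding sum_Pow_prod[OF finU] by (rule decompU)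
    finally have "exp (\<Sum>k=1..K. g k) * (\<Sum>m\<in>I. (f m)\<^sup>2) \<le> exp (\<Sum>k=1..K. g k) * (\<Prod>k=1..K. \<Prod>p\<in>Q k. 1 + u p)"
      by (intro mult_left_mono) auto
    also have "\<dots> = (\<Prod>k=1..K. exp (g k) * (\<Prod>p\<in>Q k. 1 + u p))"
      by (simp add: exp_sum prod.distrib)
    also have "\<dots> \<le> (\<Prod>k=1..K. \<Sum>(T,S)\<in>block_pairs (Q k) (t k) (s k). (\<Prod>p\<in>T. v p) * (\<Prod>p\<in>S. u p))"
      by (intro prod_mono conjI block mult_nonneg_nonneg prod_nonneg add_nonneg_nonneg u0) simp_all
    also have "\<dots> \<le> (\<Sum>(T,S)\<in>?P. (\<Prod>p\<in>T. v p) * (\<Prod>p\<in>S. u p))"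
      using fin disj u0 by (intro family_sum_ge) blast+
    also have "\<dots> = (\<Sum>(k,m)\<in>E. 1 / sqrt (real k) * (f m * f (k * m)))"
    proof -
      have inj: "inj_on (\<lambda>(T, S). (\<Prod>T, \<Prod>S)) ?P"
      proof (rule inj_onI)
        fix x z assume xz: "x \<in> ?P" "z \<in> ?P" and eq: "(\<lambda>(T, S). (\<Prod>T, \<Prod>S)) x = (\<lambda>(T, S). (\<Prod>T, \<Prod>S)) z"
        obtain T S T' S' where x: "x = (T, S)" and z: "z = (T', S')" by (cases x, cases z)
        have "\<Prod>T = \<Prod>T'" "\<Prod>S = \<Prod>S'" using eq unfolding x z by simp_all
        thus "x = z"
          using P[OF xz(1)[unfolded x]] P[OF xz(2)[unfolded z]] pf[of T] pf[of S] pf[of T'] pf[of S']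
          unfolding x z by metis
      qed
      show ?thesis unfolding E_def sum.reindex[OF inj] o_def
      proof (intro sum.cong refl)
        fix z assume z: "z \<in> ?P"
        obtain T S where zz: "z = (T, S)" by (cases z)
        note PT = P[OF z[unfolded zz]]
        have "\<Prod>T * \<Prod>S = \<Prod>(T \<union> S)" using PT finS by (subst prod.union_disjoint) auto
        hence "f (\<Prod>T * \<Prod>S) = (\<Prod>p\<in>T \<union> S. w p)" using PT by (simp add: f_prod)
        also have "\<dots> = (\<Prod>p\<in>T. w p) * (\<Prod>p\<in>S. w p)" using PT finS by (intro prod.union_disjoint) auto
        finally have "1 / sqrt (real (\<Prod>T)) * (f (\<Prod>S) * f (\<Prod>T * \<Prod>S)) =
            1 / (\<Prod>p\<in>T. sqrt (real p)) * ((\<Prod>p\<in>S. w p) * ((\<Prod>p\<in>T. w p) * (\<Prod>p\<in>S. w p)))"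
          using PT by (simp add: f_prod of_nat_prod sqrt_prod)
        also have "\<dots> = (\<Prod>p\<in>T. v p) * (\<Prod>p\<in>S. u p)"
          unfolding u_def v_def by (simp add: prod_dividef prod.distrib power2_eq_square)
        finally have e: "1 / sqrt (real (\<Prod>T)) * (f (\<Prod>S) * f (\<Prod>T * \<Prod>S)) = (\<Prod>p\<in>T. v p) * (\<Prod>p\<in>S. u p)" .
        show "(case z of (T, S) \<Rightarrow> (\<Prod>p\<in>T. v p) * (\<Prod>p\<in>S. u p)) =
           (case case z of (T, S) \<Rightarrow> (\<Prod>T, \<Prod>S) of (k, m) \<Rightarrow> 1 / sqrt (real k) * (f m * f (k * m)))"
          unfolding zz prod.case by (rule e[symmetric])
      qed
    qed
    finally show "exp (\<Sum>k=1..K. g k) * (\<Sum>m\<in>I. (f m)\<^sup>2) \<le> (\<Sum>(k,m)\<in>E. 1 / sqrt (real k) * (f m * f (k * m)))" .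
  qed
qed

section \<open>The choice of blocks, weights and caps in terms of iterated logarithms\<close>

lemma sum_inverse_squares_le: "(\<Sum>k=1..n. 1 / (real k)\<^sup>2) \<le> 2"
proof (cases "n = 0")
  case False
  have "(\<Sum>k=1..n. 1 / (real k)\<^sup>2) \<le> 2 - 1 / real n" if "n \<ge> 1" for n
    using that
  proof (induction n rule: nat_induct_at_least)
    case (Suc n)
    have "1 / (real (Suc n))\<^sup>2 \<le> 1 / (real n * real (Suc n))"
      using Suc.hyps unfolding power2_eq_square by (intro divide_left_mono mult_right_mono) auto
    also have "\<dots> = 1 / real n - 1 / real (Suc n)" using Suc.hyps by (simp add: field_simps)
    finally have "1 / (real (Suc n))\<^sup>2 \<le> 1 / real n - 1 / real (Suc n)" .
    moreover have "(\<Sum>k=1..Suc n. 1 / (real k)\<^sup>2) = (\<Sum>k=1..n. 1 / (real k)\<^sup>2) + 1 / (real (Suc n))\<^sup>2"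
      by simp
    ultimately show ?case using Suc.IH by linarith
  qed simp
  from this[of n] False show ?thesis by (smt (verit) divide_nonneg_nonneg of_nat_0_le_iff One_nat_def Suc_leI neq0_conv)
qed simp

text \<open>\<open>L1\<close>, \<open>L2\<close>, \<open>L3\<close> stand for log N, log log N, log
  log log N. On block \<open>k\<close> the quantity ln p - L2 - L3 lies between B k and B (k + 1);
  the weight of p is sqrt (\<kappa> L1 L2 / L3) divided by sqrt p and by this quantity, frozen at B
  k. The hypothesis \<open>e1\<close> keeps ln p close to \<open>L2\<close>, \<open>e2\<close> and
  \<open>e3\<close> keep \<open>u\<close> and \<open>v\<close> small, \<open>e5\<close> and
  \<open>e6\<close> feed the block estimate, and \<open>e7\<close>, \<open>e8\<close>,
  \<open>e9\<close> give the cardinality, the size of the multipliers and the gain. The main term of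
  \<open>e7\<close> is (1 + \<delta>)^3 \<kappa> L1, that of \<open>e9\<close> is close to sqrt
  (\<kappa> L1 L3 / L2).\<close>

lemma resonator_at:
  fixes L1 \<kappa> \<delta> B C \<theta> c :: real
  defines "L2 \<equiv> ln L1" and "L3 \<equiv> ln (ln L1)"
  defines "A \<equiv> sqrt (\<kappa> * L1 * L2 / L3) / B" and "K \<equiv> nat \<lfloor>\<delta> * L2 / (2 * B)\<rfloor>"
  assumes C: "C \<ge> 1"
    and mertens: "\<And>x y. 1 \<le> x \<Longrightarrow> x \<le> y \<Longrightarrow>
      \<bar>(\<Sum>p | prime p \<and> x < real p \<and> real p \<le> y. ln (real p) / real p) - ln (y / x)\<bar> \<le> C"
    and \<delta>: "0 < \<delta>" "\<delta> \<le> 1/4" and B: "B = C / \<delta>" and \<kappa>: "\<kappa> > 0"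
    and L1: "L1 \<ge> 1" and L2: "L2 \<ge> 1" and L3: "L3 \<ge> 1"
    and e1: "L3 + B \<le> \<delta> * L2 / 2"
    and e2: "\<kappa> / (B\<^sup>2 * L3) \<le> \<delta>"
    and e3: "A / (L1 * L2) \<le> \<delta>"
    and e4: "K \<ge> 1" "(1 - \<delta>) * L3 \<le> ln K"
    and e5: "A * (B - C) / ((1 + \<delta>) * L2\<^sup>2) \<ge> 1"
    and e6: "((1 + \<delta>) * ln (1 + \<delta>) - (1 + \<delta>) + 1) * (A\<^sup>2 * (B + C) / L2 ^ 3) \<ge> 1"
    and e7: "L1 * (B + C) / L3 + (1 + \<delta>) * (A\<^sup>2 * (B + C) / L2) * (B * (1 + \<delta>) * (1 + L3) + 2 * (B * (1 + \<delta>) + ln L3))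
       + L2 * ((4 * (A * (B + C) / L2) + 2) * (B * (1 + \<delta>) * (L2 + 1) + ln L3)) \<le> \<theta> * L1"
    and e8: "L2 * ((4 * (A * (B + C) / L2) + 1) * (2 * L2)) \<le> L1"
    and e9: "c * sqrt (L1 * L3 / L2) \<le> (A * B / L2) * ((1 - \<delta>)\<^sup>2 / (1 + \<delta>) - 4 * \<delta> * (1 + \<delta>)) * ((1 - \<delta>) * L3) - 3 * L2"
    and g0: "(1 - \<delta>)\<^sup>2 / (1 + \<delta>) - 4 * \<delta> * (1 + \<delta>) \<ge> 0"
  shows "\<exists>(f :: nat \<Rightarrow> real) I E. finite I \<and> 0 \<notin> I \<and> (\<forall>m. f m \<ge> 0) \<and> (\<Sum>m\<in>I. (f m)\<^sup>2) > 0 \<and>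
     real (card I) \<le> exp (\<theta> * L1) \<and>
     (\<forall>(k, m)\<in>E. 0 < k \<and> m \<in> I \<and> k * m \<in> I \<and> real k \<le> exp L1) \<and>
     exp (c * sqrt (L1 * L3 / L2)) * (\<Sum>m\<in>I. (f m)\<^sup>2) \<le> (\<Sum>(k,m)\<in>E. 1 / sqrt (real k) * (f m * f (k * m)))"
proof -
  have CB: "C = \<delta> * B" using B \<delta> by simp
  have B4: "B \<ge> 4"
  proof -
    have "C * 4 \<le> C / \<delta>" using C \<delta> by (simp add: field_simps)
    thus ?thesis using C B by simp
  qed
  have BC: "B - C > 0" unfolding CB using B4 \<delta> by (simp add: algebra_simps mult_less_cancel_right1)
  have A0: "A > 0" unfolding A_def using \<kappa> L1 L2 L3 B4 by auto
  \<comment> \<open>At this starting point \<open>A\<^sup>2 / x0\<close> equals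
    \<open>\<kappa> / (B\<^sup>2 * L3)\<close>, which is just small enough for all
    \<open>u p\<close> to be negligible.\<close>
  define x0 where "x0 = L1 * L2"
  have x0: "x0 \<ge> L1" "x0 \<ge> 1" unfolding x0_def using L1 L2 mult_mono[of 1 L1 1 L2] by (auto simp: mult_le_cancel_left1)
  have lnx0: "ln x0 = L2 + L3" unfolding x0_def L2_def L3_def using L1 L2[unfolded L2_def] by (simp add: ln_mult)
  define x where "x = (\<lambda>k::nat. exp (B * k) * x0)"
  have x1: "x k \<ge> x0" for k unfolding x_def using B4 x0 by (simp add: mult_le_cancel_right1)
  have x_mono: "x j \<le> x k" if "j \<le> k" for j k unfolding x_def using that B4 x0 by (intro mult_right_mono) auto
  have lnx: "ln (x k) = B * k + L2 + L3" for k unfolding x_def using x0 by (simp add: ln_mult lnx0)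
  have KL: "B * K \<le> \<delta> * L2 / 2"
  proof -
    have "real K \<le> \<delta> * L2 / (2 * B)" unfolding K_def using \<delta> L2 B4 by (intro of_nat_floor) auto
    thus ?thesis using B4 by (simp add: field_simps)
  qed
  have KL2: "real K \<le> L2"
  proof -
    have "real K \<le> B * K" using B4 by (simp add: mult_le_cancel_right1)
    also have "\<dots> \<le> \<delta> * L2 / 2" by (rule KL)
    also have "\<dots> \<le> 1 * L2" using \<delta> L2 by (simp add: field_simps mult_mono)
    finally show ?thesis by simp
  qed
  \<comment> \<open>One half of \<delta> L2 is spent on the \<open>K\<close> blocks of logarithmic
    length \<open>B\<close>, the other on the offset L3 + B.\<close>
  have lnx_le: "ln (x (Suc k)) \<le> (1 + \<delta>) * L2" if "k \<le> K" for k
  proof -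
    have "B * real (Suc k) \<le> B * K + B" using that B4 by (simp add: algebra_simps)
    thus ?thesis unfolding lnx using KL e1 by (simp add: algebra_simps)
  qed
  define Q where "Q = (\<lambda>k. {p. prime p \<and> x k < real p \<and> real p \<le> x (Suc k)})"
  have finQ: "finite (Q k)" for k
    by (rule finite_subset[of _ "{..nat \<lfloor>x (Suc k)\<rfloor>}"]) (auto simp: Q_def le_nat_floor)
  have disjQ: "Q j \<inter> Q k = {}" if "j \<noteq> k" for j k
  proof (cases "j < k")
    case True
    hence "x (Suc j) \<le> x k" by (intro x_mono) auto
    thus ?thesis unfolding Q_def by auto
  next
    case False
    hence "x (Suc k) \<le> x j" using that by (intro x_mono) auto
    thus ?thesis unfolding Q_def by auto
  qed
  have Qp: "real p \<ge> x0" "real p > 0" if "p \<in> Q k" for p k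
    using that x1[of k] x0 unfolding Q_def by auto
  define H where "H = (\<lambda>k. \<Sum>p\<in>Q k. 1 / real p)"
  \<comment> \<open>Mertens' theorem concerns ln p / p; since ln p is between L2 and (1 + \<delta>)
    L2 on the block, dividing by it gives the sum of 1/p.\<close>
  have H_ub: "H k \<le> (B + C) / L2" and H_lb: "k \<le> K \<Longrightarrow> H k \<ge> (B - C) / ((1 + \<delta>) * L2)" for k
  proof -
    have "ln (x (Suc k) / x k) = B"
      using x1[of k] x1[of "Suc k"] x0 by (simp add: ln_div lnx algebra_simps)
    hence M: "\<bar>(\<Sum>p\<in>Q k. ln (real p) / real p) - B\<bar> \<le> C"
      using mertens[of "x k" "x (Suc k)"] x1[of k] x0 x_mono[of k "Suc k"] unfolding Q_def by auto
    have "L2 * H k \<le> (\<Sum>p\<in>Q k. ln (real p) / real p)"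
      unfolding H_def sum_distrib_left
    proof (rule sum_mono)
      fix p assume p: "p \<in> Q k"
      have "L2 \<le> ln (real p)" unfolding L2_def using Qp[OF p] x0 L1 by (subst ln_le_cancel_iff) auto
      thus "L2 * (1 / real p) \<le> ln (real p) / real p" using Qp[OF p] by (simp add: divide_right_mono)
    qed
    hence "L2 * H k \<le> B + C" using M by linarith
    thus "H k \<le> (B + C) / L2" using L2 by (simp add: field_simps)
    assume k: "k \<le> K"
    have "(\<Sum>p\<in>Q k. ln (real p) / real p) \<le> ((1 + \<delta>) * L2) * H k"
      unfolding H_def sum_distrib_left
    proof (rule sum_mono)
      fix p assume p: "p \<in> Q k"
      have "ln (real p) \<le> ln (x (Suc k))" using Qp[OF p] p unfolding Q_def by (subst ln_le_cancel_iff) auto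
      hence "ln (real p) \<le> (1 + \<delta>) * L2" using lnx_le[OF k] by linarith
      hence "ln (real p) / real p \<le> (1 + \<delta>) * L2 / real p" using Qp[OF p] by (intro divide_right_mono) auto
      thus "ln (real p) / real p \<le> (1 + \<delta>) * L2 * (1 / real p)" by simp
    qed
    hence "B - C \<le> H k * ((1 + \<delta>) * L2)" using M by (simp add: mult.commute abs_le_iff)
    thus "H k \<ge> (B - C) / ((1 + \<delta>) * L2)" using L2 \<delta> by (subst pos_divide_le_eq) auto
  qed
  define w where "w = (\<lambda>p. \<Sum>k\<in>{1..K}. if p \<in> Q k then A / (real k * sqrt (real p)) else 0)"
  have w0: "w p \<ge> 0" for p unfolding w_def using A0 by (intro sum_nonneg) auto
  have w: "w p = A / (real k * sqrt (real p))" if "k \<in> {1..K}" "p \<in> Q k" for k p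
  proof -
    have "w p = (\<Sum>j\<in>{1..K}. if j = k then A / (real k * sqrt (real p)) else 0)"
      unfolding w_def using that disjQ by (intro sum.cong refl) fastforce
    thus ?thesis using that by simp
  qed
  define u where "u = (\<lambda>p. (w p)\<^sup>2)"
  define v where "v = (\<lambda>p. w p / sqrt (real p))"
  have u: "u p = A\<^sup>2 / (real k)\<^sup>2 * (1 / real p)" and v: "v p = A / real k * (1 / real p)"
    if "k \<in> {1..K}" "p \<in> Q k" for k p
    using Qp[OF that(2)] unfolding u_def v_def w[OF that] by (auto simp: power_divide power_mult_distrib)
  define Ub where "Ub = (\<lambda>k::nat. A\<^sup>2 / (real k)\<^sup>2 * ((B + C) / L2))"
  define Vb where "Vb = (\<lambda>k::nat. A / real k * ((B + C) / L2))"
  define s where "s = (\<lambda>k. nat \<lceil>(1 + \<delta>) * Ub k\<rceil>)"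
  define t where "t = (\<lambda>k. nat \<lceil>4 * Vb k\<rceil>)"
  have Ub0: "Ub k \<ge> 0" and Vb0: "Vb k \<ge> 0" for k
    unfolding Ub_def Vb_def using A0 B4 C L2 by auto
  have s_bd: "(1 + \<delta>) * Ub k \<le> s k" "s k \<le> (1 + \<delta>) * Ub k + 1" for k
    using mult_nonneg_nonneg[OF _ Ub0, of "1 + \<delta>" k] \<delta> unfolding s_def by linarith+
  have t_bd: "4 * Vb k \<le> t k" "t k \<le> 4 * Vb k + 1" for k
    using Vb0[of k] unfolding t_def by linarith+
  define g where "g = (\<lambda>k. (1 - \<delta>) * (\<Sum>p\<in>Q k. v p) - \<delta> * (4 * Vb k + 1) - 2)"
  have sum_u: "(\<Sum>p\<in>Q k. u p) = A\<^sup>2 / (real k)\<^sup>2 * H k" and sum_v: "(\<Sum>p\<in>Q k. v p) = A / real k * H k"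
    if "k \<in> {1..K}" for k
    unfolding H_def sum_distrib_left using u[OF that] v[OF that] by (auto intro!: sum.cong)
  have sum_v_ge: "(\<Sum>p\<in>Q k. v p) \<ge> A / real k * ((B - C) / ((1 + \<delta>) * L2))" if "k \<in> {1..K}" for k
    unfolding sum_v[OF that] using H_lb[of k] that A0 by (intro mult_left_mono) auto
  have block: "exp (g k) * (\<Prod>p\<in>Q k. 1 + u p) \<le>
      (\<Sum>(T,S)\<in>block_pairs (Q k) (t k) (s k). (\<Prod>p\<in>T. v p) * (\<Prod>p\<in>S. u p))" if k: "k \<in> {1..K}" for k
    unfolding g_def
  proof (rule block_sum_ge[where U = "Ub k"])
    have kr: "real k \<ge> 1" "real k \<le> L2" using k KL2 by auto
    fix p assume p: "p \<in> Q k"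
    have inv: "1 / real p \<le> 1 / x0" using Qp[OF p] x0 by (intro divide_left_mono) auto
    have "u p \<le> A\<^sup>2 / 1 * (1 / x0)"
      unfolding u[OF k p] using kr by (intro mult_mono divide_left_mono inv) auto
    also have "\<dots> = \<kappa> / (B\<^sup>2 * L3)"
      unfolding A_def x0_def using \<kappa> L1 L2 L3 by (simp add: power_divide field_simps)
    finally show "0 \<le> u p \<and> u p \<le> \<delta>" using e2 unfolding u_def by simp
    have "v p \<le> A / 1 * (1 / x0)"
      unfolding v[OF k p] using kr A0 by (intro mult_mono divide_left_mono inv) auto
    thus "0 \<le> v p \<and> v p \<le> \<delta>" using e3 w0 unfolding v_def x0_def by simp
  next
    have kr: "real k \<ge> 1" "real k \<le> L2" using k KL2 by auto
    show "(\<Sum>p\<in>Q k. u p) \<le> Ub k" "(\<Sum>p\<in>Q k. v p) \<le> Vb k"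
      unfolding sum_u[OF k] sum_v[OF k] Ub_def Vb_def using H_ub A0 by (intro mult_left_mono; auto)+
    have "1 \<le> A * (B - C) / ((1 + \<delta>) * L2\<^sup>2)" by (rule e5)
    also have "\<dots> = A / L2 * ((B - C) / ((1 + \<delta>) * L2))" by (simp add: power2_eq_square)
    also have "\<dots> \<le> A / real k * ((B - C) / ((1 + \<delta>) * L2))"
      using kr A0 BC \<delta> L2 by (intro mult_right_mono divide_left_mono) auto
    also have "\<dots> \<le> (\<Sum>p\<in>Q k. v p)" by (rule sum_v_ge[OF k])
    finally show "1 \<le> (\<Sum>p\<in>Q k. v p)" .
    have pos: "(1 + \<delta>) * ln (1 + \<delta>) - (1 + \<delta>) + 1 \<ge> 0"
    proof (rule ccontr)
      assume "\<not> ?thesis"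
      hence "((1 + \<delta>) * ln (1 + \<delta>) - (1 + \<delta>) + 1) * (A\<^sup>2 * (B + C) / L2 ^ 3) \<le> 0"
        using B4 C L2 by (intro mult_nonpos_nonneg) auto
      thus False using e6 by linarith
    qed
    have "A\<^sup>2 * (B + C) / L2 ^ 3 = A\<^sup>2 / L2\<^sup>2 * ((B + C) / L2)" by (simp add: power2_eq_square power3_eq_cube)
    also have "\<dots> \<le> Ub k" unfolding Ub_def using kr B4 C L2
      by (intro mult_right_mono divide_left_mono power_mono) auto
    finally have "((1 + \<delta>) * ln (1 + \<delta>) - (1 + \<delta>) + 1) * (A\<^sup>2 * (B + C) / L2 ^ 3) \<le> ((1 + \<delta>) * ln (1 + \<delta>) - (1 + \<delta>) + 1) * Ub k"
      using pos by (intro mult_left_mono)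
    thus "1 \<le> ((1 + \<delta>) * ln (1 + \<delta>) - (1 + \<delta>) + 1) * Ub k" using e6 by linarith
  qed (use finQ \<delta> s_bd t_bd in auto)
  \<comment> \<open>The block has at most e^(B(k+1)) L1 (B + C) primes, so this weight makes
    \<open>card (Q k) * y k\<close> at most L1 (B + C) / L3 times e^(-C(k+1)): summable over
    \<open>k\<close> and o(L1) in total. The price per element grows linearly in \<open>k\<close>
    against a cap \<open>s k\<close> with main part of order 1/k^2, and the resulting harmonic sum
    supplies the factor L3.\<close>
  define W where "W = (\<lambda>k::nat. B * (1 + \<delta>) * (real k + 1) + ln L3)"
  define y where "y = (\<lambda>k. exp (- W k))"
  have lnL3: "ln L3 \<ge> 0" using L3 by simp
  have W0: "W k \<ge> 0" for k unfolding W_def using B4 \<delta> lnL3 by (auto intro!: add_nonneg_nonneg mult_nonneg_nonneg)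
  have BC2: "(B + C) / L2 \<ge> 0" using B4 C L2 by auto
  have card_bound: "(\<Prod>k=1..K. (1 + y k) ^ card (Q k) / y k ^ (t k + s k)) \<le> exp (\<theta> * L1)"
  proof -
    have factor: "(1 + y k) ^ card (Q k) / y k ^ (t k + s k) \<le> exp (card (Q k) * y k + W k * real (t k + s k))" for k
    proof -
      have "(1 + y k) ^ card (Q k) \<le> exp (y k) ^ card (Q k)"
        by (intro power_mono) (auto simp: y_def add_nonneg_nonneg)
      also have "\<dots> = exp (card (Q k) * y k)" by (simp add: exp_of_nat_mult)
      finally have 1: "(1 + y k) ^ card (Q k) \<le> exp (card (Q k) * y k)" .
      have "y k ^ (t k + s k) = exp (- (W k * real (t k + s k)))"
        unfolding y_def exp_of_nat_mult[symmetric] by (simp add: mult.commute)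
      hence "(1 + y k) ^ card (Q k) / y k ^ (t k + s k) = (1 + y k) ^ card (Q k) * exp (W k * real (t k + s k))"
        by (simp add: exp_minus divide_inverse)
      also have "\<dots> \<le> exp (card (Q k) * y k) * exp (W k * real (t k + s k))"
        by (intro mult_right_mono 1) auto
      finally show ?thesis by (simp add: exp_add)
    qed
    have "(\<Prod>k=1..K. (1 + y k) ^ card (Q k) / y k ^ (t k + s k)) \<le> (\<Prod>k=1..K. exp (card (Q k) * y k + W k * real (t k + s k)))"
      by (intro prod_mono conjI factor divide_nonneg_nonneg zero_le_power) (auto simp: y_def add_nonneg_nonneg)
    also have "\<dots> = exp (\<Sum>k=1..K. card (Q k) * y k + W k * real (t k + s k))" by (simp add: exp_sum)
    also have "(\<Sum>k=1..K. card (Q k) * y k + W k * real (t k + s k)) \<le>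
       (\<Sum>k=1..K. L1 * (B + C) / L3 * (1/2) ^ k + (1 + \<delta>) * (A\<^sup>2 * (B + C) / L2) * (1 / (real k)\<^sup>2 * W k)
         + (4 * (A * (B + C) / L2) + 2) * (B * (1 + \<delta>) * (L2 + 1) + ln L3))"
    proof (rule sum_mono)
      fix k assume k: "k \<in> {1..K}"
      have kr: "real k \<ge> 1" "real k \<le> L2" using k KL2 by auto
      have "card (Q k) * y k \<le> L1 * (B + C) / L3 * (1/2) ^ k"
      proof -
        have "real (card (Q k)) = (\<Sum>p\<in>Q k. 1)" by simp
        also have "\<dots> \<le> (\<Sum>p\<in>Q k. x (Suc k) * (1 / real p))"
          using Qp by (intro sum_mono) (auto simp: Q_def field_simps)
        also have "\<dots> = x (Suc k) * H k" unfolding H_def by (rule sum_distrib_left[symmetric])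
        also have "\<dots> \<le> x (Suc k) * ((B + C) / L2)" using x1[of "Suc k"] x0 by (intro mult_left_mono H_ub) auto
        also have "\<dots> = exp (B * real (Suc k)) * L1 * (B + C)" unfolding x_def x0_def using L2 by simp
        finally have 1: "card (Q k) * y k \<le> exp (B * real (Suc k)) * L1 * (B + C) * y k"
          by (intro mult_right_mono) (auto simp: y_def)
        have "y k = exp (- (B * real (Suc k))) * exp (- (C * real (Suc k))) / L3"
        proof -
          have "- W k = - (B * real (Suc k)) + - (C * real (Suc k)) + - ln L3"
            unfolding W_def CB by (simp add: algebra_simps)
          hence "y k = exp (- (B * real (Suc k))) * exp (- (C * real (Suc k))) * exp (- ln L3)"
            unfolding y_def by (simp only: exp_add)
          thus ?thesis using L3 by (simp add: exp_minus divide_inverse)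
        qed
        hence "exp (B * real (Suc k)) * L1 * (B + C) * y k = L1 * (B + C) / L3 * exp (- (C * real (Suc k)))"
          by (simp add: exp_minus)
        also have "\<dots> \<le> L1 * (B + C) / L3 * (1/2) ^ k"
        proof (intro mult_left_mono)
          have "exp (- (C * real (Suc k))) \<le> exp (- (1 * real k))"
            using C mult_mono[of 1 C "real k" "real (Suc k)"] by simp
          also have "\<dots> = exp (-1) ^ k" by (simp add: exp_of_nat_mult[symmetric])
          also have "\<dots> \<le> (1/2) ^ k"
            using exp_ge_add_one_self[of "1::real"] by (intro power_mono) (auto simp: exp_minus field_simps)
          finally show "exp (- (C * real (Suc k))) \<le> (1/2) ^ k" .
        qed (use L1 B4 C L3 in auto)
        finally show ?thesis using 1 by linarith
      qed
      moreover have "W k * real (t k + s k) \<le> (1 + \<delta>) * (A\<^sup>2 * (B + C) / L2) * (1 / (real k)\<^sup>2 * W k)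
         + (4 * (A * (B + C) / L2) + 2) * (B * (1 + \<delta>) * (L2 + 1) + ln L3)"
      proof -
        have Vb_le: "Vb k \<le> A * (B + C) / L2"
        proof -
          have "A / real k \<le> A / 1" using kr A0 by (intro divide_left_mono) auto
          hence "Vb k \<le> A / 1 * ((B + C) / L2)" unfolding Vb_def using BC2 by (intro mult_right_mono) auto
          thus ?thesis by simp
        qed
        have W_le: "W k \<le> B * (1 + \<delta>) * (L2 + 1) + ln L3"
          unfolding W_def using kr B4 \<delta> by (intro add_right_mono mult_left_mono) auto
        have "real (t k + s k) \<le> (1 + \<delta>) * Ub k + (4 * Vb k + 2)" using s_bd[of k] t_bd[of k] by simp
        hence "W k * real (t k + s k) \<le> W k * ((1 + \<delta>) * Ub k + (4 * Vb k + 2))"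
          by (intro mult_left_mono W0)
        also have "\<dots> = (1 + \<delta>) * (A\<^sup>2 * (B + C) / L2) * (1 / (real k)\<^sup>2 * W k) + (4 * Vb k + 2) * W k"
        proof -
          have "Ub k = (A\<^sup>2 * (B + C) / L2) * (1 / (real k)\<^sup>2)" unfolding Ub_def by simp
          thus ?thesis by (simp only: distrib_left mult_ac)
        qed
        also have "(4 * Vb k + 2) * W k \<le> (4 * (A * (B + C) / L2) + 2) * (B * (1 + \<delta>) * (L2 + 1) + ln L3)"
          using Vb_le W_le Vb0[of k] W0[of k] by (intro mult_mono) linarith+
        finally show ?thesis by simp
      qed
      ultimately show "card (Q k) * y k + W k * real (t k + s k) \<le>
        L1 * (B + C) / L3 * (1/2) ^ k + (1 + \<delta>) * (A\<^sup>2 * (B + C) / L2) * (1 / (real k)\<^sup>2 * W k)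
         + (4 * (A * (B + C) / L2) + 2) * (B * (1 + \<delta>) * (L2 + 1) + ln L3)" by linarith
    qed
    also have "\<dots> = L1 * (B + C) / L3 * (\<Sum>k=1..K. (1/2) ^ k) + (1 + \<delta>) * (A\<^sup>2 * (B + C) / L2) * (\<Sum>k=1..K. 1 / (real k)\<^sup>2 * W k)
         + real K * ((4 * (A * (B + C) / L2) + 2) * (B * (1 + \<delta>) * (L2 + 1) + ln L3))"
      by (simp only: sum.distrib sum_distrib_left sum_constant card_atLeastAtMost) simp
    also have "\<dots> \<le> L1 * (B + C) / L3 * 1 + (1 + \<delta>) * (A\<^sup>2 * (B + C) / L2) * (B * (1 + \<delta>) * (1 + L3) + 2 * (B * (1 + \<delta>) + ln L3))
         + L2 * ((4 * (A * (B + C) / L2) + 2) * (B * (1 + \<delta>) * (L2 + 1) + ln L3))"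
    proof (intro add_mono mult_left_mono mult_right_mono)
      have "(\<Sum>k=1..n. (1/2) ^ k) = 1 - (1/2::real) ^ n" for n by (induction n) auto
      thus "(\<Sum>k=1..K. (1/2) ^ k) \<le> (1::real)" by simp
      have "(\<Sum>k=1..K. 1 / (real k)\<^sup>2 * W k) = (\<Sum>k=1..K. B * (1 + \<delta>) * inverse (real k) + (B * (1 + \<delta>) + ln L3) * (1 / (real k)\<^sup>2))"
        unfolding W_def by (intro sum.cong refl) (auto simp: field_simps power2_eq_square)
      also have "\<dots> = B * (1 + \<delta>) * harm K + (B * (1 + \<delta>) + ln L3) * (\<Sum>k=1..K. 1 / (real k)\<^sup>2)"
        unfolding harm_def by (simp only: sum.distrib sum_distrib_left)
      also have "\<dots> \<le> B * (1 + \<delta>) * (1 + L3) + (B * (1 + \<delta>) + ln L3) * 2"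
      proof (intro add_mono mult_left_mono sum_inverse_squares_le)
        have "ln (real K) \<le> L3" unfolding L3_def using KL2 e4 L2 unfolding L2_def by (subst ln_le_cancel_iff) auto
        thus "harm K \<le> 1 + L3" using harm_le_Suc_ln[of K] e4 by linarith
      qed (use B4 \<delta> lnL3 in \<open>auto intro!: add_nonneg_nonneg mult_nonneg_nonneg\<close>)
      finally show "(\<Sum>k=1..K. 1 / (real k)\<^sup>2 * W k) \<le> B * (1 + \<delta>) * (1 + L3) + 2 * (B * (1 + \<delta>) + ln L3)" by simp
      show "real K \<le> L2" by (rule KL2)
    qed (use L1 B4 C L2 L3 \<delta> A0 lnL3 in \<open>auto intro!: add_nonneg_nonneg mult_nonneg_nonneg divide_nonneg_nonneg\<close>)
    also have "\<dots> \<le> \<theta> * L1" using e7 by simp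
    finally show ?thesis by simp
  qed
  have size_bound: "(\<Prod>j=1..K. x (Suc j) ^ t j) \<le> exp L1"
  proof -
    have xp: "x (Suc j) > 0" for j using x1[of "Suc j"] x0 by linarith
    have "(\<Prod>j=1..K. x (Suc j) ^ t j) = (\<Prod>j=1..K. exp (real (t j) * ln (x (Suc j))))"
      using xp by (intro prod.cong refl) (simp add: exp_of_nat_mult)
    also have "\<dots> = exp (\<Sum>j=1..K. real (t j) * ln (x (Suc j)))" by (simp add: exp_sum)
    also have "(\<Sum>j=1..K. real (t j) * ln (x (Suc j))) \<le> (\<Sum>j=1..K. (4 * (A * (B + C) / L2) + 1) * (2 * L2))"
    proof (intro sum_mono mult_mono)
      fix j assume j: "j \<in> {1..K}"
      hence kr: "real j \<ge> 1" by auto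
      have "A / real j \<le> A / 1" using kr A0 by (intro divide_left_mono) auto
      hence "Vb j \<le> A / 1 * ((B + C) / L2)" unfolding Vb_def using BC2 by (intro mult_right_mono) auto
      thus "real (t j) \<le> 4 * (A * (B + C) / L2) + 1" using t_bd(2)[of j] by simp
      have "ln (x (Suc j)) \<le> (1 + \<delta>) * L2" using j by (intro lnx_le) auto
      also have "\<dots> \<le> 2 * L2" using \<delta> L2 by (intro mult_right_mono) auto
      finally show "ln (x (Suc j)) \<le> 2 * L2" .
      show "0 \<le> 4 * (A * (B + C) / L2) + 1" using A0 B4 C L2 by (auto intro!: add_nonneg_nonneg divide_nonneg_nonneg)
      show "0 \<le> ln (x (Suc j))" using x1[of "Suc j"] x0 by simp
    qed
    also have "\<dots> = real K * ((4 * (A * (B + C) / L2) + 1) * (2 * L2))" by simp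
    also have "\<dots> \<le> L2 * ((4 * (A * (B + C) / L2) + 1) * (2 * L2))"
      using KL2 A0 B4 C L2 by (intro mult_right_mono) (auto intro!: add_nonneg_nonneg divide_nonneg_nonneg mult_nonneg_nonneg)
    also have "\<dots> \<le> L1" by (rule e8)
    finally show ?thesis by simp
  qed
  have gain: "c * sqrt (L1 * L3 / L2) \<le> (\<Sum>k=1..K. g k)"
  proof -
    \<comment> \<open>The total loss, tending to 1 with \<delta>: the quotient comes from the lower
      bound for the sum of \<open>v\<close>, the subtracted term from keeping \<open>S\<close> away
      from \<open>T\<close>.\<close>
    define G where "G = (1 - \<delta>)\<^sup>2 / (1 + \<delta>) - 4 * \<delta> * (1 + \<delta>)"
    have "(A * B / L2) * G * harm K - 3 * K = (\<Sum>k=1..K. (A * B / L2) * G * inverse (real k) - 3)"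
      unfolding harm_def by (simp add: sum_subtractf sum_distrib_left)
    also have "\<dots> \<le> (\<Sum>k=1..K. g k)"
    proof (rule sum_mono)
      fix k assume k: "k \<in> {1..K}"
      have "(A * B / L2) * G * inverse (real k) = (1 - \<delta>) * (A / real k * ((B - C) / ((1 + \<delta>) * L2))) - 4 * \<delta> * Vb k"
      proof -
        define q where "q = A / real k * (B / L2)"
        have e: "(B - C) / ((1 + \<delta>) * L2) = B / L2 * ((1 - \<delta>) / (1 + \<delta>))" "(B + C) / L2 = B / L2 * (1 + \<delta>)"
          unfolding CB by (simp_all add: algebra_simps)
        have "(A * B / L2) * G * inverse (real k) = q * G" unfolding q_def by (simp add: divide_inverse mult_ac)
        also have "\<dots> = q * ((1 - \<delta>) * ((1 - \<delta>) / (1 + \<delta>))) - q * (4 * \<delta> * (1 + \<delta>))"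
          unfolding G_def by (simp only: right_diff_distrib power2_eq_square times_divide_eq_right)
        also have "q * ((1 - \<delta>) * ((1 - \<delta>) / (1 + \<delta>))) = (1 - \<delta>) * (A / real k * ((B - C) / ((1 + \<delta>) * L2)))"
          unfolding e q_def by (simp add: mult_ac)
        also have "q * (4 * \<delta> * (1 + \<delta>)) = 4 * \<delta> * Vb k"
          unfolding Vb_def e q_def by (simp add: mult_ac)
        finally show ?thesis .
      qed
      moreover have "(1 - \<delta>) * (A / real k * ((B - C) / ((1 + \<delta>) * L2))) \<le> (1 - \<delta>) * (\<Sum>p\<in>Q k. v p)"
        using \<delta> by (intro mult_left_mono sum_v_ge[OF k]) auto
      moreover have "g k = (1 - \<delta>) * (\<Sum>p\<in>Q k. v p) - 4 * \<delta> * Vb k - \<delta> - 2"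
        unfolding g_def by (simp add: algebra_simps)
      ultimately show "(A * B / L2) * G * inverse (real k) - 3 \<le> g k" using \<delta> by linarith
    qed
    finally have 1: "(A * B / L2) * G * harm K - 3 * K \<le> (\<Sum>k=1..K. g k)" .
    have "(1 - \<delta>) * L3 \<le> harm K"
    proof -
      have "ln (real K) \<le> ln (real K + 1)" using e4 by simp
      also have "\<dots> \<le> harm K" by (rule ln_le_harm)
      finally show ?thesis using e4 by linarith
    qed
    hence "(A * B / L2) * G * ((1 - \<delta>) * L3) \<le> (A * B / L2) * G * harm K"
      using g0 A0 B4 L2 unfolding G_def[symmetric] by (intro mult_left_mono) auto
    thus ?thesis using 1 e9 KL2 unfolding G_def by linarith
  qed
  define f where "f = (\<lambda>m. \<Prod>p\<in>prime_factors m. w p)"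
  obtain I E where IE: "finite I" "0 \<notin> I" "1 \<in> I"
      "real (card I) \<le> (\<Prod>k=1..K. (1 + y k) ^ card (Q k) / y k ^ (t k + s k))"
      "\<And>k m. (k, m) \<in> E \<Longrightarrow> k > 0 \<and> m \<in> I \<and> k * m \<in> I \<and> real k \<le> (\<Prod>j=1..K. x (Suc j) ^ t j)"
      "exp (\<Sum>k=1..K. g k) * (\<Sum>m\<in>I. (f m)\<^sup>2) \<le> (\<Sum>(k,m)\<in>E. 1 / sqrt (real k) * (f m * f (k * m)))"
  proof (rule prime_resonator[of K Q w y "\<lambda>k. x (Suc k)" g t s])
    show "Q j \<inter> Q k = {}" if "j \<noteq> k" for j k using that by (rule disjQ)
    show "0 < y k \<and> y k \<le> 1" for k using W0[of k] unfolding y_def by simp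
    show "exp (g k) * (\<Prod>p\<in>Q k. 1 + (w p)\<^sup>2) \<le>
      (\<Sum>(T,S)\<in>block_pairs (Q k) (t k) (s k). (\<Prod>p\<in>T. w p / sqrt (real p)) * (\<Prod>p\<in>S. (w p)\<^sup>2))"
      if "k \<in> {1..K}" for k using block[OF that] unfolding u_def v_def .
    show "x (Suc k) \<ge> 1" for k using x1[of "Suc k"] x0 by linarith
  qed (use finQ w0 that in \<open>auto simp: Q_def f_def\<close>)
  have f0: "f m \<ge> 0" for m unfolding f_def using w0 by (intro prod_nonneg) auto
  have D: "(\<Sum>m\<in>I. (f m)\<^sup>2) > 0"
  proof -
    have "f 1 = 1" unfolding f_def by simp
    hence "1 \<le> (\<Sum>m\<in>I. (f m)\<^sup>2)" using member_le_sum[OF IE(3), of "\<lambda>m. (f m)\<^sup>2"] IE(1) by simp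
    thus ?thesis by linarith
  qed
  have "exp (c * sqrt (L1 * L3 / L2)) * (\<Sum>m\<in>I. (f m)\<^sup>2) \<le> exp (\<Sum>k=1..K. g k) * (\<Sum>m\<in>I. (f m)\<^sup>2)"
    using gain D by (intro mult_right_mono) auto
  also note IE(6)
  finally have fin_ineq: "exp (c * sqrt (L1 * L3 / L2)) * (\<Sum>m\<in>I. (f m)\<^sup>2) \<le> (\<Sum>(k,m)\<in>E. 1 / sqrt (real k) * (f m * f (k * m)))" .
  show ?thesis
  proof (intro exI[of _ f] exI[of _ I] exI[of _ E] conjI allI)
    show "\<forall>(k, m)\<in>E. 0 < k \<and> m \<in> I \<and> k * m \<in> I \<and> real k \<le> exp L1"
      using IE(5) size_bound by (fast intro: order_trans)
    show "real (card I) \<le> exp (\<theta> * L1)" using IE(4) card_bound by linarith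
  qed (use IE f0 D fin_ineq in auto)
qed

text \<open>At \<delta> = 0 the conditions reduce to c < sqrt \<kappa> and \<kappa> < \<theta>,
  which c^2 < \<theta> allows; right continuity at 0 supplies a positive \<delta>.\<close>

lemma resonator_parameters:
  fixes c \<theta> :: real
  assumes "0 < c" "c\<^sup>2 < \<theta>"
  obtains \<kappa> \<delta> where "\<kappa> > 0" "0 < \<delta>" "\<delta> \<le> 1/4" "(1 + \<delta>) ^ 3 * \<kappa> < \<theta>"
    "(1 - \<delta>)\<^sup>2 / (1 + \<delta>) - 4 * \<delta> * (1 + \<delta>) \<ge> 0"
    "c < sqrt \<kappa> * ((1 - \<delta>)\<^sup>2 / (1 + \<delta>) - 4 * \<delta> * (1 + \<delta>)) * (1 - \<delta>)"
proof -
  obtain \<kappa> where \<kappa>: "c\<^sup>2 < \<kappa>" "\<kappa> < \<theta>" using dense[OF assms(2)] by blast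
  have \<kappa>0: "\<kappa> > 0" using \<kappa>(1) zero_le_power2[of c] by linarith
  have c: "c < sqrt \<kappa>" using \<kappa>(1) by (rule real_less_rsqrt)
  have "((\<lambda>\<delta>. (1 + \<delta>) ^ 3 * \<kappa>) \<longlongrightarrow> (1 + 0) ^ 3 * \<kappa>) (at_right 0)"
    by (intro tendsto_intros)
  hence 1: "eventually (\<lambda>\<delta>. (1 + \<delta>) ^ 3 * \<kappa> < \<theta>) (at_right 0)"
    using \<kappa> by (intro order_tendstoD(2)) auto
  have "((\<lambda>\<delta>. sqrt \<kappa> * ((1 - \<delta>)\<^sup>2 / (1 + \<delta>) - 4 * \<delta> * (1 + \<delta>)) * (1 - \<delta>)) \<longlongrightarrow>
      sqrt \<kappa> * ((1 - 0)\<^sup>2 / (1 + 0) - 4 * 0 * (1 + 0)) * (1 - 0)) (at_right 0)"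
    by (intro tendsto_intros) auto
  hence 2: "eventually (\<lambda>\<delta>. c < sqrt \<kappa> * ((1 - \<delta>)\<^sup>2 / (1 + \<delta>) - 4 * \<delta> * (1 + \<delta>)) * (1 - \<delta>)) (at_right 0)"
    using c by (intro order_tendstoD(1)) auto
  have 3: "eventually (\<lambda>\<delta>::real. \<delta> \<in> {0<..<1/4}) (at_right 0)"
    by (rule eventually_at_right_real) simp
  have "eventually (\<lambda>\<delta>. (1 + \<delta>) ^ 3 * \<kappa> < \<theta> \<and>
     c < sqrt \<kappa> * ((1 - \<delta>)\<^sup>2 / (1 + \<delta>) - 4 * \<delta> * (1 + \<delta>)) * (1 - \<delta>) \<and> \<delta> \<in> {0<..<1/4}) (at_right 0)"
    using 1 2 3 by eventually_elim blast
  then obtain \<delta> where \<delta>: "(1 + \<delta>) ^ 3 * \<kappa> < \<theta>"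
     "c < sqrt \<kappa> * ((1 - \<delta>)\<^sup>2 / (1 + \<delta>) - 4 * \<delta> * (1 + \<delta>)) * (1 - \<delta>)" "\<delta> \<in> {0<..<1/4}"
    using eventually_happens'[OF trivial_limit_at_right_real] by blast
  have "(1 - \<delta>)\<^sup>2 / (1 + \<delta>) - 4 * \<delta> * (1 + \<delta>) \<ge> 0"
  proof (rule ccontr)
    assume "\<not> ?thesis"
    hence "sqrt \<kappa> * ((1 - \<delta>)\<^sup>2 / (1 + \<delta>) - 4 * \<delta> * (1 + \<delta>)) * (1 - \<delta>) \<le> 0"
      using \<kappa>0 \<delta>(3) by (intro mult_nonpos_nonneg mult_nonneg_nonpos) auto
    thus False using \<delta>(2) assms(1) by linarith
  qed
  thus ?thesis using that[of \<kappa> \<delta>] \<kappa>0 \<delta> by auto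
qed

text \<open>This is the rate in the Chernoff bound at a = 1 + \<delta>. It is positive because ln z
  < z - 1 strictly at z = 1 / (1 + \<delta>).\<close>

lemma entropy_pos:
  fixes \<delta> :: real
  assumes "\<delta> > 0"
  shows "(1 + \<delta>) * ln (1 + \<delta>) - (1 + \<delta>) + 1 > 0"
proof -
  have "ln (1 / (1 + \<delta>)) \<le> 1 / (1 + \<delta>) - 1" using assms by (intro ln_le_minus_one) auto
  moreover have "ln (1 / (1 + \<delta>)) \<noteq> 1 / (1 + \<delta>) - 1"
    using assms ln_eq_minus_one[of "1 / (1 + \<delta>)"] by auto
  ultimately have "ln (1 / (1 + \<delta>)) < 1 / (1 + \<delta>) - 1" by linarith
  hence "ln (1 + \<delta>) > 1 - 1 / (1 + \<delta>)" using assms by (simp add: ln_div)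
  hence "(1 + \<delta>) * ln (1 + \<delta>) > (1 + \<delta>) * (1 - 1 / (1 + \<delta>))" using assms by (intro mult_strict_left_mono) auto
  also have "(1 + \<delta>) * (1 - 1 / (1 + \<delta>)) = \<delta>" using assms by (simp add: field_simps)
  finally show ?thesis by simp
qed

text \<open>Only the product of x / ln ln x with the inner ln ln x has order x, with coefficient c2
  c3. The rest is o(x), and its three parts share the margin \<theta> - c2 c3 equally.\<close>

lemma card_exponent_asymptotics:
  fixes c1 c2 c3 c4 c5 c6 \<theta> :: real
  assumes "c1 > 0" "c2 > 0" "c3 > 0" "c4 > 0" "c5 > 0" "c6 > 0" "c2 * c3 < \<theta>"
  shows "eventually (\<lambda>x. x * c1 / ln (ln x) + c2 * (x / ln (ln x)) * (c3 * (1 + ln (ln x)) + 2 * (c4 + ln (ln (ln x)))) +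
     ln x * ((c5 * (sqrt (x * ln x / ln (ln x)) / ln x) + 2) * (c6 * (ln x + 1) + ln (ln (ln x)))) \<le> \<theta> * x) at_top"
proof -
  define d where "d = (\<theta> - c2 * c3) / 3"
  have d: "d > 0" using assms unfolding d_def by simp
  have 1: "eventually (\<lambda>x. x * c1 / ln (ln x) \<le> d * x) at_top" using assms d by real_asymp
  have 2: "eventually (\<lambda>x. c2 * (x / ln (ln x)) * (c3 + 2 * (c4 + ln (ln (ln x)))) \<le> d * x) at_top"
    using assms d by real_asymp
  have 3: "eventually (\<lambda>x. ln x * ((c5 * (sqrt (x * ln x / ln (ln x)) / ln x) + 2) * (c6 * (ln x + 1) + ln (ln (ln x)))) \<le> d * x) at_top"
    using assms d by real_asymp
  have 4: "eventually (\<lambda>x::real. ln (ln x) > 0) at_top" by real_asymp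
  show ?thesis using 1 2 3 4
  proof eventually_elim
    case (elim x)
    have "c2 * (x / ln (ln x)) * (c3 * (1 + ln (ln x)) + 2 * (c4 + ln (ln (ln x)))) =
        c2 * (x / ln (ln x)) * (c3 + 2 * (c4 + ln (ln (ln x)))) + c2 * c3 * x"
      using elim(4) by (simp add: field_simps)
    moreover have "\<theta> * x = d * x + d * x + d * x + c2 * c3 * x" unfolding d_def by (simp add: field_simps)
    ultimately show ?case using elim by linarith
  qed
qed

lemma resonator_exists:
  fixes c \<theta> :: real
  assumes c: "0 < c" "c\<^sup>2 < \<theta>"
  shows "eventually (\<lambda>x. \<exists>(f :: nat \<Rightarrow> real) I E. finite I \<and> 0 \<notin> I \<and> (\<forall>m. f m \<ge> 0) \<and> (\<Sum>m\<in>I. (f m)\<^sup>2) > 0 \<and>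
     real (card I) \<le> exp (\<theta> * x) \<and>
     (\<forall>(k, m)\<in>E. 0 < k \<and> m \<in> I \<and> k * m \<in> I \<and> real k \<le> exp x) \<and>
     exp (c * sqrt (x * ln (ln x) / ln x)) * (\<Sum>m\<in>I. (f m)\<^sup>2) \<le>
       (\<Sum>(k,m)\<in>E. 1 / sqrt (real k) * (f m * f (k * m)))) at_top"
proof -
  obtain \<kappa> \<delta> where p: "\<kappa> > 0" "0 < \<delta>" "\<delta> \<le> 1/4" "(1 + \<delta>) ^ 3 * \<kappa> < \<theta>"
    "(1 - \<delta>)\<^sup>2 / (1 + \<delta>) - 4 * \<delta> * (1 + \<delta>) \<ge> 0"
    "c < sqrt \<kappa> * ((1 - \<delta>)\<^sup>2 / (1 + \<delta>) - 4 * \<delta> * (1 + \<delta>)) * (1 - \<delta>)"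
    using resonator_parameters[OF c] by blast
  obtain C where C: "C \<ge> 1" "\<And>x y. 1 \<le> x \<Longrightarrow> x \<le> y \<Longrightarrow>
      \<bar>(\<Sum>p | prime p \<and> x < real p \<and> real p \<le> y. ln (real p) / real p) - ln (y / x)\<bar> \<le> C"
    using mertens_first by blast
  \<comment> \<open>The blocks are long enough for the Mertens error \<open>C\<close> to be the
    fraction \<delta> of their logarithmic length.\<close>
  define B where "B = C / \<delta>"
  define G where "G = (1 - \<delta>)\<^sup>2 / (1 + \<delta>) - 4 * \<delta> * (1 + \<delta>)"
  define a where "a = sqrt \<kappa> / B"
  define A where "A = (\<lambda>x. sqrt (\<kappa> * x * ln x / ln (ln x)) / B)"
  have B0: "B > 0" unfolding B_def using C p by simp
  have CB: "C = \<delta> * B" unfolding B_def using p by simp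
  have BC: "B - C > 0" "B + C > 0" unfolding CB using B0 p by (auto simp: algebra_simps mult_less_cancel_right1 add_pos_pos)
  have a0: "a > 0" unfolding a_def using p B0 by simp
  have A_eq: "A x = a * sqrt (x * ln x / ln (ln x))" for x
    unfolding A_def a_def by (simp add: real_sqrt_mult real_sqrt_divide mult_ac)
  define r where "r = \<delta> / (2 * B)"
  have r0: "r > 0" unfolding r_def using p B0 by simp
  have ev1: "eventually (\<lambda>x::real. x \<ge> 1) at_top" by (rule eventually_ge_at_top)
  have ev2: "eventually (\<lambda>x::real. ln x \<ge> 1) at_top" by real_asymp
  have ev3: "eventually (\<lambda>x::real. ln (ln x) \<ge> 1) at_top" by real_asymp
  have ev4: "eventually (\<lambda>x. ln (ln x) + B \<le> \<delta> * ln x / 2) at_top" using p by real_asymp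
  have ev5: "eventually (\<lambda>x. \<kappa> / (B\<^sup>2 * ln (ln x)) \<le> \<delta>) at_top" using p B0 by real_asymp
  have ev6: "eventually (\<lambda>x. A x / (x * ln x) \<le> \<delta>) at_top" unfolding A_eq using a0 p by real_asymp
  have ev7: "eventually (\<lambda>x. r * ln x \<ge> 2) at_top" using r0 by real_asymp
  have ev8: "eventually (\<lambda>x. (1 - \<delta>) * ln (ln x) \<le> ln (r * ln x - 1)) at_top" using r0 p by real_asymp
  define a1 where "a1 = a * (B - C) / (1 + \<delta>)"
  have a1: "a1 > 0" unfolding a1_def using a0 BC p by simp
  have "eventually (\<lambda>x. a1 * sqrt (x * ln x / ln (ln x)) / (ln x)\<^sup>2 \<ge> 1) at_top" using a1 by real_asymp
  hence ev9: "eventually (\<lambda>x. A x * (B - C) / ((1 + \<delta>) * (ln x)\<^sup>2) \<ge> 1) at_top"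
    unfolding A_eq a1_def by eventually_elim (simp add: field_simps)
  define h where "h = ((1 + \<delta>) * ln (1 + \<delta>) - (1 + \<delta>) + 1) * (a\<^sup>2 * (B + C))"
  have h0: "h > 0" unfolding h_def using entropy_pos[OF p(2)] a0 BC by simp
  have A2: "(A x)\<^sup>2 = a\<^sup>2 * (x * ln x / ln (ln x))" if "x \<ge> 1" "ln x \<ge> 1" "ln (ln x) \<ge> 1" for x
    unfolding A_eq power_mult_distrib using that by simp
  have "eventually (\<lambda>x. h * (x * ln x / ln (ln x)) / (ln x) ^ 3 \<ge> 1) at_top" using h0 by real_asymp
  hence ev10: "eventually (\<lambda>x. ((1 + \<delta>) * ln (1 + \<delta>) - (1 + \<delta>) + 1) * ((A x)\<^sup>2 * (B + C) / ln x ^ 3) \<ge> 1) at_top"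
    using ev1 ev2 ev3
  proof eventually_elim
    case (elim x)
    have "((1 + \<delta>) * ln (1 + \<delta>) - (1 + \<delta>) + 1) * ((A x)\<^sup>2 * (B + C) / ln x ^ 3) = h * (x * ln x / ln (ln x)) / (ln x) ^ 3"
      unfolding A2[OF elim(2-4)] h_def by simp
    thus ?case using elim(1) by simp
  qed
  define c2 where "c2 = (1 + \<delta>) * a\<^sup>2 * (B + C)"
  \<comment> \<open>The block length cancels, so the leading coefficient of the cardinality exponent
    depends on \<kappa> and \<delta> alone.\<close>
  have "c2 * (B * (1 + \<delta>)) = (1 + \<delta>) ^ 3 * \<kappa>"
  proof -
    have "a\<^sup>2 * (B + C) * B = (1 + \<delta>) * \<kappa>"
      unfolding CB a_def using p B0 by (simp add: power_divide field_simps power2_eq_square)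
    hence "c2 * (B * (1 + \<delta>)) = (1 + \<delta>)\<^sup>2 * ((1 + \<delta>) * \<kappa>)"
      unfolding c2_def by (metis (no_types, opaque_lifting) mult.assoc mult.commute power2_eq_square)
    thus ?thesis by (simp add: power3_eq_cube power2_eq_square)
  qed
  hence c2: "c2 * (B * (1 + \<delta>)) < \<theta>" using p by simp
  have ev11: "eventually (\<lambda>x. x * (B + C) / ln (ln x) +
      (1 + \<delta>) * ((A x)\<^sup>2 * (B + C) / ln x) * (B * (1 + \<delta>) * (1 + ln (ln x)) + 2 * (B * (1 + \<delta>) + ln (ln (ln x))))
       + ln x * ((4 * (A x * (B + C) / ln x) + 2) * (B * (1 + \<delta>) * (ln x + 1) + ln (ln (ln x)))) \<le> \<theta> * x) at_top"
  proof -
    have "eventually (\<lambda>x. x * (B + C) / ln (ln x) +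
      c2 * (x / ln (ln x)) * (B * (1 + \<delta>) * (1 + ln (ln x)) + 2 * (B * (1 + \<delta>) + ln (ln (ln x))))
       + ln x * ((4 * a * (B + C) * (sqrt (x * ln x / ln (ln x)) / ln x) + 2) * (B * (1 + \<delta>) * (ln x + 1) + ln (ln (ln x)))) \<le> \<theta> * x) at_top"
      using BC B0 p a0 c2 unfolding c2_def by (intro card_exponent_asymptotics) auto
    thus ?thesis using ev1 ev2 ev3
    proof eventually_elim
      case (elim x)
      have e1: "(1 + \<delta>) * ((A x)\<^sup>2 * (B + C) / ln x) = c2 * (x / ln (ln x))"
        unfolding A2[OF elim(2-4)] c2_def using elim by simp
      have e2: "4 * (A x * (B + C) / ln x) = 4 * a * (B + C) * (sqrt (x * ln x / ln (ln x)) / ln x)"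
        unfolding A_eq by simp
      show ?case unfolding e1 e2 by (rule elim(1))
    qed
  qed
  have ev12: "eventually (\<lambda>x. ln x * ((4 * (A x * (B + C) / ln x) + 1) * (2 * ln x)) \<le> x) at_top"
  proof -
    define b where "b = 4 * a * (B + C)"
    have "b > 0" unfolding b_def using a0 BC by simp
    hence "eventually (\<lambda>x. ln x * ((b * sqrt (x * ln x / ln (ln x)) / ln x + 1) * (2 * ln x)) \<le> x) at_top"
      by real_asymp
    moreover have "4 * (A x * (B + C) / ln x) = b * sqrt (x * ln x / ln (ln x)) / ln x" for x
      unfolding A_eq b_def by simp
    ultimately show ?thesis by (simp only:)
  qed
  define d where "d = sqrt \<kappa> * G * (1 - \<delta>) - c"
  have d: "d > 0" unfolding d_def G_def using p by simp
  have "eventually (\<lambda>x. d * sqrt (x * ln (ln x) / ln x) \<ge> 3 * ln x) at_top" using d by real_asymp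
  hence ev13: "eventually (\<lambda>x. c * sqrt (x * ln (ln x) / ln x) \<le> (A x * B / ln x) * G * ((1 - \<delta>) * ln (ln x)) - 3 * ln x) at_top"
    using ev1 ev2 ev3
  proof eventually_elim
    case (elim x)
    have "sqrt (x * ln x / ln (ln x)) / ln x * ln (ln x) = sqrt (x * ln (ln x) / ln x)"
    proof (rule real_sqrt_unique[symmetric])
      have "(sqrt (x * ln x / ln (ln x)) / ln x * ln (ln x))\<^sup>2 = (x * ln x / ln (ln x)) / (ln x)\<^sup>2 * (ln (ln x))\<^sup>2"
        unfolding power_mult_distrib power_divide using elim by simp
      also have "\<dots> = x * ln (ln x) / ln x" using elim by (simp add: power2_eq_square)
      finally show "(sqrt (x * ln x / ln (ln x)) / ln x * ln (ln x))\<^sup>2 = x * ln (ln x) / ln x" .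
      show "sqrt (x * ln x / ln (ln x)) / ln x * ln (ln x) \<ge> 0" using elim by auto
    qed
    moreover have "(A x * B / ln x) * G * ((1 - \<delta>) * ln (ln x)) =
        sqrt \<kappa> * G * (1 - \<delta>) * (sqrt (x * ln x / ln (ln x)) / ln x * ln (ln x))"
      unfolding A_eq a_def using B0 by simp
    ultimately have "(A x * B / ln x) * G * ((1 - \<delta>) * ln (ln x)) = (d + c) * sqrt (x * ln (ln x) / ln x)"
      unfolding d_def by simp
    thus ?case using elim(1) by (simp add: algebra_simps)
  qed
  show ?thesis
    using ev1 ev2 ev3 ev4 ev5 ev6 ev7 ev8 ev9 ev10 ev11 ev12 ev13
  proof eventually_elim
    case (elim x)
    have rl: "\<delta> * ln x / (2 * B) = r * ln x" unfolding r_def by simp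
    define k where "k = nat \<lfloor>\<delta> * ln x / (2 * B)\<rfloor>"
    have K: "real k \<ge> r * ln x - 1" unfolding k_def rl by linarith
    have K1: "k \<ge> 1" using K elim(7) by linarith
    have "ln (r * ln x - 1) \<le> ln (real k)"
      using K elim(7) by (subst ln_le_cancel_iff) auto
    hence K2: "(1 - \<delta>) * ln (ln x) \<le> ln (real k)" using elim(8) by linarith
    note K12 = K1[unfolded k_def] K2[unfolded k_def]
    show ?case
      by (rule resonator_at[where C = C and \<delta> = \<delta> and B = B and \<kappa> = \<kappa>])
        (use C p elim K12 B_def in \<open>simp_all add: A_def G_def\<close>)
  qed
qed

section \<open>Large values of zeta\<close>

text \<open>For K > 1 + 1/\<epsilon> the exponent (1 + \<epsilon>)(K - 1) exceeds K, so the right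
  side eventually wins. This is the truncation condition for all heights up to \<alpha> h and all
  lengths from h^(1 + \<epsilon>) on.\<close>

lemma zeta_approx_condition:
  fixes \<alpha> \<epsilon> :: real
  assumes "\<alpha> > 0" "\<epsilon> > 0"
  obtains K :: nat where "K \<ge> 2" "eventually (\<lambda>h::real. (1/2 + \<alpha> * h + real K) ^ K \<le> (h powr (1 + \<epsilon>)) ^ (K - 1)) at_top"
proof -
  define K where "K = nat \<lceil>1 / \<epsilon>\<rceil> + 2"
  have K2: "K \<ge> 2" unfolding K_def by simp
  have "real K > 1 + 1 / \<epsilon>" unfolding K_def by linarith
  hence "\<epsilon> * real K > \<epsilon> + 1" using assms by (simp add: field_simps)
  define \<eta> where "\<eta> = (1 + \<epsilon>) * (real K - 1) - real K"
  have \<eta>: "\<eta> > 0" unfolding \<eta>_def using \<open>\<epsilon> * real K > \<epsilon> + 1\<close> by (simp add: algebra_simps)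
  have "eventually (\<lambda>h::real. h powr \<eta> \<ge> (\<alpha> + 1) ^ K) at_top" using \<eta> by real_asymp
  moreover have "eventually (\<lambda>h::real. h \<ge> real K + 1) at_top" by (rule eventually_ge_at_top)
  ultimately have "eventually (\<lambda>h::real. (1/2 + \<alpha> * h + real K) ^ K \<le> (h powr (1 + \<epsilon>)) ^ (K - 1)) at_top"
  proof eventually_elim
    case (elim h)
    have h: "h > 0" using elim(2) by linarith
    have "(1/2 + \<alpha> * h + real K) ^ K \<le> ((\<alpha> + 1) * h) ^ K"
      using elim(2) assms h by (intro power_mono) (auto simp: algebra_simps)
    also have "\<dots> = (\<alpha> + 1) ^ K * h powr real K" using h by (simp add: power_mult_distrib powr_realpow)
    also have "\<dots> \<le> h powr \<eta> * h powr real K" by (intro mult_right_mono elim(1)) auto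
    also have "\<dots> = h powr ((1 + \<epsilon>) * (real K - 1))" unfolding \<eta>_def by (simp flip: powr_add)
    also have "\<dots> = (h powr (1 + \<epsilon>)) ^ (K - 1)"
      using K2 h by (simp add: powr_powr[symmetric] powr_realpow[symmetric] of_nat_diff)
    finally show ?case .
  qed
  thus ?thesis using that K2 by blast
qed

lemma zeta_sums_approx_eventually:
  fixes \<alpha> \<epsilon> :: real
  assumes \<alpha>: "\<alpha> > 0" and \<epsilon>: "\<epsilon> > 0"
  shows "eventually (\<lambda>h::real. \<forall>(l::nat) (Y::nat). 1 \<le> l \<longrightarrow> real l \<le> h \<longrightarrow> h powr (1 + \<epsilon>) \<le> real Y \<longrightarrow>
    norm (zeta_sum Y (Complex (1/2) (\<alpha> * l)) - riemann_zeta (Complex (1/2) (\<alpha> * l))) \<le> zeta_error + sqrt Y / (\<alpha> * l) \<and>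
    norm (zeta_smooth_sum Y (Complex (1/2) (\<alpha> * l)) - riemann_zeta (Complex (1/2) (\<alpha> * l))) \<le>
      zeta_error + 1 + 8 * sqrt Y / (\<alpha> * l)\<^sup>2) at_top"
proof -
  obtain K :: nat where K: "K \<ge> 2"
    "eventually (\<lambda>h::real. (1/2 + \<alpha> * h + real K) ^ K \<le> (h powr (1 + \<epsilon>)) ^ (K - 1)) at_top"
    using zeta_approx_condition[OF \<alpha> \<epsilon>] by blast
  show ?thesis using K(2)
  proof eventually_elim
    case (elim h)
    show ?case
    proof (intro allI impI)
      fix l Y :: nat assume l: "1 \<le> l" "real l \<le> h" and Y: "h powr (1 + \<epsilon>) \<le> real Y"
      define s where "s = Complex (1/2) (\<alpha> * l)"
      have s: "Re s = 1/2" "Im s = \<alpha> * l" unfolding s_def by auto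
      have Im0: "Im s > 0" unfolding s using \<alpha> l by simp
      have "norm s \<le> 1/2 + \<alpha> * l" using cmod_le[of s] Im0 unfolding s by simp
      also have "\<dots> \<le> 1/2 + \<alpha> * h" using \<alpha> l by simp
      finally have "(norm s + K) ^ K \<le> (1/2 + \<alpha> * h + K) ^ K" by (intro power_mono) auto
      also note elim
      also have "(h powr (1 + \<epsilon>)) ^ (K - 1) \<le> real Y ^ (K - 1)" using Y by (intro power_mono) auto
      finally have cond: "(norm s + K) ^ K \<le> real Y ^ (K - 1)" .
      have "norm (of_nat Y powr (1 - s) / (1 - s)) \<le> sqrt Y / (\<alpha> * l)"
      proof -
        have eq: "norm (of_nat Y powr (1 - s)) = sqrt Y"
          using norm_powr_real_powr[of "of_nat Y" "1 - s"] s by (cases "Y = 0") (auto simp: powr_half_sqrt)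
        have ge: "norm (1 - s) \<ge> \<alpha> * l" using abs_Im_le_cmod[of "1 - s"] Im0 s by simp
        have pos: "\<alpha> * l > 0" using Im0 s by simp
        have "norm (1 - s) > 0" using ge pos by linarith
        hence "sqrt Y / norm (1 - s) \<le> sqrt Y / (\<alpha> * l)"
          by (intro divide_left_mono[OF ge] mult_pos_pos[OF _ pos]) simp_all
        thus ?thesis by (simp only: norm_divide eq)
      qed
      hence "norm (zeta_sum Y s - riemann_zeta s) \<le> zeta_error + sqrt Y / (\<alpha> * l)"
        using zeta_sum_approx[OF s(1) K(1) cond]
          norm_triangle_sub[of "zeta_sum Y s - riemann_zeta s" "of_nat Y powr (1 - s) / (1 - s)"] by linarith
      moreover have "norm (zeta_smooth_sum Y s - riemann_zeta s) \<le> zeta_error + 1 + 8 * sqrt Y / (\<alpha> * l)\<^sup>2"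
        using zeta_smooth_sum_approx[OF s(1) less_imp_neq[OF Im0, symmetric] K(1) cond] unfolding s(2) .
      ultimately show "norm (zeta_sum Y (Complex (1/2) (\<alpha> * l)) - riemann_zeta (Complex (1/2) (\<alpha> * l))) \<le> zeta_error + sqrt Y / (\<alpha> * l) \<and>
        norm (zeta_smooth_sum Y (Complex (1/2) (\<alpha> * l)) - riemann_zeta (Complex (1/2) (\<alpha> * l))) \<le>
        zeta_error + 1 + 8 * sqrt Y / (\<alpha> * l)\<^sup>2" unfolding s_def by blast
    qed
  qed
qed

text \<open>The coefficient of \<open>k\<close> in the averaged sum: 1 / sqrt k up to
  \<open>X\<close>, then multiplied by a factor falling linearly to 0 at \<open>2 * X\<close>.
  Multipliers up to N \<le> X thus carry the unsmoothed weight.\<close>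

definition smooth_weight :: "nat \<Rightarrow> nat \<Rightarrow> real" where
  "smooth_weight X k = (\<Sum>Y=X..<2*X. if k \<le> Y then 1 else 0) / real X / sqrt (real k)"

lemma smooth_weight_nonneg: "smooth_weight X k \<ge> 0"
  unfolding smooth_weight_def by (intro divide_nonneg_nonneg sum_nonneg) auto

lemma smooth_weight_eq: "X > 0 \<Longrightarrow> k \<le> X \<Longrightarrow> smooth_weight X k = 1 / sqrt (real k)"
  unfolding smooth_weight_def by simp

lemma zeta_smooth_sum_eq:
  "zeta_smooth_sum X (Complex (1/2) (\<alpha> * real l)) =
    (\<Sum>k\<in>{1..2*X}. of_real (smooth_weight X k) * cis (- (of_int (int l) * (\<alpha> * ln (real k)))))"
proof -
  let ?e = "\<lambda>k. of_real (1 / sqrt (real k)) * cis (- (of_int (int l) * (\<alpha> * ln (real k))))"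
  have "zeta_sum Y (Complex (1/2) (\<alpha> * real l)) = (\<Sum>k\<in>{1..2*X}. of_real (if k \<le> Y then 1 else 0) * ?e k)"
    if "Y \<in> {X..<2*X}" for Y
  proof -
    have "zeta_sum Y (Complex (1/2) (\<alpha> * real l)) = (\<Sum>k\<in>{1..Y}. ?e k)"
      unfolding zeta_sum_def by (intro sum.cong refl, subst of_nat_powr_critical_line) (auto simp: mult_ac)
    also have "\<dots> = (\<Sum>k\<in>{1..2*X}. of_real (if k \<le> Y then 1 else 0) * ?e k)"
      using that by (intro sum.mono_neutral_cong_left) auto
    finally show ?thesis .
  qed
  hence "zeta_smooth_sum X (Complex (1/2) (\<alpha> * real l)) =
      (\<Sum>Y=X..<2*X. \<Sum>k\<in>{1..2*X}. of_real (if k \<le> Y then 1 else 0) * ?e k) / of_nat X"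
    unfolding zeta_smooth_sum_def by simp
  also have "\<dots> = (\<Sum>k\<in>{1..2*X}. of_real (\<Sum>Y=X..<2*X. if k \<le> Y then 1 else 0) * ?e k) / of_nat X"
    by (subst sum.swap) (simp only: of_real_sum sum_distrib_right)
  also have "\<dots> = (\<Sum>k\<in>{1..2*X}. of_real (smooth_weight X k) * cis (- (of_int (int l) * (\<alpha> * ln (real k)))))"
  proof (subst sum_divide_distrib, rule sum.cong[OF refl])
    fix k
    define q :: real where "q = (\<Sum>Y=X..<2*X. if k \<le> Y then 1 else 0)"
    show "of_real (\<Sum>Y=X..<2*X. if k \<le> Y then 1 else 0) * ?e k / of_nat X =
        of_real (smooth_weight X k) * cis (- (of_int (int l) * (\<alpha> * ln (real k))))"
      unfolding smooth_weight_def q_def[symmetric] by simp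
  qed
  finally show ?thesis .
qed

lemma sum_inverse_sqrt_le: "(\<Sum>k=1..n. 1 / sqrt (real k)) \<le> 2 * sqrt (real n)"
proof (induction n)
  case (Suc n)
  have "(sqrt (real (Suc n)) - sqrt (real n)) * (sqrt (real (Suc n)) + sqrt (real n)) = 1"
    by (simp add: algebra_simps)
  moreover have "sqrt (real (Suc n)) + sqrt (real n) \<le> 2 * sqrt (real (Suc n))" by simp
  ultimately have "1 \<le> (sqrt (real (Suc n)) - sqrt (real n)) * (2 * sqrt (real (Suc n)))"
    using mult_left_mono[of "sqrt (real (Suc n)) + sqrt (real n)" "2 * sqrt (real (Suc n))" "sqrt (real (Suc n)) - sqrt (real n)"] by simp
  hence "1 / sqrt (real (Suc n)) \<le> 2 * (sqrt (real (Suc n)) - sqrt (real n))"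
    by (subst pos_divide_le_eq) (simp_all add: algebra_simps)
  thus ?case using Suc by simp
qed simp

text \<open>The approximation by zeta requires l \<ge> 1, so l = 0 is treated trivially; sqrt X is
  affordable within the short range.\<close>

lemma zeta_smooth_sum_at_0: "norm (zeta_smooth_sum X (Complex (1/2) 0)) \<le> 4 * sqrt X"
proof -
  have "norm (zeta_sum Y (Complex (1/2) 0)) \<le> 4 * sqrt X" if "Y \<le> 2 * X" for Y
  proof -
    have "norm (zeta_sum Y (Complex (1/2) 0)) \<le> (\<Sum>k=1..Y. 1 / sqrt (real k))"
      unfolding zeta_sum_def
      by (intro sum_norm_le, subst of_nat_powr_critical_line) (auto simp: norm_mult norm_divide)
    also have "\<dots> \<le> 2 * sqrt Y" by (rule sum_inverse_sqrt_le)
    also have "sqrt Y \<le> sqrt (4 * X)" using that by (intro real_sqrt_le_mono) linarith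
    also have "\<dots> = 2 * sqrt X" by (simp add: real_sqrt_mult)
    finally show ?thesis by simp
  qed
  hence "norm (\<Sum>Y=X..<2*X. zeta_sum Y (Complex (1/2) 0)) \<le> (\<Sum>Y=X..<2*X. 4 * sqrt X)"
    by (intro sum_norm_le) auto
  hence "norm (\<Sum>Y=X..<2*X. zeta_sum Y (Complex (1/2) 0)) \<le> 4 * sqrt X * real X" by (simp add: mult_ac)
  thus ?thesis unfolding zeta_smooth_sum_def
    by (cases "X = 0") (auto simp: norm_divide field_simps)
qed

text \<open>The sum of length \<open>X\<close> is replaced, through zeta, by a plain sum of length
  near T^(1/2 + \<epsilon>), which suffices at heights up to \<alpha> sqrt T; its mean square is
  then affordable. The polar terms add up to order sqrt X and sqrt Y log T, again within the
  bound.\<close>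

lemma zeta_smooth_sum_short_mean:
  fixes \<alpha> \<epsilon> :: real
  assumes \<alpha>: "\<alpha> > 0" and \<epsilon>: "0 < \<epsilon>" "\<epsilon> \<le> 1"
  shows "eventually (\<lambda>T::real. \<forall>(X::nat) (h::nat). T powr (1 + \<epsilon>) \<le> X \<longrightarrow> X \<le> 2 * T powr (1 + \<epsilon>) \<longrightarrow>
     h \<le> sqrt T + 1 \<longrightarrow> (\<Sum>l<h. norm (zeta_smooth_sum X (Complex (1/2) (\<alpha> * l)))) \<le> sqrt T * (T powr \<epsilon>)\<^sup>2) at_top"
proof -
  define Z where "Z = zeta_error"
  have Z0: "Z > 0" using zeta_error_ge unfolding Z_def by simp
  define D where "D = (\<lambda>T. 2 * (2 * \<alpha> * ln T + 1) * (2 + 16 / \<alpha> * (1 + 2 * ln T)) * (1 + 2 * ln T))"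
  have "filterlim (\<lambda>T::real. sqrt T) at_top at_top" by real_asymp
  from eventually_compose_filterlim[OF zeta_sums_approx_eventually[OF \<alpha> \<epsilon>(1)] this]
  have ev1: "eventually (\<lambda>T::real. \<forall>(l::nat) (Y::nat). 1 \<le> l \<longrightarrow> real l \<le> sqrt T \<longrightarrow> (sqrt T) powr (1 + \<epsilon>) \<le> real Y \<longrightarrow>
    norm (zeta_sum Y (Complex (1/2) (\<alpha> * l)) - riemann_zeta (Complex (1/2) (\<alpha> * l))) \<le> zeta_error + sqrt Y / (\<alpha> * l) \<and>
    norm (zeta_smooth_sum Y (Complex (1/2) (\<alpha> * l)) - riemann_zeta (Complex (1/2) (\<alpha> * l))) \<le>
      zeta_error + 1 + 8 * sqrt Y / (\<alpha> * l)\<^sup>2) at_top" .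
  \<comment> \<open>All constants and logarithms of the argument are collected here and absorbed by
    one factor T^\<epsilon>.\<close>
  have ev2: "eventually (\<lambda>T. D T + 2 * (2 * Z + 1) + 2 / \<alpha> * (1 + ln T) + 32 / \<alpha>\<^sup>2 + 8 \<le> T powr \<epsilon>) at_top"
    unfolding D_def using \<alpha> \<epsilon> Z0 by real_asymp
  have ev3: "eventually (\<lambda>T::real. T \<ge> 4) at_top" by (rule eventually_ge_at_top)
  show ?thesis using ev1 ev2 ev3
  proof eventually_elim
    case (elim T)
    have T: "T \<ge> 4" by (rule elim(3))
    define R where "R = T powr \<epsilon>"
    define q where "q = sqrt T"
    have q2: "q \<ge> 2" unfolding q_def by (rule real_le_rsqrt) (use T in simp)
    have qq: "q * q = T" unfolding q_def using T by simp
    have R1: "R \<ge> 1" unfolding R_def using T \<epsilon> by (intro ge_one_powr_ge_zero) auto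
    have RT: "R \<le> T" unfolding R_def using T \<epsilon> powr_mono[of \<epsilon> 1 T] by simp
    have TR: "T powr (1 + \<epsilon>) = T * R" unfolding R_def using T by (simp add: powr_add)
    have lnT: "ln T \<ge> 0" using T by simp
    show ?case
    proof (intro allI impI)
      fix X h :: nat
      assume X: "T powr (1 + \<epsilon>) \<le> X" "X \<le> 2 * T powr (1 + \<epsilon>)" and h: "h \<le> sqrt T + 1"
      have hq: "real h \<le> 2 * q" using h q2 unfolding q_def by linarith
      \<comment> \<open>This length is at least (sqrt T)^(1 + \<epsilon>), as the approximation at l
        \<le> sqrt T demands.\<close>
      define Y where "Y = nat \<lceil>q * R\<rceil>"
      have qR: "q * R \<ge> 2" using mult_mono[of 2 q 1 R] q2 R1 by simp
      have Y: "q * R \<le> Y" "Y \<le> 2 * (q * R)" unfolding Y_def using qR by linarith+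
      have Y0: "real Y \<ge> 1" using Y qR by linarith
      have sqX: "sqrt X \<le> 2 * (q * R)"
      proof (rule real_le_lsqrt)
        have "real X \<le> 2 * (T * R)" using X TR by simp
        also have "\<dots> \<le> 4 * (T * (R * R))" using R1 T mult_left_mono[of 1 R "T * R"] by simp
        also have "\<dots> = (2 * (q * R))\<^sup>2" unfolding qq[symmetric] by (simp add: power2_eq_square)
        finally show "real X \<le> (2 * (q * R))\<^sup>2" .
      qed (use qR in auto)
      have sqY: "sqrt Y \<le> 2 * (q * R)"
      proof -
        have "sqrt Y \<le> Y" using Y0 by (intro real_le_lsqrt) (auto simp: power2_eq_square)
        thus ?thesis using Y by linarith
      qed
      have cond: "q powr (1 + \<epsilon>) \<le> q * R" "q powr (1 + \<epsilon>) \<le> T * R"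
      proof -
        have "q powr (1 + \<epsilon>) = q * q powr \<epsilon>" using q2 by (simp add: powr_add)
        also have "\<dots> \<le> q * R" unfolding R_def using q2 \<epsilon> qq
          by (intro mult_left_mono powr_mono2) (auto simp flip: qq)
        finally show 1: "q powr (1 + \<epsilon>) \<le> q * R" .
        have "q * R \<le> T * R" unfolding qq[symmetric] using q2 R1 by (intro mult_right_mono) auto
        thus "q powr (1 + \<epsilon>) \<le> T * R" using 1 by linarith
      qed
      have lnY: "ln Y \<le> 2 * ln T"
      proof -
        have "real Y \<le> 2 * (q * R)" by (rule Y)
        also have "\<dots> \<le> q * (q * T)" using q2 R1 RT mult_mono[of 2 q "q * R" "q * T"] by simp
        also have "\<dots> = T\<^sup>2" unfolding qq[symmetric] by (simp add: power2_eq_square)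
        finally have "ln Y \<le> ln (T\<^sup>2)" using Y0 T by (subst ln_le_cancel_iff) auto
        thus ?thesis using T by (simp add: ln_realpow)
      qed
      have lnY0: "ln Y \<ge> 0" using Y0 by simp
      let ?P = "\<lambda>l::nat. norm (zeta_smooth_sum X (Complex (1/2) (\<alpha> * l)))"
      let ?S = "\<lambda>l::nat. norm (zeta_sum Y (Complex (1/2) (\<alpha> * l)))"
      have pt: "?P l \<le> ?S l + (2 * Z + 1) + sqrt Y / \<alpha> * inverse (real l) + 8 * sqrt X / \<alpha>\<^sup>2 * (1 / (real l)\<^sup>2)"
        if l: "l \<in> {1..<h}" for l
      proof -
        have lq: "1 \<le> l" "real l \<le> sqrt T" using l h by auto
        let ?z = "riemann_zeta (Complex (1/2) (\<alpha> * l))"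
        have cY: "sqrt T powr (1 + \<epsilon>) \<le> real Y" using cond(1) Y(1) unfolding q_def by linarith
        have cX: "sqrt T powr (1 + \<epsilon>) \<le> real X" using cond(2) X(1) unfolding q_def TR by linarith
        note approx = elim(1)[folded Z_def, rule_format, OF lq]
        have "norm (zeta_sum Y (Complex (1/2) (\<alpha> * l)) - ?z) \<le> Z + sqrt Y / (\<alpha> * l)"
          using approx[OF cY] by blast
        moreover have "norm (zeta_smooth_sum X (Complex (1/2) (\<alpha> * l)) - ?z) \<le> Z + 1 + 8 * sqrt X / (\<alpha> * l)\<^sup>2"
          using approx[OF cX] by blast
        moreover have "sqrt Y / (\<alpha> * l) = sqrt Y / \<alpha> * inverse (real l)" by (simp add: divide_inverse)
        moreover have "8 * sqrt X / (\<alpha> * l)\<^sup>2 = 8 * sqrt X / \<alpha>\<^sup>2 * (1 / (real l)\<^sup>2)" by (simp add: power_mult_distrib)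
        moreover have "norm ?z \<le> ?S l + norm (zeta_sum Y (Complex (1/2) (\<alpha> * l)) - ?z)"
          by (metis norm_minus_commute norm_triangle_sub)
        moreover have "?P l \<le> norm ?z + norm (zeta_smooth_sum X (Complex (1/2) (\<alpha> * l)) - ?z)"
          by (rule norm_triangle_sub)
        ultimately show ?thesis by linarith
      qed
      have sumS: "(\<Sum>l<h. ?S l) \<le> q * R * D T"
      proof (rule power2_le_imp_le)
        have D1: "D T \<ge> 1"
        proof -
          have "1 * 1 * 1 * 1 \<le> D T" unfolding D_def using \<alpha> lnT
            by (intro mult_mono) (auto intro!: add_increasing2 mult_nonneg_nonneg add_nonneg_nonneg divide_nonneg_nonneg)
          thus ?thesis by simp
        qed
        have "(\<Sum>l<h. ?S l)\<^sup>2 \<le> (\<Sum>l<h. (?S l)\<^sup>2) * card {..<h}"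
          by (rule sum_squared_le_sum_of_squares)
        also have "\<dots> = real h * (\<Sum>l<h. (?S l)\<^sup>2)" by simp
        also have "\<dots> \<le> (2 * q) * ((2 * \<alpha> * ln T + 1) * ((q * R * (2 + 16 / \<alpha> * (1 + 2 * ln T))) * (1 + 2 * ln T)))"
        proof (rule mult_mono[OF hq])
          have "(\<Sum>l<h. (?S l)\<^sup>2) \<le> (\<alpha> * ln Y + 1) * ((h + 8 * real Y / \<alpha> * (1 + ln Y)) * (1 + ln Y))"
            using zeta_sum_mean_square[OF \<alpha>, of Y h] Y0 by simp
          also have "\<dots> \<le> (2 * \<alpha> * ln T + 1) * ((q * R * (2 + 16 / \<alpha> * (1 + 2 * ln T))) * (1 + 2 * ln T))"
          proof -
            define m where "m = q * R"
            have n1: "\<alpha> * ln Y + 1 \<le> 2 * \<alpha> * ln T + 1" using \<alpha> lnY by simp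
            have z1: "0 \<le> 1 + ln Y" "0 \<le> 2 * \<alpha> * ln T + 1" using lnY0 \<alpha> lnT by simp_all
            have n3: "1 + ln Y \<le> 1 + 2 * ln T" using lnY by simp
            have z2: "0 \<le> 8 * real Y / \<alpha> * (1 + ln Y)" using \<alpha> z1 by simp
            have m: "real Y \<le> 2 * m" "m \<ge> 0" using Y qR unfolding m_def by linarith+
            hence "8 * real Y \<le> 8 * (2 * m)" by linarith
            hence le: "8 * real Y / \<alpha> \<le> 8 * (2 * m) / \<alpha>" using \<alpha> by (rule divide_right_mono[OF _ less_imp_le])
            have "0 \<le> 8 * (2 * m) / \<alpha>" using m \<alpha> by simp
            from mult_mono[OF le n3 this z1(1)]
            have "8 * real Y / \<alpha> * (1 + ln Y) \<le> 8 * (2 * m) / \<alpha> * (1 + 2 * ln T)" .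
            moreover have "2 * q \<le> m * 2" unfolding m_def using R1 q2 by simp
            ultimately have "h + 8 * real Y / \<alpha> * (1 + ln Y) \<le> m * 2 + 8 * (2 * m) / \<alpha> * (1 + 2 * ln T)"
              using hq by linarith
            also have "8 * (2 * m) / \<alpha> = m * (16 / \<alpha>)" by simp
            finally have n2: "h + 8 * real Y / \<alpha> * (1 + ln Y) \<le> m * (2 + 16 / \<alpha> * (1 + 2 * ln T))"
              by (simp only: distrib_left mult.assoc)
            have z3: "0 \<le> h + 8 * real Y / \<alpha> * (1 + ln Y)" using z2 by linarith
            have z4: "0 \<le> m * (2 + 16 / \<alpha> * (1 + 2 * ln T))" using n2 z3 by linarith
            show ?thesis unfolding m_def[symmetric]
              by (rule mult_mono[OF n1 mult_mono[OF n2 n3 z4 z1(1)] z1(2) mult_nonneg_nonneg[OF z3 z1(1)]])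
          qed
          finally show "(\<Sum>l<h. (?S l)\<^sup>2) \<le> (2 * \<alpha> * ln T + 1) * ((q * R * (2 + 16 / \<alpha> * (1 + 2 * ln T))) * (1 + 2 * ln T))" .
        qed (use q2 in \<open>auto intro!: sum_nonneg\<close>)
        also have "\<dots> = (q * q * R) * D T" unfolding D_def by (simp only: mult_ac)
        \<comment> \<open>One factor \<open>R\<close> and one factor \<open>D T\<close> are given
          away to reach a perfect square.\<close>
        also have "\<dots> \<le> (q * q * (R * R)) * (D T * D T)"
          using q2 R1 D1 mult_mono[of 1 R 1 R] by (intro mult_mono) auto
        also have "\<dots> = (q * R * D T)\<^sup>2" by (simp only: power2_eq_square mult_ac)
        finally show "(\<Sum>l<h. ?S l)\<^sup>2 \<le> (q * R * D T)\<^sup>2" .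
        show "0 \<le> q * R * D T" using q2 R1 D1 by simp
      qed
      have "(\<Sum>l<h. ?P l) \<le> (\<Sum>l\<in>insert 0 {1..<h}. ?P l)" by (intro sum_mono2) auto
      also have "\<dots> = ?P 0 + (\<Sum>l\<in>{1..<h}. ?P l)" by simp
      also have "?P 0 \<le> 4 * sqrt X" using zeta_smooth_sum_at_0[of X] by simp
      also have "(\<Sum>l\<in>{1..<h}. ?P l) \<le> (\<Sum>l\<in>{1..<h}. ?S l + (2 * Z + 1) + sqrt Y / \<alpha> * inverse (real l) + 8 * sqrt X / \<alpha>\<^sup>2 * (1 / (real l)\<^sup>2))"
        by (rule sum_mono[OF pt])
      also have "\<dots> \<le> (\<Sum>l<h. ?S l) + real h * (2 * Z + 1) + sqrt Y / \<alpha> * (1 + ln T) + 8 * sqrt X / \<alpha>\<^sup>2 * 2"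
      proof (cases "h = 0")
        case True
        thus ?thesis using \<alpha> lnT by simp
      next
        case False
        have a: "(\<Sum>l\<in>{1..<h}. ?S l) \<le> (\<Sum>l<h. ?S l)" by (intro sum_mono2) auto
        have b: "(\<Sum>l\<in>{1..<h}. 2 * Z + 1) \<le> real h * (2 * Z + 1)"
          using Z0 by (simp add: mult_right_mono)
        have "(\<Sum>l\<in>{1..<h}. inverse (real l)) \<le> harm h" unfolding harm_def by (intro sum_mono2) auto
        also have "\<dots> \<le> 1 + ln h" using False by (intro harm_le_Suc_ln) auto
        also have "ln h \<le> ln T"
        proof -
          have "real h \<le> q * q" using hq q2 mult_right_mono[of 2 q q] by linarith
          thus ?thesis using False T qq by (subst ln_le_cancel_iff) auto
        qed
        finally have c: "(\<Sum>l\<in>{1..<h}. sqrt Y / \<alpha> * inverse (real l)) \<le> sqrt Y / \<alpha> * (1 + ln T)"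
          unfolding sum_distrib_left[symmetric] using \<alpha> by (intro mult_left_mono) auto
        have "(\<Sum>l\<in>{1..<h}. 1 / (real l)\<^sup>2) \<le> (\<Sum>l\<in>{1..h}. 1 / (real l)\<^sup>2)" by (intro sum_mono2) auto
        also have "\<dots> \<le> 2" by (rule sum_inverse_squares_le)
        finally have d: "(\<Sum>l\<in>{1..<h}. 8 * sqrt X / \<alpha>\<^sup>2 * (1 / (real l)\<^sup>2)) \<le> 8 * sqrt X / \<alpha>\<^sup>2 * 2"
          unfolding sum_distrib_left[symmetric] using \<alpha> by (intro mult_left_mono) auto
        show ?thesis using add_mono[OF add_mono[OF add_mono[OF a b] c] d] by (simp only: sum.distrib)
      qed
      also have "\<dots> \<le> q * R * D T + (2 * (q * R)) * (2 * Z + 1) + (2 * (q * R)) / \<alpha> * (1 + ln T) + 8 * (2 * (q * R)) / \<alpha>\<^sup>2 * 2"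
      proof -
        have "2 * q * 1 \<le> 2 * q * R" using q2 R1 by (intro mult_left_mono) auto
        hence "real h \<le> 2 * (q * R)" using hq by simp
        hence t2: "real h * (2 * Z + 1) \<le> (2 * (q * R)) * (2 * Z + 1)" by (rule mult_right_mono) (use Z0 in simp)
        have t3: "sqrt Y / \<alpha> * (1 + ln T) \<le> (2 * (q * R)) / \<alpha> * (1 + ln T)"
          by (rule mult_right_mono[OF divide_right_mono[OF sqY]]) (use \<alpha> lnT in simp_all)
        have "8 * sqrt X \<le> 8 * (2 * (q * R))" using sqX by linarith
        hence "8 * sqrt X / \<alpha>\<^sup>2 \<le> 8 * (2 * (q * R)) / \<alpha>\<^sup>2" by (rule divide_right_mono) simp
        hence t4: "8 * sqrt X / \<alpha>\<^sup>2 * 2 \<le> 8 * (2 * (q * R)) / \<alpha>\<^sup>2 * 2" by (rule mult_right_mono) simp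
        show ?thesis by (rule add_mono[OF add_mono[OF add_mono[OF sumS t2] t3] t4])
      qed
      finally have "(\<Sum>l<h. ?P l) \<le> 4 * (2 * (q * R)) + (q * R * D T + (2 * (q * R)) * (2 * Z + 1) + (2 * (q * R)) / \<alpha> * (1 + ln T) + 8 * (2 * (q * R)) / \<alpha>\<^sup>2 * 2)"
        using sqX by linarith
      also have "\<dots> = (q * R) * (D T + 2 * (2 * Z + 1) + 2 / \<alpha> * (1 + ln T) + 32 / \<alpha>\<^sup>2 + 8)"
      proof -
        define m where "m = q * R"
        show ?thesis unfolding m_def[symmetric] by (simp add: field_simps)
      qed
      also have "\<dots> \<le> (q * R) * R" using elim(2) qR unfolding R_def[symmetric] by (intro mult_left_mono) auto
      finally show "(\<Sum>l<h. ?P l) \<le> sqrt T * (T powr \<epsilon>)\<^sup>2"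
        unfolding R_def[symmetric] q_def[symmetric] by (simp add: power2_eq_square mult.assoc)
    qed
  qed
qed

theorem theorem1p2:
  fixes \<alpha> c :: real
  assumes "\<alpha> > 0" and "c < 1 / sqrt 2"
  shows "\<forall>\<^sub>F N in sequentially. N \<ge> 1 \<and>
    (\<exists>l::int. sqrt (real N) \<le> real_of_int l \<and> real_of_int l \<le> real N * ln (real N) \<and>
      norm (riemann_zeta (Complex (1/2) (\<alpha> * real_of_int l)))
        \<ge> exp (c * sqrt (ln (real N) * ln (ln (ln (real N))) / ln (ln (real N)))))"
proof -
  have \<alpha>: "\<alpha> > 0" by fact
  \<comment> \<open>Raising c makes it positive and loses nothing; the gap between \<open>c0\<close>
    and the later \<open>d\<close> will absorb all constants.\<close>
  define c0 where "c0 = max c (1/2)"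
  have "1/2 < 1 / sqrt (2::real)" using sqrt2_less_2 by (simp add: field_simps)
  hence "c0 < 1 / sqrt 2" using assms(2) unfolding c0_def by simp
  then obtain d where d: "c0 < d" "d < 1 / sqrt 2" using dense by blast
  have d0: "d > 0" using d(1) unfolding c0_def by linarith
  have "d\<^sup>2 < (1 / sqrt 2)\<^sup>2" using d d0 by (intro power_strict_mono) auto
  hence d2: "d\<^sup>2 < 1/2" by (simp add: power_divide)
  \<comment> \<open>This makes \<theta> = 1/2 - 4\<epsilon> the midpoint of d^2 and 1/2. Of the
    reserve 4\<epsilon>, the short range consumes 2\<epsilon>.\<close>
  define \<epsilon> where "\<epsilon> = (1/2 - d\<^sup>2) / 8"
  have \<epsilon>: "0 < \<epsilon>" "\<epsilon> \<le> 1" using d2 unfolding \<epsilon>_def by (auto simp: field_simps)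
  define \<theta> where "\<theta> = 1/2 - 4 * \<epsilon>"
  have \<theta>: "d\<^sup>2 < \<theta>" using d2 unfolding \<theta>_def \<epsilon>_def by (simp add: field_simps)
  define s where "s = (\<lambda>T::real. sqrt (ln T * ln (ln (ln T)) / ln (ln T)))"
  define Z where "Z = zeta_error"
  have ev1: "eventually (\<lambda>T::real. T \<ge> 4) at_top" by (rule eventually_ge_at_top)
  have ev2: "eventually (\<lambda>T::real. ln T \<ge> 1) at_top" by real_asymp
  have "filterlim (\<lambda>T::real. ln T) at_top at_top" by real_asymp
  note ev3 = eventually_compose_filterlim[OF resonator_exists[OF d0 \<theta>] this]
  note ev4 = zeta_sums_approx_eventually[OF \<alpha> \<epsilon>(1)]
  note ev5 = zeta_smooth_sum_short_mean[OF \<alpha> \<epsilon>]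
  \<comment> \<open>The constants are those of the resonance inequality: 32 = 4 * 8 in front of the
    pointwise bound V + Z + 2 for \<open>P\<close>, and 8 = 4 * 2 from the short range.\<close>
  have ev6: "eventually (\<lambda>T. 32 * exp (c0 * s T) + 32 * (Z + 2) + 8 < exp (d * s T)) at_top"
  proof -
    have "filterlim s at_top at_top" unfolding s_def by real_asymp
    moreover have "eventually (\<lambda>x. 32 * exp (c0 * x) + 32 * (Z + 2) + 8 < exp (d * x)) at_top"
    proof -
      define \<eta> where "\<eta> = d - c0"
      have "\<eta> > 0" unfolding \<eta>_def using d by simp
      hence "eventually (\<lambda>x. 32 + \<bar>32 * (Z + 2) + 8\<bar> < exp (\<eta> * x)) at_top" by real_asymp
      moreover have "eventually (\<lambda>x::real. x \<ge> 0) at_top" by (rule eventually_ge_at_top)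
      ultimately show ?thesis
      proof eventually_elim
        case (elim x)
        have "c0 \<ge> 0" unfolding c0_def by simp
        hence e1: "exp (c0 * x) \<ge> 1" using elim(2) by simp
        have "32 * exp (c0 * x) + 32 * (Z + 2) + 8 \<le> 32 * exp (c0 * x) + \<bar>32 * (Z + 2) + 8\<bar> * exp (c0 * x)"
          using mult_left_mono[OF e1, of "\<bar>32 * (Z + 2) + 8\<bar>"] by simp
        also have "\<dots> = (32 + \<bar>32 * (Z + 2) + 8\<bar>) * exp (c0 * x)" by (simp only: distrib_right)
        also have "\<dots> < exp (\<eta> * x) * exp (c0 * x)" by (intro mult_strict_right_mono elim(1)) simp
        also have "\<dots> = exp (d * x)" unfolding \<eta>_def by (simp add: exp_add[symmetric] algebra_simps)
        finally show ?case .
      qed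
    qed
    ultimately show ?thesis by (rule eventually_compose_filterlim[rotated])
  qed
  \<comment> \<open>At l \<ge> sqrt T the averaged polar term is of order T^((1 + \<epsilon>)/2 - 1)
    and tends to 0; with a sharp truncation the exponent would be \<epsilon>/2.\<close>
  have ev7: "eventually (\<lambda>T::real. 8 * sqrt (2 * T powr (1 + \<epsilon>)) / (\<alpha>\<^sup>2 * T) \<le> 1) at_top"
  proof -
    define \<beta> where "\<beta> = (1 - \<epsilon>) / 2"
    have "8 * \<epsilon> = 1/2 - d\<^sup>2" unfolding \<epsilon>_def by simp
    hence "\<epsilon> < 1" using zero_le_power2[of d] by linarith
    hence "\<beta> > 0" unfolding \<beta>_def by simp
    hence "eventually (\<lambda>T::real. T powr \<beta> \<ge> 16 / \<alpha>\<^sup>2) at_top" by real_asymp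
    thus ?thesis using ev1
    proof eventually_elim
      case (elim T)
      have "sqrt (2 * T powr (1 + \<epsilon>)) \<le> sqrt (4 * T powr (1 + \<epsilon>))" by (intro real_sqrt_le_mono) auto
      also have "\<dots> = 2 * sqrt (T powr (1 + \<epsilon>))" by (simp add: real_sqrt_mult)
      also have "sqrt (T powr (1 + \<epsilon>)) = T powr ((1 + \<epsilon>) / 2)"
        using elim by (simp add: powr_half_sqrt[symmetric] powr_powr)
      finally have "sqrt (2 * T powr (1 + \<epsilon>)) \<le> 2 * T powr ((1 + \<epsilon>) / 2)" .
      hence "8 * sqrt (2 * T powr (1 + \<epsilon>)) \<le> 16 * T powr ((1 + \<epsilon>) / 2)" by simp
      also have "\<dots> \<le> (\<alpha>\<^sup>2 * T powr \<beta>) * T powr ((1 + \<epsilon>) / 2)"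
        using elim(1) \<alpha> by (intro mult_right_mono) (auto simp: field_simps)
      also have "\<dots> = \<alpha>\<^sup>2 * (T powr \<beta> * T powr ((1 + \<epsilon>) / 2))" by simp
      also have "T powr \<beta> * T powr ((1 + \<epsilon>) / 2) = T powr 1"
        unfolding \<beta>_def powr_add[symmetric] by (rule arg_cong[where f = "(powr) T"]) (simp add: field_simps)
      also have "T powr 1 = T" using elim by simp
      finally show ?case using elim \<alpha> by (subst pos_divide_le_eq) auto
    qed
  qed
  have ev8: "eventually (\<lambda>T. s T \<ge> 0) at_top" unfolding s_def by real_asymp
  have "eventually (\<lambda>T::real. \<forall>N::nat. T = real N \<longrightarrow> (N \<ge> 1 \<and>
    (\<exists>l::int. sqrt (real N) \<le> real_of_int l \<and> real_of_int l \<le> real N * ln (real N) \<and>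
      norm (riemann_zeta (Complex (1/2) (\<alpha> * real_of_int l))) \<ge> exp (c * s T)))) at_top"
    using ev1 ev2 ev3 ev4 ev5 ev6 ev7 ev8
  proof eventually_elim
    case (elim T)
    show ?case
    proof (intro allI impI)
      fix N :: nat assume TN: "T = real N"
      have T4: "T \<ge> 4" by (rule elim(1))
      define V where "V = exp (c0 * s T)"
      define R where "R = T powr \<epsilon>"
      have R1: "R \<ge> 1" unfolding R_def using T4 \<epsilon> by (intro ge_one_powr_ge_zero) auto
      have s0: "c * s T \<le> c0 * s T"
        using elim(8) unfolding c0_def by (intro mult_right_mono) auto
      \<comment> \<open>A large value is found already below N; the factor ln N \<ge> 1 in the
        allowed range is then free.\<close>
      have "\<exists>l::nat. sqrt T \<le> real l \<and> l < N \<and> norm (riemann_zeta (Complex (1/2) (\<alpha> * l))) \<ge> V"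
      proof (rule ccontr)
        assume "\<not> ?thesis"
        hence small: "norm (riemann_zeta (Complex (1/2) (\<alpha> * l))) < V" if "sqrt T \<le> l" "l < N" for l :: nat
          using that by force
        obtain f I E where res: "finite I" "0 \<notin> I" "\<And>m. f m \<ge> 0" "(\<Sum>m\<in>I. (f m)\<^sup>2) > (0::real)"
          "real (card I) \<le> exp (\<theta> * ln T)"
          "\<forall>(k, m)\<in>E. 0 < k \<and> m \<in> I \<and> k * m \<in> I \<and> real k \<le> exp (ln T)"
          "exp (d * s T) * (\<Sum>m\<in>I. (f m)\<^sup>2) \<le> (\<Sum>(k,m)\<in>E. 1 / sqrt (real k) * (f m * f (k * m)))"
          using elim(3) unfolding s_def by blast
        define X where "X = nat \<lceil>T powr (1 + \<epsilon>)\<rceil>"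
        have TR: "T powr (1 + \<epsilon>) = T * R" unfolding R_def using T4 by (simp add: powr_add)
        have TR4: "T * R \<ge> 4" using T4 R1 mult_mono[of 4 T 1 R] by simp
        have X: "T powr (1 + \<epsilon>) \<le> X" "X \<le> 2 * T powr (1 + \<epsilon>)" unfolding X_def TR using TR4 by linarith+
        have XN: "N \<le> X"
        proof -
          have "real N \<le> T * R" unfolding TN[symmetric] using T4 R1 by (simp add: mult_le_cancel_left1)
          thus ?thesis using X(1) unfolding TR by linarith
        qed
        have X0: "X > 0" using XN T4 TN by (cases X) auto
        define h where "h = nat \<lceil>sqrt T\<rceil>"
        have sT: "sqrt T \<ge> 0" using T4 by simp
        have h: "h \<le> sqrt T + 1" "\<And>l::nat. h \<le> l \<Longrightarrow> sqrt T \<le> l" unfolding h_def using sT by linarith+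
        define P where "P = (\<lambda>l::int. \<Sum>k\<in>{1..2*X}. of_real (smooth_weight X k) * cis (- (of_int l * (\<alpha> * ln (real k)))))"
        have P_eq: "P (int l) = zeta_smooth_sum X (Complex (1/2) (\<alpha> * real l))" for l
          unfolding P_def zeta_smooth_sum_eq ..
        have Pbig: "norm (P (int l)) \<le> V + Z + 2" if l: "h \<le> l" "l < N" for l
        proof -
          have lq: "sqrt T \<le> l" using h l by simp
          have "sqrt T \<ge> 2" using T4 real_le_rsqrt[of 2 T] by simp
          hence l1: "1 \<le> l" "real l \<le> T" using lq l TN by linarith+
          have "norm (zeta_smooth_sum X (Complex (1/2) (\<alpha> * l)) - riemann_zeta (Complex (1/2) (\<alpha> * l))) \<le>
              Z + 1 + 8 * sqrt X / (\<alpha> * l)\<^sup>2"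
            using elim(4) l1 X(1) unfolding Z_def by blast
          moreover have "8 * sqrt X / (\<alpha> * l)\<^sup>2 \<le> 8 * sqrt (2 * T powr (1 + \<epsilon>)) / (\<alpha>\<^sup>2 * T)"
          proof (intro frac_le mult_left_mono real_sqrt_le_mono X(2))
            have "T = (sqrt T)\<^sup>2" using T4 by simp
            also have "\<dots> \<le> (real l)\<^sup>2" using lq sT by (intro power_mono) auto
            finally show "\<alpha>\<^sup>2 * T \<le> (\<alpha> * l)\<^sup>2" by (simp add: power_mult_distrib mult_left_mono)
          qed (use \<alpha> T4 in auto)
          moreover note elim(7)
          moreover have "norm (riemann_zeta (Complex (1/2) (\<alpha> * l))) < V" using small lq l by blast
          moreover have "norm (P (int l)) \<le> norm (riemann_zeta (Complex (1/2) (\<alpha> * l))) +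
             norm (zeta_smooth_sum X (Complex (1/2) (\<alpha> * l)) - riemann_zeta (Complex (1/2) (\<alpha> * l)))"
            unfolding P_eq by (rule norm_triangle_sub)
          ultimately show ?thesis by linarith
        qed
        have Psmall: "(\<Sum>l<h. norm (P (int l))) \<le> sqrt T * R\<^sup>2"
          unfolding P_eq R_def using elim(5) X h(1) by blast
        have V0: "V > 0" unfolding V_def by simp
        have Z0: "Z > 0" unfolding Z_def using zeta_error_ge by linarith
        have key: "real N * (\<Sum>(k,m)\<in>E. smooth_weight X k * (f m * f (k * m))) \<le>
            4 * (8 * N * (V + Z + 2) + 2 * (sqrt T * R\<^sup>2) * card I) * (\<Sum>m\<in>I. (f m)\<^sup>2)"
        proof (rule resonance_inequality[where A = "{1..2*X}" and x = "\<lambda>k. \<alpha> * ln (real k)" and h = h])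
          show "N > 0" using T4 TN by (cases N) auto
          show "finite I" by (rule res)
          show "smooth_weight X k \<ge> 0" for k by (rule smooth_weight_nonneg)
          show "f m \<ge> 0" for m by (rule res)
          have "k \<in> {1..2*X} \<and> m \<in> I" if "(k, m) \<in> E" for k m
          proof -
            have "0 < k" "m \<in> I" "real k \<le> T" using res(6) that T4 by auto
            thus ?thesis using XN TN by auto
          qed
          thus "E \<subseteq> {1..2*X} \<times> I" by auto
          show "0 < k \<and> k * m \<in> I \<and> \<alpha> * ln (real (k * m)) = \<alpha> * ln (real k) + \<alpha> * ln (real m)"
            if "(k, m) \<in> E" for k m
          proof -
            have km: "0 < k" "m \<in> I" "k * m \<in> I" using res(6) that by auto
            hence "m > 0" using res(2) by (cases m) auto
            thus ?thesis using km by (simp add: ln_mult distrib_left)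
          qed
          show "0 \<le> V + Z + 2" using V0 Z0 by simp
          show "norm (\<Sum>k\<in>{1..2*X}. of_real (smooth_weight X k) * cis (- (of_int (int l) * (\<alpha> * ln (real k))))) \<le> V + Z + 2"
            if "h \<le> l" "l < N" for l using Pbig[OF that] unfolding P_def .
          show "(\<Sum>l<h. norm (\<Sum>k\<in>{1..2*X}. of_real (smooth_weight X k) * cis (- (of_int (int l) * (\<alpha> * ln (real k)))))) \<le> sqrt T * R\<^sup>2"
            using Psmall unfolding P_def .
        qed simp
        have "(\<Sum>(k,m)\<in>E. smooth_weight X k * (f m * f (k * m))) = (\<Sum>(k,m)\<in>E. 1 / sqrt (real k) * (f m * f (k * m)))"
        proof (intro sum.cong refl, clarify)
          fix k m assume "(k, m) \<in> E"
          hence "real k \<le> T" using res(6) T4 by auto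
          hence "k \<le> X" using XN TN by simp
          thus "smooth_weight X k * (f m * f (k * m)) = 1 / sqrt (real k) * (f m * f (k * m))"
            using X0 by (simp add: smooth_weight_eq)
        qed
        hence "real N * (exp (d * s T) * (\<Sum>m\<in>I. (f m)\<^sup>2)) \<le>
            4 * (8 * N * (V + Z + 2) + 2 * (sqrt T * R\<^sup>2) * card I) * (\<Sum>m\<in>I. (f m)\<^sup>2)"
          using key mult_left_mono[OF res(7), of "real N"] by simp
        hence "(real N * exp (d * s T)) * (\<Sum>m\<in>I. (f m)\<^sup>2) \<le>
            (4 * (8 * N * (V + Z + 2) + 2 * (sqrt T * R\<^sup>2) * card I)) * (\<Sum>m\<in>I. (f m)\<^sup>2)"
          by (simp only: mult.assoc)
        hence main: "real N * exp (d * s T) \<le> 4 * (8 * N * (V + Z + 2) + 2 * (sqrt T * R\<^sup>2) * card I)"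
          using res(4) by (subst (asm) mult_le_cancel_right_pos)
        \<comment> \<open>The exponents add up to 1/2 + 2\<epsilon> + \<theta> = 1 - 2\<epsilon>.
          Here the size of the resonator must stay below sqrt N, which forces \<theta> <
          1/2.\<close>
        have "sqrt T * R\<^sup>2 * card I \<le> T"
        proof -
          have e1: "exp (\<theta> * ln T) = T powr \<theta>" using T4 by (simp add: powr_def)
          have e2: "R\<^sup>2 = T powr (2 * \<epsilon>)" unfolding R_def power2_eq_square powr_add[symmetric] by simp
          have "sqrt T * R\<^sup>2 * card I \<le> sqrt T * R\<^sup>2 * exp (\<theta> * ln T)"
            using res(5) sT by (intro mult_left_mono) auto
          also have "\<dots> = T powr (1/2) * T powr (2 * \<epsilon>) * T powr \<theta>"
            unfolding e1 e2 using T4 by (simp add: powr_half_sqrt)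
          also have "\<dots> = T powr (1 - 2 * \<epsilon>)" unfolding \<theta>_def by (simp add: powr_add[symmetric])
          also have "\<dots> \<le> T powr 1" using T4 \<epsilon> by (intro powr_mono) auto
          finally show ?thesis using T4 by simp
        qed
        hence "real N * exp (d * s T) \<le> real N * (32 * (V + Z + 2) + 8)"
          using main TN by (simp add: algebra_simps)
        hence "exp (d * s T) \<le> 32 * (V + Z + 2) + 8" using T4 TN by (subst (asm) mult_le_cancel_left_pos) auto
        thus False using elim(6) unfolding V_def by simp
      qed
      then obtain l :: nat where "sqrt T \<le> l \<and> l < N \<and> norm (riemann_zeta (Complex (1/2) (\<alpha> * l))) \<ge> V" ..
      hence l: "sqrt T \<le> l" "l < N" "norm (riemann_zeta (Complex (1/2) (\<alpha> * l))) \<ge> V" by blast+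
      have "real l \<le> real N * 1" using l by simp
      also have "\<dots> \<le> real N * ln (real N)" using elim(2) TN by (intro mult_left_mono) auto
      finally have l2: "real l \<le> real N * ln (real N)" .
      have "exp (c * s T) \<le> V" unfolding V_def using s0 by simp
      hence "norm (riemann_zeta (Complex (1/2) (\<alpha> * real_of_int (int l)))) \<ge> exp (c * s T)" using l(3) by simp
      thus "N \<ge> 1 \<and> (\<exists>l::int. sqrt (real N) \<le> real_of_int l \<and> real_of_int l \<le> real N * ln (real N) \<and>
          norm (riemann_zeta (Complex (1/2) (\<alpha> * real_of_int l))) \<ge> exp (c * s T))"
        using l l2 TN by (intro conjI exI[of _ "int l"]) auto
    qed
  qed
  from eventually_compose_filterlim[OF this filterlim_real_sequentially]
  show ?thesis unfolding s_def by eventually_elim blast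
qed

end
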